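(* Let $f(\underline x)=g(\underline x)e^{-|\underline x|^2/4}\in L^2(\mathbb R^m)$. Then \[ \mathcal M\big(\mathcal B[f](\underline z)\big)=\frac{1}{(2\pi)^{m/2}}\int_{\mathbb R^m}E(\underline z,\underline x)\,g(\underline x)\,e^{-|\underline x|^2/2}\,d\underline x=\big[E(\underline z,\underline x)^\dagger,g(\underline x)\big], \] where $\mathcal B$ is the Segal-Bargmann-Fock transform, $\mathcal M$ is the projection of a function onto its monogenic part in the complex monogenic Fischer decomposition, $E$ is the Fourier-Borel kernel, and $[\cdot,\cdot]$ denotes the Fischer inner product $[R,S]=R(\partial_{\underline x})^\dagger S(\underline x)\vert_{\underline x=\underline 0}$, taken in the variable $\underline x$. In particular, when $g$ is monogenic, one obtains $\mathcal M\big(\mathcal B[f](\underline z)\big)=g(\underline z)$.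
   Context: $\mathbb R_m$ is the real Clifford algebra generated by $e_1,\dots,e_m$ with $e_je_k+e_ke_j=-2\delta_{jk}$, and $\mathbb C_m=\mathbb R_m\oplus i\,\mathbb R_m$ is its complexification; functions take values in $\mathbb C_m$. Conjugation on $\mathbb R_m$ is the linear anti-automorphism with $\overline{e_j}=-e_j$; the Hermitian conjugation on $\mathbb C_m$ is $(a+ib)^\dagger=\overline a-i\overline b$ for $a,b\in\mathbb R_m$. Vectors in $\mathbb R^m$ and $\mathbb C^m$ are identified with $\underline x=\sum_j x_je_j$ and $\underline z=\sum_j z_je_j$; $|\underline x|^2=\sum_j x_j^2$. Dirac operators: $\partial_{\underline x}=\sum_j e_j\partial_{x_j}$ and $\partial_{\underline z}=\sum_j e_j\partial_{z_j}$, acting from the left. A function $g$ on $\mathbb R^m$ is monogenic if it is continuously differentiable with $\partial_{\underline x}g=0$; then $g(\underline z)$ denotes its holomorphic extension to $\mathbb C^m$. Monogenic part: every homogeneous polynomial $R_k$ of degree $k$ has a unique Fischer decomposition $R_k(\underline x)=M_k(\underline x)+\underline x R_{k-1}(\underline x)$ with $M_k,R_{k-1}$ homogeneous polynomials of degrees $k$ and $k-1$ and $\partial_{\underline x}M_k=0$; put $\mathcal M(R_k)=M_k$. For a function with homogeneous expansion $\sum_k R_k$ at the origin, its monogenic part is $\sum_k\mathcal M(R_k)$. The complex version, for entire holomorphic functions of $\underline z\in\mathbb C^m$, uses $\underline z$, $\partial_{\underline z}$ in place of $\underline x$, $\partial_{\underline x}$. Fourier-Borel kernel: for $\underline x,\underline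 u\in\mathbb R^m$, $E(\underline x,\underline u)$ is the monogenic part, with respect to $\underline x$, of $e^{\langle\underline x,\underline u\rangle}$, where $\langle\underline x,\underline u\rangle=\sum_j x_ju_j$; $E(\underline z,\underline u)$ denotes its holomorphic extension to $\underline z\in\mathbb C^m$ in the first variable. Fischer inner product: in $[R,S]=R(\partial_{\underline x})^\dagger S(\underline x)\vert_{\underline x=\underline 0}$, the operator $R(\partial_{\underline x})^\dagger$ is obtained from the power series of $R$ in $x_1,\dots,x_m$ by replacing each $x_j$ by $\partial_{x_j}$ and each coefficient by its Hermitian conjugate (coefficients multiply from the left); the inner product is considered on real analytic functions. The Segal-Bargmann-Fock transform of $f\in L^2(\mathbb R^m)$ is \[\mathcal B[f](\underline z)=\frac{1}{(2\pi)^{m/2}}\int_{\mathbb R^m}\exp\left(-\frac{\underline z\cdot\underline z}{2}+\underline x\cdot\underline z-\frac{\underline x\cdot\underline x}{4}\right)f(\underline x)\,d\underline x,\qquad \underline x\cdot\underline z=\sum_{j=1}^m x_jz_j,\] and similarly $\underline z\cdot\underline z=\sum_j z_j^2$, $\underline x\cdot\underline x=\sum_j x_j^2$; it is applied componentwise to $\mathbb C_m$-valued functions.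
   Formalization: The second equality (integral = Fischer inner product) is stated only for harmonic g, which includes monogenic g; it fails in general: for g = |x|^2, z = 0 the integral is m but the Fischer product is 0. *)

theory Defs
  imports "HOL-Analysis.Analysis"
begin

section \<open>The complex Clifford algebra\<close>

text \<open>
  An element is given by its complex coordinates with respect to the basis
  \<open>e\<^sub>A = e\<^sub>a\<^sub>1 \<dots> e\<^sub>a\<^sub>k\<close>, where \<open>A = {a\<^sub>1 < \<dots> < a\<^sub>k}\<close> ranges over the sets of indices; the
  dimension \<open>m\<close> is \<open>CARD('m)\<close>. The type carries the Euclidean norm of the coordinates.
  The product of the vector type itself is componentwise, so the Clifford product is a
  separate operation. Complex multiples are written \<open>c *s a\<close>.
\<close>

type_synonym 'm rspace = "real ^ 'm"
type_synonym 'm cspace = "complex ^ 'm"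
type_synonym 'm clifford = "complex ^ ('m set)"

definition cl_basis :: "'m::{finite,linorder} set \<Rightarrow> 'm clifford" where
  "cl_basis A = axis A 1"

abbreviation cl_one :: "'m::{finite,linorder} clifford" where
  "cl_one \<equiv> cl_basis {}"

abbreviation cl_e :: "'m::{finite,linorder} \<Rightarrow> 'm clifford" where
  "cl_e j \<equiv> cl_basis {j}"

text \<open>
  \<open>e\<^sub>A e\<^sub>B\<close> is \<open>e\<^sub>C\<close> up to sign, \<open>C\<close> being the symmetric difference. Sorting contributes a factor \<open>-1\<close>
  for every \<open>a \<in> A\<close>, \<open>b \<in> B\<close> with \<open>b < a\<close>, and every \<open>a = b\<close> contributes \<open>-1\<close> through \<open>e\<^sub>a\<^sup>2 = -1\<close>.
\<close>

definition cl_sign :: "'m::{finite,linorder} set \<Rightarrow> 'm set \<Rightarrow> complex" where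
  "cl_sign A B = (-1) ^ card {(a, b). a \<in> A \<and> b \<in> B \<and> b \<le> a}"

definition cl_mult :: "'m::{finite,linorder} clifford \<Rightarrow> 'm clifford \<Rightarrow> 'm clifford"
    (infixl "\<odot>" 70) where
  "x \<odot> y = (\<chi> C. \<Sum>A\<in>UNIV. \<Sum>B\<in>UNIV.
      if sym_diff A B = C then cl_sign A B * x $ A * y $ B else 0)"

text \<open>
  Conjugation reverses the \<open>k = card A\<close> factors of \<open>e\<^sub>A\<close> and negates each of them, which gives
  the sign \<open>(-1)^(k(k-1)/2) (-1)^k\<close>; the coefficients are conjugated in \<open>\<complex>\<close>.
\<close>

definition cl_hconj :: "'m::{finite,linorder} clifford \<Rightarrow> 'm clifford" where
  "cl_hconj x = (\<chi> A. (-1) ^ (card A * (card A + 1) div 2) * cnj (x $ A))"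

definition cvector :: "'m cspace \<Rightarrow> 'm::{finite,linorder} clifford" where
  "cvector z = (\<Sum>j\<in>UNIV. (z $ j) *s cl_e j)"

definition complexify :: "'m::finite rspace \<Rightarrow> 'm cspace" where
  "complexify x = (\<chi> j. complex_of_real (x $ j))"

definition rvector :: "'m rspace \<Rightarrow> 'm::{finite,linorder} clifford" where
  "rvector x = (\<Sum>j\<in>UNIV. (x $ j) *\<^sub>R cl_e j)"

subsection \<open>The defining properties\<close>

lemma cl_mult_nth: "(x \<odot> y) $ C = (\<Sum>A\<in>UNIV. cl_sign A (sym_diff A C) * x $ A * y $ sym_diff A C)"
proof -
  have "(\<Sum>B\<in>UNIV. if sym_diff A B = C then cl_sign A B * x $ A * y $ B else 0)
      = cl_sign A (sym_diff A C) * x $ A * y $ sym_diff A C" for A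
  proof -
    have "sym_diff A B = C \<longleftrightarrow> B = sym_diff A C" for B by blast
    then show ?thesis by simp
  qed
  then show ?thesis by (simp add: cl_mult_def)
qed

lemma cl_sign_prod: "cl_sign A B = (\<Prod>a\<in>A. \<Prod>b\<in>B. if b \<le> a then -1 else 1)"
proof -
  have "(\<Prod>a\<in>A. \<Prod>b\<in>B. if b \<le> a then -1 else (1::complex))
      = (\<Prod>p\<in>A \<times> B. if snd p \<le> fst p then -1 else 1)"
    by (simp add: prod.cartesian_product case_prod_unfold)
  also have "\<dots> = (\<Prod>p\<in>{p \<in> A \<times> B. snd p \<le> fst p}. -1)"
    by (rule prod.inter_filter [symmetric]) simp
  also have "\<dots> = (-1) ^ card {p \<in> A \<times> B. snd p \<le> fst p}" by simp
  also have "{p \<in> A \<times> B. snd p \<le> fst p} = {(a, b). a \<in> A \<and> b \<in> B \<and> b \<le> a}" by auto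
  finally show ?thesis by (simp add: cl_sign_def)
qed

lemma prod_sym_diff:
  fixes f :: "'a::finite \<Rightarrow> complex"
  assumes "\<And>a. f a * f a = 1"
  shows "prod f (sym_diff A B) = prod f A * prod f B"
proof -
  have A: "prod f A = prod f (A - B) * prod f (A \<inter> B)"
    by (metis finite_code prod.Int_Diff mult.commute)
  have B: "prod f B = prod f (B - A) * prod f (A \<inter> B)"
    by (metis finite_code prod.Int_Diff mult.commute inf_commute)
  have "prod f (A \<inter> B) * prod f (A \<inter> B) = 1"
    using assms by (simp flip: prod.distrib)
  moreover have "prod f (sym_diff A B) = prod f (A - B) * prod f (B - A)"
    by (rule prod.union_disjoint) auto
  ultimately show ?thesis unfolding A B by (simp add: mult.assoc mult.left_commute)
qed

lemma cl_sign_square: "cl_sign A B * cl_sign A B = 1"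
  by (simp add: cl_sign_def flip: power_add)

lemma cl_sign_sym_diff_right: "cl_sign A (sym_diff B C) = cl_sign A B * cl_sign A C"
  unfolding cl_sign_prod by (subst prod_sym_diff) (auto simp: prod.distrib)

lemma cl_sign_sym_diff_left: "cl_sign (sym_diff A B) C = cl_sign A C * cl_sign B C"
  unfolding cl_sign_prod by (subst prod_sym_diff) (auto simp flip: prod.distrib intro!: prod.neutral)

lemma cl_mult_assoc: "(x \<odot> y) \<odot> z = x \<odot> (y \<odot> z)"
proof -
  have "((x \<odot> y) \<odot> z) $ D = (x \<odot> (y \<odot> z)) $ D" for D
  proof -
    have "((x \<odot> y) \<odot> z) $ D = (\<Sum>C\<in>UNIV. \<Sum>A\<in>UNIV. cl_sign C (sym_diff C D) *
        (cl_sign A (sym_diff A C) * x $ A * y $ sym_diff A C) * z $ sym_diff C D)"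
      by (simp add: cl_mult_nth sum_distrib_left sum_distrib_right)
    also have "\<dots> = (\<Sum>A\<in>UNIV. \<Sum>C\<in>UNIV. cl_sign C (sym_diff C D) *
        (cl_sign A (sym_diff A C) * x $ A * y $ sym_diff A C) * z $ sym_diff C D)"
      by (rule sum.swap)
    also have "\<dots> = (\<Sum>A\<in>UNIV. \<Sum>B\<in>UNIV. cl_sign (sym_diff A B) (sym_diff (sym_diff A B) D) *
        (cl_sign A B * x $ A * y $ B) * z $ sym_diff (sym_diff A B) D)"
    proof (rule sum.cong [OF refl])
      fix A :: "'a set"
      have c: "sym_diff A (sym_diff A B) = B" for B by blast
      have "bij (sym_diff A)" by (rule o_bij [of "sym_diff A"]) (auto simp: fun_eq_iff)
      then show "(\<Sum>C\<in>UNIV. cl_sign C (sym_diff C D) *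
          (cl_sign A (sym_diff A C) * x $ A * y $ sym_diff A C) * z $ sym_diff C D) =
        (\<Sum>B\<in>UNIV. cl_sign (sym_diff A B) (sym_diff (sym_diff A B) D) *
          (cl_sign A B * x $ A * y $ B) * z $ sym_diff (sym_diff A B) D)"
        by (subst sum.reindex_bij_betw [symmetric, of "sym_diff A"]) (simp_all add: c)
    qed
    also have "\<dots> = (\<Sum>A\<in>UNIV. \<Sum>B\<in>UNIV. cl_sign A (sym_diff A D) * x $ A *
        (cl_sign B (sym_diff B (sym_diff A D)) * y $ B * z $ sym_diff B (sym_diff A D)))"
    proof (intro sum.cong refl)
      fix A B :: "'a set"
      define E where "E = sym_diff B (sym_diff A D)"
      have 1: "sym_diff (sym_diff A B) D = E" and 2: "sym_diff A D = sym_diff B E"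
        unfolding E_def by blast+
      show "cl_sign (sym_diff A B) (sym_diff (sym_diff A B) D) *
        (cl_sign A B * x $ A * y $ B) * z $ sym_diff (sym_diff A B) D =
        cl_sign A (sym_diff A D) * x $ A *
        (cl_sign B (sym_diff B (sym_diff A D)) * y $ B * z $ sym_diff B (sym_diff A D))"
        unfolding E_def [symmetric] 1
        unfolding 2 cl_sign_sym_diff_left cl_sign_sym_diff_right by simp
    qed
    also have "\<dots> = (x \<odot> (y \<odot> z)) $ D"
      by (simp add: cl_mult_nth sum_distrib_left mult.assoc)
    finally show ?thesis .
  qed
  then show ?thesis by (simp add: vec_eq_iff)
qed

lemma cl_basis_mult: "cl_basis A \<odot> cl_basis B = cl_sign A B *s cl_basis (sym_diff A B)"
proof -
  have "(cl_basis A \<odot> cl_basis B) $ C = (cl_sign A B *s cl_basis (sym_diff A B)) $ C" for C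
  proof -
    have *: "B = sym_diff A C \<longleftrightarrow> sym_diff A B = C" by blast
    have "(cl_basis A \<odot> cl_basis B) $ C
        = (\<Sum>A'\<in>UNIV. if A' = A then if B = sym_diff A C then cl_sign A B else 0 else 0)"
      unfolding cl_mult_nth by (rule sum.cong) (auto simp: cl_basis_def axis_def)
    also have "\<dots> = (if B = sym_diff A C then cl_sign A B else 0)" by simp
    also have "\<dots> = (cl_sign A B *s cl_basis (sym_diff A B)) $ C"
      unfolding * by (simp add: cl_basis_def axis_def)
    finally show ?thesis .
  qed
  then show ?thesis by (simp add: vec_eq_iff)
qed

lemma cl_one_left: "cl_one \<odot> x = x" and cl_one_right: "x \<odot> cl_one = x"
proof -
  have "(cl_one \<odot> x) $ C = (\<Sum>A\<in>(UNIV :: 'a set set). if A = {} then x $ C else 0)" for C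
    unfolding cl_mult_nth
    by (rule sum.cong) (auto simp: cl_basis_def axis_def cl_sign_prod)
  then show "cl_one \<odot> x = x" by (simp add: vec_eq_iff)
  have "(x \<odot> cl_one) $ C = (\<Sum>A\<in>UNIV. if A = C then x $ C else 0)" for C
    unfolding cl_mult_nth
  proof (rule sum.cong [OF refl])
    fix A
    have "sym_diff A C = {} \<longleftrightarrow> A = C" by blast
    then show "cl_sign A (sym_diff A C) * x $ A * (cl_one :: 'a clifford) $ sym_diff A C
        = (if A = C then x $ C else 0)"
      by (auto simp: cl_basis_def axis_def cl_sign_prod)
  qed
  then show "x \<odot> cl_one = x" by (simp add: vec_eq_iff)
qed

lemma cl_e_anticommute:
  "cl_e j \<odot> cl_e k + cl_e k \<odot> cl_e j = (if j = k then -2 else 0) *s cl_one"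
proof (cases "j = k")
  case True
  then show ?thesis
    by (simp add: cl_basis_mult cl_sign_prod vec_eq_iff)
next
  case False
  have "cl_sign {j} {k} = - cl_sign {k} {j}"
    using False by (cases j k rule: linorder_cases) (auto simp: cl_sign_prod)
  moreover have "cl_e k \<odot> cl_e j = cl_sign {k} {j} *s cl_basis (sym_diff {j} {k})"
    by (simp only: cl_basis_mult Un_commute)
  ultimately show ?thesis
    using False by (simp only: cl_basis_mult) (simp add: vec_eq_iff)
qed

lemma cl_basis_insert:
  assumes "\<And>a. a \<in> A \<Longrightarrow> j < a"
  shows "cl_basis (insert j A) = cl_e j \<odot> cl_basis A"
proof -
  have "j \<notin> A" using assms by blast
  then have "sym_diff {j} A = insert j A" by auto
  moreover have "cl_sign {j} A = 1"
    using assms by (auto simp: cl_sign_prod not_le intro!: prod.neutral)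
  ultimately show ?thesis by (simp add: cl_basis_mult)
qed

lemma cl_sign_self: "cl_sign A A = (-1) ^ (card A * (card A + 1) div 2)"
proof -
  have "finite A" by simp
  then show ?thesis
  proof (induction A rule: finite_linorder_max_induct)
    case empty
    then show ?case by (simp add: cl_sign_prod)
  next
    case (insert b A)
    have b: "b \<notin> A" using insert by auto
    then have eq: "insert b A = sym_diff {b} A" by auto
    have 1: "cl_sign A {b} = 1"
      unfolding cl_sign_prod using insert(2) by (intro prod.neutral) auto
    have 2: "cl_sign {b} A = (-1) ^ card A"
    proof -
      have "(\<Prod>a\<in>A. if a \<le> b then -1 else (1::complex)) = (\<Prod>a\<in>A. -1)"
        using insert(2) by (intro prod.cong) (auto dest: less_imp_le)
      then show ?thesis by (simp add: cl_sign_prod)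
    qed
    have 3: "cl_sign {b} {b} = -1" by (simp add: cl_sign_prod)
    have "cl_sign (insert b A) (insert b A) = - ((-1) ^ (card A + card A * (card A + 1) div 2))"
      unfolding eq cl_sign_sym_diff_left cl_sign_sym_diff_right 1 2 3
      by (simp add: insert power_add)
    moreover have "Suc (card A) * (Suc (card A) + 1) div 2
        = Suc (card A + card A * (card A + 1) div 2)"
    proof -
      have "Suc (card A) * (Suc (card A) + 1) = card A * (card A + 1) + 2 * Suc (card A)"
        by (simp add: algebra_simps)
      then show ?thesis by (metis add.commute add_Suc div_mult_self2 zero_neq_numeral)
    qed
    ultimately show ?case using b by simp
  qed
qed

lemma cl_hconj_nth: "cl_hconj x $ A = cl_sign A A * cnj (x $ A)"
  by (simp add: cl_hconj_def cl_sign_self)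

lemma cl_hconj_mult: "cl_hconj (x \<odot> y) = cl_hconj y \<odot> cl_hconj x"
proof -
  have "cl_hconj (x \<odot> y) $ C = (cl_hconj y \<odot> cl_hconj x) $ C" for C
  proof -
    have cnj: "cnj (cl_sign A B) = cl_sign A B" for A B :: "'a set"
      by (simp add: cl_sign_def)
    have "bij (\<lambda>A. sym_diff A C)"
      by (rule o_bij [of "\<lambda>A. sym_diff A C"]) (auto simp: fun_eq_iff)
    then have "(cl_hconj y \<odot> cl_hconj x) $ C = (\<Sum>A\<in>UNIV. (\<lambda>B. cl_sign B (sym_diff B C) *
        cl_hconj y $ B * cl_hconj x $ sym_diff B C) (sym_diff A C))"
      unfolding cl_mult_nth by (rule sum.reindex_bij_betw [symmetric])
    also have "\<dots> = (\<Sum>A\<in>UNIV. cl_sign C C *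
        (cl_sign A (sym_diff A C) * cnj (x $ A) * cnj (y $ sym_diff A C)))"
    proof (rule sum.cong [OF refl])
      fix A :: "'a set"
      define B where "B = sym_diff A C"
      have C: "C = sym_diff A B" and A: "sym_diff B C = A" unfolding B_def by blast+
      have s: "cl_sign C C * cl_sign A B = cl_sign B A * cl_sign B B * cl_sign A A"
        unfolding C cl_sign_sym_diff_left cl_sign_sym_diff_right
        using cl_sign_square [of A B] by (simp add: algebra_simps)
      show "(\<lambda>B. cl_sign B (sym_diff B C) * cl_hconj y $ B * cl_hconj x $ sym_diff B C)
          (sym_diff A C) = cl_sign C C *
          (cl_sign A (sym_diff A C) * cnj (x $ A) * cnj (y $ sym_diff A C))"
        unfolding B_def [symmetric] A cl_hconj_nth
        using arg_cong [OF s, of "\<lambda>t. t * cnj (x $ A) * cnj (y $ B)"]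
        by (auto simp: algebra_simps)
    qed
    also have "\<dots> = cl_hconj (x \<odot> y) $ C"
      by (simp add: cl_hconj_nth cl_mult_nth sum_distrib_left cnj)
    finally show ?thesis by simp
  qed
  then show ?thesis by (simp add: vec_eq_iff)
qed

lemma cl_hconj_e: "cl_hconj (cl_e j) = - cl_e j"
  by (auto simp: cl_hconj_def cl_basis_def axis_def vec_eq_iff)

section \<open>Differential operators\<close>

definition partial_deriv ::
    "'m::finite \<Rightarrow> ('m rspace \<Rightarrow> 'b::real_normed_vector) \<Rightarrow> 'm rspace \<Rightarrow> 'b" where
  "partial_deriv j g x = vector_derivative (\<lambda>t. g (x + t *\<^sub>R axis j 1)) (at 0)"

definition continuously_differentiable ::
    "('m::finite rspace \<Rightarrow> 'b::real_normed_vector) \<Rightarrow> bool" where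
  "continuously_differentiable g \<longleftrightarrow>
     (\<forall>x. g differentiable (at x)) \<and> (\<forall>j. continuous_on UNIV (partial_deriv j g))"

definition dirac ::
    "('m rspace \<Rightarrow> 'm clifford) \<Rightarrow> 'm rspace \<Rightarrow> 'm::{finite,linorder} clifford" where
  "dirac g x = (\<Sum>j\<in>UNIV. cl_e j \<odot> partial_deriv j g x)"

definition monogenic :: "('m rspace \<Rightarrow> 'm::{finite,linorder} clifford) \<Rightarrow> bool" where
  "monogenic g \<longleftrightarrow> continuously_differentiable g \<and> (\<forall>x. dirac g x = 0)"

text \<open>
  Harmonicity delimits where the Fischer inner product with the Fourier-Borel kernel agrees with
  the Gaussian integral. For the real analytic \<open>g x = |x|\<^sup>2\<close> they differ: at \<open>z = 0\<close>, where the kernel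
  is \<open>1\<close>, the normalised integral is \<open>m\<close> and the Fischer inner product is \<open>g 0 = 0\<close>. Every
  monogenic function is harmonic, since the square of the Dirac operator is minus the Laplacian.
\<close>

definition harmonic :: "('m::finite rspace \<Rightarrow> 'b::real_normed_vector) \<Rightarrow> bool" where
  "harmonic g \<longleftrightarrow> continuously_differentiable g \<and>
     (\<forall>j. continuously_differentiable (partial_deriv j g)) \<and>
     (\<forall>x. (\<Sum>j\<in>UNIV. partial_deriv j (partial_deriv j g) x) = 0)"

definition cdirac ::
    "('m cspace \<Rightarrow> 'm clifford) \<Rightarrow> 'm cspace \<Rightarrow> 'm::{finite,linorder} clifford" where
  "cdirac F z = (\<Sum>j\<in>UNIV. cl_e j \<odot> (\<chi> A. deriv (\<lambda>w. F (z + axis j w) $ A) 0))"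

definition entire :: "('m::finite cspace \<Rightarrow> complex ^ 'n::finite) \<Rightarrow> bool" where
  "entire F \<longleftrightarrow> (\<forall>z. \<exists>F'. (F has_derivative F') (at z) \<and> (\<forall>c v. F' (c *s v) = c *s F' v))"

definition is_holomorphic_extension ::
    "('m::finite rspace \<Rightarrow> complex ^ 'n::finite) \<Rightarrow> ('m cspace \<Rightarrow> complex ^ 'n) \<Rightarrow> bool" where
  "is_holomorphic_extension g G \<longleftrightarrow> entire G \<and> (\<forall>x. G (complexify x) = g x)"

definition holomorphic_extension ::
    "('m::finite rspace \<Rightarrow> complex ^ 'n::finite) \<Rightarrow> 'm cspace \<Rightarrow> complex ^ 'n" where
  "holomorphic_extension g = (THE G. is_holomorphic_extension g G)"

section \<open>Fischer decomposition and monogenic part\<close>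

definition multi_indices :: "nat \<Rightarrow> ('m::finite \<Rightarrow> nat) set" where
  "multi_indices k = {\<alpha>. (\<Sum>j\<in>UNIV. \<alpha> j) = k}"

subsection \<open>Functions on real space\<close>

definition homogeneous_poly ::
    "nat \<Rightarrow> ('m rspace \<Rightarrow> 'm::{finite,linorder} clifford) \<Rightarrow> bool" where
  "homogeneous_poly k P \<longleftrightarrow>
     (\<exists>c. \<forall>x. P x = (\<Sum>\<alpha>\<in>multi_indices k. (\<Prod>j\<in>UNIV. (x $ j) ^ \<alpha> j) *\<^sub>R c \<alpha>))"

text \<open>For \<open>k = 0\<close> the cofactor of \<open>x\<close>, of degree \<open>-1\<close>, is zero.\<close>

definition fischer_part ::
    "nat \<Rightarrow> ('m rspace \<Rightarrow> 'm::{finite,linorder} clifford) \<Rightarrow> 'm rspace \<Rightarrow> 'm clifford" where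
  "fischer_part k R = (THE M. homogeneous_poly k M \<and> (\<forall>x. dirac M x = 0) \<and>
     (\<exists>Q. (if k = 0 then \<forall>x. Q x = 0 else homogeneous_poly (k - 1) Q) \<and>
          (\<forall>x. R x = M x + rvector x \<odot> Q x)))"

definition homogeneous_expansion ::
    "('m rspace \<Rightarrow> 'm clifford) \<Rightarrow> (nat \<Rightarrow> 'm rspace \<Rightarrow> 'm::{finite,linorder} clifford) \<Rightarrow> bool" where
  "homogeneous_expansion F R \<longleftrightarrow>
     (\<forall>k. homogeneous_poly k (R k)) \<and> (\<forall>\<^sub>F x in nhds 0. (\<lambda>k. R k x) sums F x)"

definition monogenic_part ::
    "('m rspace \<Rightarrow> 'm::{finite,linorder} clifford) \<Rightarrow> 'm rspace \<Rightarrow> 'm clifford" where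
  "monogenic_part F x = (\<Sum>k. fischer_part k ((THE R. homogeneous_expansion F R) k) x)"

subsection \<open>Entire functions on complex space\<close>

definition chomogeneous_poly ::
    "nat \<Rightarrow> ('m cspace \<Rightarrow> 'm::{finite,linorder} clifford) \<Rightarrow> bool" where
  "chomogeneous_poly k P \<longleftrightarrow>
     (\<exists>c. \<forall>z. P z = (\<Sum>\<alpha>\<in>multi_indices k. (\<Prod>j\<in>UNIV. (z $ j) ^ \<alpha> j) *s c \<alpha>))"

definition cfischer_part ::
    "nat \<Rightarrow> ('m cspace \<Rightarrow> 'm::{finite,linorder} clifford) \<Rightarrow> 'm cspace \<Rightarrow> 'm clifford" where
  "cfischer_part k R = (THE M. chomogeneous_poly k M \<and> (\<forall>z. cdirac M z = 0) \<and>
     (\<exists>Q. (if k = 0 then \<forall>z. Q z = 0 else chomogeneous_poly (k - 1) Q) \<and>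
          (\<forall>z. R z = M z + cvector z \<odot> Q z)))"

definition chomogeneous_expansion ::
    "('m cspace \<Rightarrow> 'm clifford) \<Rightarrow> (nat \<Rightarrow> 'm cspace \<Rightarrow> 'm::{finite,linorder} clifford) \<Rightarrow> bool" where
  "chomogeneous_expansion F R \<longleftrightarrow>
     (\<forall>k. chomogeneous_poly k (R k)) \<and> (\<forall>z. (\<lambda>k. R k z) sums F z)"

definition cmonogenic_part ::
    "('m cspace \<Rightarrow> 'm::{finite,linorder} clifford) \<Rightarrow> 'm cspace \<Rightarrow> 'm clifford" where
  "cmonogenic_part F z = (\<Sum>k. cfischer_part k ((THE R. chomogeneous_expansion F R) k) z)"

section \<open>Fourier-Borel kernel, Fischer inner product, Segal-Bargmann-Fock transform\<close>

definition real_fourier_borel ::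
    "'m rspace \<Rightarrow> 'm rspace \<Rightarrow> 'm::{finite,linorder} clifford" where
  "real_fourier_borel x u = monogenic_part (\<lambda>y. exp (y \<bullet> u) *\<^sub>R cl_one) x"

definition fourier_borel ::
    "'m cspace \<Rightarrow> 'm rspace \<Rightarrow> 'm::{finite,linorder} clifford" where
  "fourier_borel z u = holomorphic_extension (\<lambda>x. real_fourier_borel x u) z"

definition is_power_series_coeff ::
    "('m rspace \<Rightarrow> 'm clifford) \<Rightarrow> (('m \<Rightarrow> nat) \<Rightarrow> 'm::{finite,linorder} clifford) \<Rightarrow> bool" where
  "is_power_series_coeff R r \<longleftrightarrow>
     (\<forall>\<^sub>F x in nhds 0. ((\<lambda>\<alpha>. (\<Prod>j\<in>UNIV. (x $ j) ^ \<alpha> j) *\<^sub>R r \<alpha>) has_sum R x) UNIV)"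

definition power_series_coeff ::
    "('m rspace \<Rightarrow> 'm clifford) \<Rightarrow> ('m \<Rightarrow> nat) \<Rightarrow> 'm::{finite,linorder} clifford" where
  "power_series_coeff R = (THE r. is_power_series_coeff R r)"

definition partial_deriv_multi ::
    "('m \<Rightarrow> nat) \<Rightarrow> ('m rspace \<Rightarrow> 'b) \<Rightarrow> 'm::{finite,linorder} rspace \<Rightarrow> 'b::real_normed_vector" where
  "partial_deriv_multi \<alpha> =
     foldr (\<lambda>j. partial_deriv j ^^ \<alpha> j) (sorted_list_of_set (UNIV :: 'm set))"

definition fischer_inner ::
    "('m rspace \<Rightarrow> 'm clifford) \<Rightarrow> ('m rspace \<Rightarrow> 'm clifford) \<Rightarrow> 'm::{finite,linorder} clifford" where
  "fischer_inner R S =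
     (\<Sum>\<^sub>\<infinity>\<alpha>. cl_hconj (power_series_coeff R \<alpha>) \<odot> partial_deriv_multi \<alpha> S 0)"

definition square_integrable :: "('m::finite rspace \<Rightarrow> complex ^ 'n::finite) \<Rightarrow> bool" where
  "square_integrable f \<longleftrightarrow>
     f \<in> borel_measurable lebesgue \<and> integrable lebesgue (\<lambda>x. (norm (f x))\<^sup>2)"

definition cdot :: "'m::finite cspace \<Rightarrow> 'm cspace \<Rightarrow> complex" where
  "cdot z w = (\<Sum>j\<in>UNIV. z $ j * w $ j)"

definition segal_bargmann ::
    "('m::finite rspace \<Rightarrow> complex ^ 'n::finite) \<Rightarrow> 'm cspace \<Rightarrow> complex ^ 'n" where
  "segal_bargmann f z = (1 / (2 * pi) powr (real CARD('m) / 2)) *\<^sub>R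
     (LINT x|lebesgue. exp (- cdot z z / 2 + cdot (complexify x) z
        - cdot (complexify x) (complexify x) / 4) *s f x)"

end

theory Submission
  imports Defs "HOL-Complex_Analysis.Conformal_Mappings" "HOL-Probability.Distributions"
begin

text \<open>
  Put \<open>w(x) = exp(-|x|\<^sup>2/2) g(x)\<close>. The transform of \<open>f\<close> is, up to the normalising constant, the integral
  of \<open>exp(-z\<cdot>z/2 + x\<cdot>z) w(x)\<close> over \<open>x\<close>. Two facts about this kernel prove the theorem.

  First, in the Clifford algebra \<open>z\<cdot>z = -z\<^sup>2\<close>. Therefore, degree by degree in \<open>z\<close>, the Hermite generating
  function \<open>exp(-z\<cdot>z/2 + x\<cdot>z)\<close> differs from \<open>exp(x\<cdot>z)\<close> by a left multiple of the vector \<open>z\<close> (lemma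
  \<open>hser_eq_vmul\<close>), and such multiples have no monogenic part. The monogenic projection acts from the
  left, so it commutes with the integration against \<open>w\<close>, and the kernel becomes the monogenic part of
  \<open>exp(x\<cdot>z)\<close>, which is \<open>E(z, x)\<close> (lemma \<open>fourier_borel_integral\<close>).

  Second, at a real point \<open>z = y\<close> the kernel together with the weight is the Gaussian
  \<open>exp(-|x - y|\<^sup>2/2)\<close>, so the transform is a radial mean of \<open>g\<close> around \<open>y\<close>. Harmonic and monogenic functions
  have the mean value property, hence the transform is an entire extension of \<open>g\<close> (lemma
  \<open>segal_bargmann_reproduces\<close>). In particular \<open>g\<close> is given by a power series \<open>\<Sum>\<^sub>\<beta> x\<^sup>\<beta> c\<^sub>\<beta>\<close> that converges
  everywhere, and the Fischer inner product pairs \<open>E(z, x) = \<Sum>\<^sub>\<beta> x\<^sup>\<beta>/\<beta>! M(z\<^sup>\<beta>)\<close> with it to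
  \<open>\<Sum>\<^sub>\<beta> M(z\<^sup>\<beta>) c\<^sub>\<beta>\<close>, where \<open>M\<close> takes monogenic parts; this is the monogenic part of the transform (lemma \<open>fischer_inner_fourier_borel\<close>). If \<open>g\<close> is
  monogenic, the projection does not change the transform.

  Polynomials and power series are represented by their coefficients. On these the vector variable
  \<open>x\<close> and the Dirac operator \<open>\<partial>\<close> satisfy \<open>\<partial>x + x\<partial> = -(2k + m)\<close> in degree \<open>k\<close> (lemma \<open>fdirac_vmul\<close>), and this
  relation alone yields the monogenic projection in the closed form \<open>\<Sum>\<^sub>s \<kappa>\<^sub>s x\<^sup>s \<partial>\<^sup>s\<close>. The closed form gives
  existence and uniqueness of the Fischer decomposition, and the bound \<open>C\<^sup>k\<close> in degree \<open>k\<close> that makes all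
  series converge (lemma \<open>cnorm_fischer_proj_le\<close>).
\<close>

text \<open>The dollar sign is reserved for the components of vectors.\<close>

no_notation fps_nth (infixl "$" 75)

section \<open>Bilinearity of the Clifford product\<close>

lemma bilinear_cl_mult: "bilinear ((\<odot>) :: 'm::{finite,linorder} clifford \<Rightarrow> _)"
proof -
  have "linear (\<lambda>y. x \<odot> y)" for x :: "'m clifford"
    by (rule linearI) (simp_all add: vec_eq_iff cl_mult_nth sum.distrib algebra_simps scaleR_sum_right)
  moreover have "linear (\<lambda>x. x \<odot> y)" for y :: "'m clifford"
    by (rule linearI) (simp_all add: vec_eq_iff cl_mult_nth sum.distrib algebra_simps scaleR_sum_right)
  ultimately show ?thesis by (simp add: bilinear_def)
qed

lemma bounded_bilinear_cl_mult: "bounded_bilinear ((\<odot>) :: 'm::{finite,linorder} clifford \<Rightarrow> _)"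
  using bilinear_cl_mult by (simp add: bilinear_conv_bounded_bilinear)

interpretation cl: bounded_bilinear "(\<odot>) :: 'm::{finite,linorder} clifford \<Rightarrow> _"
  by (rule bounded_bilinear_cl_mult)

lemma cl_mult_smult_left: "(c *s x) \<odot> y = c *s (x \<odot> y)"
  and cl_mult_smult_right: "x \<odot> (c *s y) = c *s (x \<odot> y)"
  by (simp_all add: vec_eq_iff cl_mult_nth sum_distrib_left mult_ac)

lemma norm_smult_complex: "norm (c *s (x :: complex ^ 'n::finite)) = cmod c * norm x"
  by (simp add: norm_vec_def L2_set_def norm_mult power_mult_distrib real_sqrt_mult
      flip: sum_distrib_left)

lemma of_real_smult: "complex_of_real r *s x = r *\<^sub>R (x :: complex ^ 'n::finite)"
  unfolding vec_eq_iff vector_scaleR_component vector_smult_component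
  by (simp add: scaleR_conv_of_real)

lemma bounded_bilinear_smult: "bounded_bilinear ((*s) :: complex \<Rightarrow> complex ^ 'n::finite \<Rightarrow> _)"
proof
  show "\<exists>K. \<forall>a b. norm (a *s (b :: complex ^ 'n)) \<le> norm a * norm b * K"
    by (rule exI[of _ 1]) (simp add: norm_smult_complex)
qed (simp_all add: vec_eq_iff algebra_simps)

interpretation sm: bounded_bilinear "(*s) :: complex \<Rightarrow> complex ^ 'n::finite \<Rightarrow> _"
  by (rule bounded_bilinear_smult)

text \<open>
  A constant of continuity of the Clifford product. It enters through bounds of the form \<open>C\<^sup>k\<close> for
  polynomials of degree \<open>k\<close>, which entire series absorb.
\<close>

definition cl_const :: "'m::{finite,linorder} itself \<Rightarrow> real" where
  "cl_const _ = (SOME K. K > 0 \<and> (\<forall>x y :: 'm clifford. norm (x \<odot> y) \<le> norm x * norm y * K))"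

lemma cl_const_pos: "cl_const TYPE('m::{finite,linorder}) > 0"
  and norm_cl_mult_le: "norm ((x :: 'm clifford) \<odot> y) \<le> cl_const TYPE('m) * norm x * norm y"
proof -
  have "cl_const TYPE('m) > 0 \<and>
      (\<forall>x y :: 'm clifford. norm (x \<odot> y) \<le> norm x * norm y * cl_const TYPE('m))"
    unfolding cl_const_def by (rule someI_ex) (rule cl.pos_bounded)
  then show "cl_const TYPE('m) > 0" "norm (x \<odot> y) \<le> cl_const TYPE('m) * norm x * norm y"
    by (simp_all add: mult_ac)
qed

lemma norm_cl_basis [simp]: "norm (cl_basis A) = 1"
  by (simp add: cl_basis_def norm_axis_1)

lemma norm_cl_e_mult_le: "norm (cl_e j \<odot> (x :: 'm::{finite,linorder} clifford)) \<le> cl_const TYPE('m) * norm x"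
  using norm_cl_mult_le[of "cl_e j" x] by simp

lemma cl_e_anticommute_mult:
  "cl_e j \<odot> (cl_e k \<odot> x) + cl_e k \<odot> (cl_e j \<odot> x) = (if j = k then - (2 *\<^sub>R x) else 0)"
proof -
  have "cl_e j \<odot> (cl_e k \<odot> x) + cl_e k \<odot> (cl_e j \<odot> x) = (cl_e j \<odot> cl_e k + cl_e k \<odot> cl_e j) \<odot> x"
    by (simp add: cl_mult_assoc cl.add_left)
  also have "\<dots> = (if j = k then -2 else 0) *s x"
    by (simp only: cl_e_anticommute cl_mult_smult_left cl_one_left)
  also have "\<dots> = (if j = k then - (2 *\<^sub>R x) else 0)"
    by (simp add: vec_eq_iff scaleR_conv_of_real)
  finally show ?thesis .
qed

lemma cl_e_square_mult: "cl_e j \<odot> (cl_e j \<odot> x) = - x"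
proof -
  have "2 *\<^sub>R (cl_e j \<odot> (cl_e j \<odot> x)) = 2 *\<^sub>R (- x)"
    using cl_e_anticommute_mult[of j j x] by (simp add: scaleR_2)
  then show ?thesis by (metis scaleR_cancel_left zero_neq_numeral)
qed

lemma cl_hconj_hconj [simp]: "cl_hconj (cl_hconj x) = x"
proof -
  have "cl_sign A A * cnj (cl_sign A A) = 1" for A :: "'a set"
    using cl_sign_square[of A A] by (simp add: cl_sign_def)
  then show ?thesis by (simp add: vec_eq_iff cl_hconj_nth flip: mult.assoc)
qed

lemma bounded_linear_cl_hconj: "bounded_linear (cl_hconj :: 'm::{finite,linorder} clifford \<Rightarrow> _)"
  by (intro linear_conv_bounded_linear[THEN iffD1] linearI)
     (simp_all add: vec_eq_iff cl_hconj_nth algebra_simps)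

section \<open>Formal power series with Clifford coefficients\<close>

definition inc :: "'m \<Rightarrow> ('m \<Rightarrow> nat) \<Rightarrow> 'm \<Rightarrow> nat" where
  "inc j \<alpha> = \<alpha>(j := Suc (\<alpha> j))"

definition dec :: "'m \<Rightarrow> ('m \<Rightarrow> nat) \<Rightarrow> 'm \<Rightarrow> nat" where
  "dec j \<alpha> = \<alpha>(j := \<alpha> j - 1)"

lemma inc_same [simp]: "inc j \<alpha> j = Suc (\<alpha> j)" and dec_same [simp]: "dec j \<alpha> j = \<alpha> j - 1"
  and inc_other: "i \<noteq> j \<Longrightarrow> inc j \<alpha> i = \<alpha> i" and dec_other: "i \<noteq> j \<Longrightarrow> dec j \<alpha> i = \<alpha> i"
  by (simp_all add: inc_def dec_def)

lemma dec_inc [simp]: "dec j (inc j \<alpha>) = \<alpha>" by (simp add: inc_def dec_def)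

lemma inc_dec: "\<alpha> j > 0 \<Longrightarrow> inc j (dec j \<alpha>) = \<alpha>" by (simp add: inc_def dec_def)

lemma dec_inc_commute: "i \<noteq> j \<Longrightarrow> dec i (inc j \<alpha>) = inc j (dec i \<alpha>)"
  by (auto simp: inc_def dec_def)

abbreviation deg :: "('m::finite \<Rightarrow> nat) \<Rightarrow> nat" where
  "deg \<alpha> \<equiv> sum \<alpha> UNIV"

lemma deg_inc [simp]: "deg (inc j \<alpha>) = Suc (deg \<alpha>)"
proof -
  have "deg (inc j \<alpha>) = Suc (\<alpha> j) + sum \<alpha> (UNIV - {j})" by (simp add: sum.remove[of _ j] inc_def)
  also have "\<dots> = Suc (deg \<alpha>)" by (simp add: sum.remove[of _ j])
  finally show ?thesis .
qed

lemma deg_dec: "\<alpha> j > 0 \<Longrightarrow> Suc (deg (dec j \<alpha>)) = deg \<alpha>"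
  using deg_inc[of j "dec j \<alpha>"] by (simp add: inc_dec)

lemma multi_indices_iff: "\<alpha> \<in> multi_indices k \<longleftrightarrow> deg \<alpha> = k"
  by (simp add: multi_indices_def)

lemma finite_multi_indices [simp]: "finite (multi_indices k :: ('m::finite \<Rightarrow> nat) set)"
proof (rule finite_subset)
  show "(multi_indices k :: ('m \<Rightarrow> nat) set) \<subseteq> Pi\<^sub>E UNIV (\<lambda>_. {..k})"
    by (auto simp: multi_indices_def intro: member_le_sum)
qed (simp add: finite_PiE)

lemma multi_indices_0: "multi_indices 0 = {\<lambda>_. 0}"
  by (auto simp: multi_indices_iff fun_eq_iff)

text \<open>
  Raising the index \<open>j\<close> is a bijection from the multi-indices of degree \<open>k\<close> onto those of degree
  \<open>k + 1\<close> that involve \<open>j\<close>. Every passage between neighbouring degrees below rests on it.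
\<close>

lemma sum_multi_indices_Suc:
  "(\<Sum>\<beta>\<in>multi_indices (Suc k). if \<beta> j > 0 then h \<beta> else 0) = (\<Sum>\<alpha>\<in>multi_indices k. h (inc j \<alpha>))"
  (is "?L = ?R")
proof -
  have "?L = (\<Sum>\<beta>\<in>{\<beta> \<in> multi_indices (Suc k). \<beta> j > 0}. h \<beta>)"
    by (rule sum.inter_filter[symmetric]) simp
  also have "\<dots> = ?R"
  proof (rule sum.reindex_bij_witness[of _ "inc j" "dec j"])
    fix a assume a: "a \<in> {\<beta> \<in> multi_indices (Suc k). 0 < \<beta> j}"
    then show "inc j (dec j a) = a" by (auto intro: inc_dec)
    show "dec j a \<in> multi_indices k" using a deg_dec[of a j] by (simp add: multi_indices_iff)
  qed (auto simp: multi_indices_iff inc_dec)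
  finally show ?thesis .
qed

text \<open>
  The family of coefficients of a formal power series in commuting variables, with Clifford
  coefficients. Real and complex polynomials, and entire series, are all handled through it.
\<close>

type_synonym 'm coeffs = "('m \<Rightarrow> nat) \<Rightarrow> 'm clifford"

definition hom :: "nat \<Rightarrow> 'm::{finite,linorder} coeffs \<Rightarrow> bool" where
  "hom k c \<longleftrightarrow> (\<forall>\<alpha>. deg \<alpha> \<noteq> k \<longrightarrow> c \<alpha> = 0)"

text \<open>
  Left multiplication of a series by the vector variable \<open>\<Sum>\<^sub>j x\<^sub>j e\<^sub>j\<close>.
\<close>

definition vmul :: "'m::{finite,linorder} coeffs \<Rightarrow> 'm coeffs" where
  "vmul c \<alpha> = (\<Sum>j\<in>UNIV. if \<alpha> j > 0 then cl_e j \<odot> c (dec j \<alpha>) else 0)"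

text \<open>
  The Dirac operator \<open>\<Sum>\<^sub>j e\<^sub>j \<partial>\<^sub>j\<close>, applied to a formal series term by term.
\<close>

definition fdirac :: "'m::{finite,linorder} coeffs \<Rightarrow> 'm coeffs" where
  "fdirac c \<alpha> = (\<Sum>j\<in>UNIV. real (Suc (\<alpha> j)) *\<^sub>R (cl_e j \<odot> c (inc j \<alpha>)))"

lemma hom_vmul: "hom k c \<Longrightarrow> hom (Suc k) (vmul c)"
  unfolding hom_def vmul_def
proof (intro allI impI sum.neutral ballI)
  fix \<alpha> :: "'a \<Rightarrow> nat" and j
  assume c: "\<forall>\<alpha>. deg \<alpha> \<noteq> k \<longrightarrow> c \<alpha> = 0" and d: "deg \<alpha> \<noteq> Suc k"
  show "(if 0 < \<alpha> j then cl_e j \<odot> c (dec j \<alpha>) else 0) = 0"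
    using c[rule_format, of "dec j \<alpha>"] d deg_dec[of \<alpha> j] by (auto simp: cl.zero_right)
qed

lemma hom_fdirac: "hom (Suc k) c \<Longrightarrow> hom k (fdirac c)"
  unfolding hom_def fdirac_def
  by (auto intro!: sum.neutral simp: cl.zero_right)

lemma hom_0_fdirac: "hom 0 c \<Longrightarrow> fdirac c = (\<lambda>_. 0)"
  unfolding hom_def fdirac_def fun_eq_iff
  by (auto intro!: sum.neutral simp: cl.zero_right simp del: sum_eq_0_iff)

lemma vmul_lin:
  "vmul (\<lambda>\<alpha>. \<Sum>s\<in>S. r s *\<^sub>R c s \<alpha>) = (\<lambda>\<alpha>. \<Sum>s\<in>S. r s *\<^sub>R vmul (c s) \<alpha>)"
proof
  fix \<alpha>
  have "vmul (\<lambda>\<alpha>. \<Sum>s\<in>S. r s *\<^sub>R c s \<alpha>) \<alpha>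
      = (\<Sum>j\<in>UNIV. \<Sum>s\<in>S. r s *\<^sub>R (if \<alpha> j > 0 then cl_e j \<odot> c s (dec j \<alpha>) else 0))"
    unfolding vmul_def by (intro sum.cong) (auto simp: cl.sum_right cl.scaleR_right)
  also have "\<dots> = (\<Sum>s\<in>S. r s *\<^sub>R vmul (c s) \<alpha>)"
    unfolding vmul_def scaleR_sum_right by (rule sum.swap)
  finally show "vmul (\<lambda>\<alpha>. \<Sum>s\<in>S. r s *\<^sub>R c s \<alpha>) \<alpha> = (\<Sum>s\<in>S. r s *\<^sub>R vmul (c s) \<alpha>)" .
qed

lemma fdirac_lin:
  "fdirac (\<lambda>\<alpha>. \<Sum>s\<in>S. r s *\<^sub>R c s \<alpha>) = (\<lambda>\<alpha>. \<Sum>s\<in>S. r s *\<^sub>R fdirac (c s) \<alpha>)"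
proof
  fix \<alpha>
  have "fdirac (\<lambda>\<alpha>. \<Sum>s\<in>S. r s *\<^sub>R c s \<alpha>) \<alpha>
      = (\<Sum>j\<in>UNIV. \<Sum>s\<in>S. r s *\<^sub>R (real (Suc (\<alpha> j)) *\<^sub>R (cl_e j \<odot> c s (inc j \<alpha>))))"
    unfolding fdirac_def
    by (intro sum.cong) (simp_all add: cl.sum_right cl.scaleR_right scaleR_sum_right mult_ac)
  also have "\<dots> = (\<Sum>s\<in>S. r s *\<^sub>R fdirac (c s) \<alpha>)"
    unfolding fdirac_def scaleR_sum_right by (rule sum.swap)
  finally show "fdirac (\<lambda>\<alpha>. \<Sum>s\<in>S. r s *\<^sub>R c s \<alpha>) \<alpha> = (\<Sum>s\<in>S. r s *\<^sub>R fdirac (c s) \<alpha>)" .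
qed

lemma vmul_add: "vmul (\<lambda>\<alpha>. c \<alpha> + d \<alpha>) = (\<lambda>\<alpha>. vmul c \<alpha> + vmul d \<alpha>)"
  unfolding vmul_def by (auto simp: fun_eq_iff cl.add_right simp flip: sum.distrib intro!: sum.cong)
lemma vmul_scaleR: "vmul (\<lambda>\<alpha>. r *\<^sub>R c \<alpha>) = (\<lambda>\<alpha>. r *\<^sub>R vmul c \<alpha>)"
  unfolding vmul_def by (auto simp: fun_eq_iff cl.scaleR_right scaleR_sum_right intro!: sum.cong)
lemma vmul_zero [simp]: "vmul (\<lambda>\<alpha>. 0) = (\<lambda>\<alpha>. 0)"
  by (auto simp: vmul_def fun_eq_iff cl.zero_right intro!: sum.neutral)
lemma vmul_rmult: "vmul (\<lambda>\<alpha>. c \<alpha> \<odot> a) = (\<lambda>\<alpha>. vmul c \<alpha> \<odot> a)"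
  unfolding vmul_def
  by (auto simp: fun_eq_iff cl.sum_left cl_mult_assoc cl.zero_left intro!: sum.cong)
lemma fdirac_add: "fdirac (\<lambda>\<alpha>. c \<alpha> + d \<alpha>) = (\<lambda>\<alpha>. fdirac c \<alpha> + fdirac d \<alpha>)"
  unfolding fdirac_def by (simp add: fun_eq_iff cl.add_right scaleR_add_right sum.distrib)
lemma fdirac_scaleR: "fdirac (\<lambda>\<alpha>. r *\<^sub>R c \<alpha>) = (\<lambda>\<alpha>. r *\<^sub>R fdirac c \<alpha>)"
  unfolding fdirac_def by (simp add: fun_eq_iff cl.scaleR_right scaleR_sum_right mult_ac)
lemma fdirac_zero [simp]: "fdirac (\<lambda>\<alpha>. 0) = (\<lambda>\<alpha>. 0)"
  by (simp add: fdirac_def fun_eq_iff cl.zero_right)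
lemma fdirac_rmult: "fdirac (\<lambda>\<alpha>. c \<alpha> \<odot> a) = (\<lambda>\<alpha>. fdirac c \<alpha> \<odot> a)"
  unfolding fdirac_def
  by (simp add: fun_eq_iff cl.sum_left cl_mult_assoc cl.scaleR_left)

text \<open>
  The relation \<open>\<partial>x + x\<partial> = -(2N + m)\<close>, where \<open>N\<close> is the degree operator. The terms with two
  different indices cancel by anticommutation; each index \<open>j\<close> contributes \<open>-(2\<alpha>\<^sub>j + 1)\<close> because
  \<open>e\<^sub>j\<^sup>2 = -1\<close> meets \<open>\<partial>\<^sub>j x\<^sub>j + x\<^sub>j \<partial>\<^sub>j = 2\<alpha>\<^sub>j + 1\<close>. The whole Fischer decomposition is a consequence.
\<close>

lemma fdirac_vmul:
  "fdirac (vmul c) \<alpha> = - (real (2 * deg \<alpha> + CARD('m)) *\<^sub>R c \<alpha>) - vmul (fdirac c) \<alpha>"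
  for c :: "'m::{finite,linorder} coeffs"
proof -
  define A where "A j i = real (Suc (\<alpha> j)) *\<^sub>R (cl_e j \<odot>
      (if inc j \<alpha> i > 0 then cl_e i \<odot> c (dec i (inc j \<alpha>)) else 0))" for i j
  define B where "B j i = (if \<alpha> i > 0 then cl_e i \<odot> (real (Suc (dec i \<alpha> j)) *\<^sub>R
      (cl_e j \<odot> c (inc j (dec i \<alpha>)))) else 0)" for i j
  have 1: "fdirac (vmul c) \<alpha> = (\<Sum>j\<in>UNIV. \<Sum>i\<in>UNIV. A j i)"
    by (simp add: fdirac_def vmul_def A_def cl.sum_right scaleR_sum_right)
  have 2: "vmul (fdirac c) \<alpha> = (\<Sum>j\<in>UNIV. \<Sum>i\<in>UNIV. B j i)"
  proof -
    have "vmul (fdirac c) \<alpha> = (\<Sum>i\<in>UNIV. \<Sum>j\<in>UNIV. B j i)"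
      unfolding vmul_def fdirac_def B_def by (intro sum.cong) (simp_all add: cl.sum_right)
    then show ?thesis using sum.swap by metis
  qed
  have 3: "A j i + B j i = (if i = j then - (real (2 * \<alpha> j + 1) *\<^sub>R c \<alpha>) else 0)" for i j
  proof (cases "i = j")
    case True
    have a: "A j i = - (real (Suc (\<alpha> j)) *\<^sub>R c \<alpha>)"
      by (simp add: A_def True cl_e_square_mult)
    have b: "B j i = - (real (\<alpha> j) *\<^sub>R c \<alpha>)"
      by (simp add: B_def True cl_e_square_mult cl.scaleR_right inc_dec)
    have r: "real (2 * \<alpha> j + 1) = real (Suc (\<alpha> j)) + real (\<alpha> j)" by simp
    show ?thesis unfolding a b r scaleR_add_left using True by simp
  next
    case False
    then have e: "dec i (inc j \<alpha>) = inc j (dec i \<alpha>)" "inc j \<alpha> i = \<alpha> i" "dec i \<alpha> j = \<alpha> j"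
      by (simp_all add: dec_inc_commute inc_other dec_other)
    show ?thesis
    proof (cases "\<alpha> i > 0")
      case True
      have "A j i + B j i = real (Suc (\<alpha> j)) *\<^sub>R (cl_e j \<odot> (cl_e i \<odot> c (dec i (inc j \<alpha>)))
          + cl_e i \<odot> (cl_e j \<odot> c (dec i (inc j \<alpha>))))"
        using False True unfolding A_def B_def e
        by (simp add: cl.scaleR_right scaleR_add_right)
      then show ?thesis using False by (simp add: cl_e_anticommute_mult)
    next
      case 2: False
      then show ?thesis using False by (simp add: A_def B_def cl.zero_right inc_other)
    qed
  qed
  have "fdirac (vmul c) \<alpha> + vmul (fdirac c) \<alpha> = (\<Sum>j\<in>UNIV. \<Sum>i\<in>UNIV. A j i + B j i)"
    by (simp add: 1 2 sum.distrib)
  also have "\<dots> = - ((\<Sum>j\<in>UNIV. real (2 * \<alpha> j + 1)) *\<^sub>R c \<alpha>)"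
    by (simp add: 3 sum_negf scaleR_sum_left)
  also have "(\<Sum>j\<in>UNIV. real (2 * \<alpha> j + 1)) = real (2 * deg \<alpha> + CARD('m))"
    by (simp add: sum.distrib sum_distrib_left)
  finally show ?thesis by (simp add: algebra_simps)
qed

lemma fdirac_vmul_hom:
  fixes c :: "'m::{finite,linorder} coeffs"
  assumes "hom k c"
  shows "fdirac (vmul c) = (\<lambda>\<alpha>. - (real (2 * k + CARD('m)) *\<^sub>R c \<alpha>) - vmul (fdirac c) \<alpha>)"
proof
  fix \<alpha>
  show "fdirac (vmul c) \<alpha> = - (real (2 * k + CARD('m)) *\<^sub>R c \<alpha>) - vmul (fdirac c) \<alpha>"
    using assms by (cases "deg \<alpha> = k") (auto simp: fdirac_vmul hom_def)
qed

section \<open>The algebraic Fischer projection\<close>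

text \<open>
  The scalar in \<open>\<partial>(x\<^sup>s Q) = a x\<^sup>s\<^sup>-\<^sup>1 Q + (-1)\<^sup>s x\<^sup>s \<partial>Q\<close> when \<open>x\<^sup>s Q\<close> has degree \<open>k\<close>; here \<open>m\<close> is the
  number of variables.
\<close>

definition fischer_factor :: "nat \<Rightarrow> nat \<Rightarrow> nat \<Rightarrow> real" where
  "fischer_factor m k s = (if even s then - real s else - (2 * real k - real s - 1 + real m))"

text \<open>
  With unknown coefficients \<open>\<kappa>\<^sub>s\<close>, the Dirac operator maps \<open>\<Sum>\<^sub>s \<kappa>\<^sub>s x\<^sup>s \<partial>\<^sup>s R\<close> to a combination of the
  terms \<open>x\<^sup>s \<partial>\<^sup>s\<^sup>+\<^sup>1 R\<close>. This recursion makes all of them vanish.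
\<close>

primrec fischer_coeff :: "nat \<Rightarrow> nat \<Rightarrow> nat \<Rightarrow> real" where
  "fischer_coeff m k 0 = 1"
| "fischer_coeff m k (Suc s) = - ((-1) ^ s * fischer_coeff m k s / fischer_factor m k (Suc s))"

text \<open>
  The monogenic part of a homogeneous polynomial of degree \<open>k\<close> in closed form. Compared with an
  orthogonal projection it has two advantages: its properties are identities between
  coefficients, and its size can be read off.
\<close>

definition fischer_proj :: "nat \<Rightarrow> 'm::{finite,linorder} coeffs \<Rightarrow> 'm coeffs" where
  "fischer_proj k c = (\<lambda>\<alpha>. \<Sum>s\<le>k. fischer_coeff CARD('m) k s *\<^sub>R (vmul ^^ s) ((fdirac ^^ s) c) \<alpha>)"

text \<open>
  For even \<open>s\<close> the factor is \<open>-s\<close>; for odd \<open>s \<le> k\<close> its modulus is \<open>k + (k - s) + (m - 1) \<ge> k \<ge> s\<close>.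
  So no division by zero occurs in the recursion, and its solution decays like \<open>1/s!\<close>.
\<close>

lemma fischer_factor_ge: "m > 0 \<Longrightarrow> s \<le> k \<Longrightarrow> \<bar>fischer_factor m k s\<bar> \<ge> real s"
  by (auto simp: fischer_factor_def)

lemma fischer_coeff_Suc:
  assumes "m > 0" "Suc s \<le> k"
  shows "fischer_coeff m k (Suc s) * fischer_factor m k (Suc s) = - ((-1) ^ s * fischer_coeff m k s)"
proof -
  have "fischer_factor m k (Suc s) \<noteq> 0" using fischer_factor_ge[of m "Suc s" k] assms by auto
  then show ?thesis by simp
qed

lemma abs_fischer_coeff_le:
  assumes "m > 0" "s \<le> k"
  shows "\<bar>fischer_coeff m k s\<bar> \<le> 1 / fact s"
  using assms(2)
proof (induction s)
  case (Suc s)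
  have "\<bar>fischer_coeff m k (Suc s)\<bar> = \<bar>fischer_coeff m k s\<bar> / \<bar>fischer_factor m k (Suc s)\<bar>"
    by (simp add: abs_mult power_abs)
  also have "\<dots> \<le> (1 / fact s) / real (Suc s)"
    using Suc fischer_factor_ge[OF assms(1) Suc.prems] by (intro frac_le) auto
  also have "\<dots> = 1 / fact (Suc s)" by (simp add: field_simps)
  finally show ?case .
qed simp

lemma hom_vmul_pow: "hom k c \<Longrightarrow> hom (k + s) ((vmul ^^ s) c)"
  by (induction s) (auto intro: hom_vmul)

lemma hom_fdirac_pow: "hom k c \<Longrightarrow> s \<le> k \<Longrightarrow> hom (k - s) ((fdirac ^^ s) c)"
proof (induction s)
  case (Suc s)
  then have "hom (Suc (k - Suc s)) ((fdirac ^^ s) c)" by (simp add: Suc_diff_Suc)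
  then show ?case by (auto intro: hom_fdirac)
qed simp

lemma fdirac_pow_eq_0:
  assumes "hom k c"
  shows "(fdirac ^^ Suc k) c = (\<lambda>_. 0)"
  using hom_0_fdirac[of "(fdirac ^^ k) c"] hom_fdirac_pow[OF assms, of k] by simp

lemma vmul_pow_zero [simp]: "(vmul ^^ s) (\<lambda>_. 0) = (\<lambda>_. 0)"
  by (induction s) auto

lemma vmul_pow_add:
  "(vmul ^^ s) (\<lambda>\<alpha>. a *\<^sub>R c \<alpha> + b *\<^sub>R d \<alpha>) = (\<lambda>\<alpha>. a *\<^sub>R (vmul ^^ s) c \<alpha> + b *\<^sub>R (vmul ^^ s) d \<alpha>)"
  by (induction s) (simp_all add: vmul_add vmul_scaleR)

lemma fdirac_vmul_pow:
  fixes c :: "'m::{finite,linorder} coeffs"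
  assumes "hom l c"
  shows "fdirac ((vmul ^^ s) c) = (\<lambda>\<alpha>. fischer_factor CARD('m) (l + s) s *\<^sub>R (vmul ^^ (s - 1)) c \<alpha>
      + (-1) ^ s *\<^sub>R (vmul ^^ s) (fdirac c) \<alpha>)"
proof (induction s)
  case 0
  then show ?case by (simp add: fischer_factor_def)
next
  case (Suc s)
  let ?b = "fischer_factor CARD('m) (l + s) s"
  have 1: "?b *\<^sub>R vmul ((vmul ^^ (s - 1)) c) \<alpha> = ?b *\<^sub>R (vmul ^^ s) c \<alpha>" for \<alpha>
    by (cases s) (simp_all add: fischer_factor_def)
  have 2: "fischer_factor CARD('m) (l + Suc s) (Suc s) = - real (2 * (l + s) + CARD('m)) - ?b"
    by (auto simp: fischer_factor_def)
  have "fdirac ((vmul ^^ Suc s) c) = (\<lambda>\<alpha>. - (real (2 * (l + s) + CARD('m)) *\<^sub>R (vmul ^^ s) c \<alpha>)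
      - vmul (fdirac ((vmul ^^ s) c)) \<alpha>)"
    using fdirac_vmul_hom[OF hom_vmul_pow[OF assms, of s]] by simp
  also have "\<dots> = (\<lambda>\<alpha>. (- real (2 * (l + s) + CARD('m)) - ?b) *\<^sub>R (vmul ^^ s) c \<alpha>
      + (-1) ^ Suc s *\<^sub>R (vmul ^^ Suc s) (fdirac c) \<alpha>)"
    by (simp add: Suc vmul_add vmul_scaleR 1[unfolded One_nat_def] fun_eq_iff algebra_simps)
  finally show ?case unfolding 2 by simp
qed

lemma fdirac_pow_vmul:
  fixes q :: "'m::{finite,linorder} coeffs"
  assumes "hom k q" "s \<le> Suc k"
  shows "(fdirac ^^ s) (vmul q) = (\<lambda>\<alpha>. (-1) ^ s *\<^sub>R vmul ((fdirac ^^ s) q) \<alpha>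
      + fischer_factor CARD('m) (Suc k) s *\<^sub>R (fdirac ^^ (s - 1)) q \<alpha>)"
  using assms(2)
proof (induction s)
  case 0
  then show ?case by (simp add: fischer_factor_def)
next
  case (Suc s)
  let ?b = "fischer_factor CARD('m) (Suc k) s"
  have 1: "?b *\<^sub>R fdirac ((fdirac ^^ (s - 1)) q) \<alpha> = ?b *\<^sub>R (fdirac ^^ s) q \<alpha>" for \<alpha>
    by (cases s) (simp_all add: fischer_factor_def)
  have 2: "fischer_factor CARD('m) (Suc k) (Suc s) = (-1) ^ s * - real (2 * (k - s) + CARD('m)) + ?b"
    using Suc.prems by (auto simp: fischer_factor_def of_nat_diff)
  have "(fdirac ^^ Suc s) (vmul q) = (\<lambda>\<alpha>. (-1) ^ s *\<^sub>R fdirac (vmul ((fdirac ^^ s) q)) \<alpha>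
      + ?b *\<^sub>R (fdirac ^^ s) q \<alpha>)"
    using Suc by (simp add: fdirac_add fdirac_scaleR 1[unfolded One_nat_def])
  also define r where "r = real (2 * (k - s) + CARD('m))"
  have e: "fdirac (vmul ((fdirac ^^ s) q)) = (\<lambda>\<alpha>. - (r *\<^sub>R (fdirac ^^ s) q \<alpha>) - vmul ((fdirac ^^ Suc s) q) \<alpha>)"
    using fdirac_vmul_hom[OF hom_fdirac_pow[OF assms(1), of s]] Suc.prems by (simp add: r_def)
  have "(\<lambda>\<alpha>. (-1) ^ s *\<^sub>R fdirac (vmul ((fdirac ^^ s) q)) \<alpha> + ?b *\<^sub>R (fdirac ^^ s) q \<alpha>)
      = (\<lambda>\<alpha>. (-1) ^ Suc s *\<^sub>R vmul ((fdirac ^^ Suc s) q) \<alpha> + ((-1) ^ s * - r + ?b) *\<^sub>R (fdirac ^^ s) q \<alpha>)"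
    unfolding e by (simp add: fun_eq_iff scaleR_add_left scaleR_diff_right scaleR_diff_left)
  finally show ?case unfolding 2 r_def diff_Suc_1 .
qed

text \<open>
  The image under the Dirac operator is a telescoping sum, whose last term contains
  \<open>\<partial>\<^sup>k\<^sup>+\<^sup>1 c = 0\<close>.
\<close>

lemma fdirac_fischer_proj:
  fixes c :: "'m::{finite,linorder} coeffs"
  assumes "hom k c"
  shows "fdirac (fischer_proj k c) = (\<lambda>_. 0)"
proof
  fix \<alpha>
  let ?\<kappa> = "fischer_coeff CARD('m) k"
  define u where "u s = ((-1) ^ s * ?\<kappa> s) *\<^sub>R (vmul ^^ s) ((fdirac ^^ Suc s) c) \<alpha>" for s
  define t where "t s = ?\<kappa> s *\<^sub>R fdirac ((vmul ^^ s) ((fdirac ^^ s) c)) \<alpha>" for s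
  have t: "t s = (?\<kappa> s * fischer_factor CARD('m) k s) *\<^sub>R (vmul ^^ (s - 1)) ((fdirac ^^ s) c) \<alpha> + u s"
    if "s \<le> k" for s
    using fdirac_vmul_pow[OF hom_fdirac_pow[OF assms that], of s] that
    by (simp add: t_def u_def scaleR_add_right mult_ac)
  \<comment> \<open>Each term splits as \<open>t (n + 1) = u (n + 1) - u n\<close>.\<close>
  have "n \<le> k \<Longrightarrow> (\<Sum>s\<le>n. t s) = u n" for n
  proof (induction n)
    case 0
    then show ?case by (simp add: t fischer_factor_def)
  next
    case (Suc n)
    have "t (Suc n) = - u n + u (Suc n)"
      using fischer_coeff_Suc[of "CARD('m)" n k] Suc.prems
      by (simp add: t u_def del: fischer_coeff.simps funpow.simps)
    then show ?case using Suc by simp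
  qed
  then have "fdirac (fischer_proj k c) \<alpha> = u k"
    by (simp add: fischer_proj_def fdirac_lin t_def)
  then show "fdirac (fischer_proj k c) \<alpha> = 0"
    by (simp add: u_def fdirac_pow_eq_0[OF assms] del: funpow.simps)
qed

text \<open>
  The same factors govern \<open>\<partial>\<^sup>s(x q)\<close>, so this sum telescopes as well. It is what makes the
  monogenic part unique.
\<close>

lemma fischer_proj_vmul:
  fixes q :: "'m::{finite,linorder} coeffs"
  assumes "hom k q"
  shows "fischer_proj (Suc k) (vmul q) = (\<lambda>_. 0)"
proof
  fix \<alpha>
  let ?\<kappa> = "fischer_coeff CARD('m) (Suc k)"
  define u where "u s = ((-1) ^ s * ?\<kappa> s) *\<^sub>R (vmul ^^ Suc s) ((fdirac ^^ s) q) \<alpha>" for s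
  define t where "t s = ?\<kappa> s *\<^sub>R (vmul ^^ s) ((fdirac ^^ s) (vmul q)) \<alpha>" for s
  have t: "t s = u s + (?\<kappa> s * fischer_factor CARD('m) (Suc k) s) *\<^sub>R (vmul ^^ s) ((fdirac ^^ (s - 1)) q) \<alpha>"
    if "s \<le> Suc k" for s
    using fdirac_pow_vmul[OF assms that]
    by (simp add: t_def u_def vmul_pow_add scaleR_add_right mult_ac funpow_swap1)
  \<comment> \<open>Each term splits as \<open>t (n + 1) = u (n + 1) - u n\<close>.\<close>
  have "n \<le> Suc k \<Longrightarrow> (\<Sum>s\<le>n. t s) = u n" for n
  proof (induction n)
    case 0
    then show ?case by (simp add: t fischer_factor_def)
  next
    case (Suc n)
    have "t (Suc n) = - u n + u (Suc n)"
      using fischer_coeff_Suc[of "CARD('m)" n "Suc k"] Suc.prems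
      by (simp add: t u_def del: fischer_coeff.simps funpow.simps)
    then show ?case using Suc by simp
  qed
  then have "(\<Sum>s\<le>Suc k. t s) = u (Suc k)" by blast
  then have "fischer_proj (Suc k) (vmul q) \<alpha> = u (Suc k)"
    unfolding fischer_proj_def t_def .
  then show "fischer_proj (Suc k) (vmul q) \<alpha> = 0"
    by (simp add: u_def fdirac_pow_eq_0[OF assms] del: funpow.simps)
qed

lemma hom_fischer_proj:
  fixes c :: "'m::{finite,linorder} coeffs"
  assumes "hom k c"
  shows "hom k (fischer_proj k c)"
  unfolding hom_def fischer_proj_def
proof (intro allI impI sum.neutral ballI)
  fix \<alpha> :: "'m \<Rightarrow> nat" and s assume d: "deg \<alpha> \<noteq> k" and s: "s \<in> {..k}"
  then have "hom k ((vmul ^^ s) ((fdirac ^^ s) c))"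
    using hom_vmul_pow[OF hom_fdirac_pow[OF assms], of s s] by simp
  then show "fischer_coeff CARD('m) k s *\<^sub>R (vmul ^^ s) ((fdirac ^^ s) c) \<alpha> = 0"
    using d by (simp add: hom_def)
qed

lemma fischer_proj_eq_self:
  assumes "fdirac c = (\<lambda>_. 0)"
  shows "fischer_proj k c = c"
proof -
  have "(fdirac ^^ s) c = (\<lambda>_. 0)" if "s > 0" for s
    using that by (induction s rule: nat_induct_non_zero) (simp_all add: assms)
  then have "(\<Sum>s\<le>k. fischer_coeff CARD('a) k s *\<^sub>R (vmul ^^ s) ((fdirac ^^ s) c) \<alpha>)
      = (\<Sum>s\<in>{0}. fischer_coeff CARD('a) k s *\<^sub>R (vmul ^^ s) ((fdirac ^^ s) c) \<alpha>)" for \<alpha>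
    by (intro sum.mono_neutral_right) auto
  then show ?thesis
    by (simp add: fischer_proj_def)
qed

text \<open>
  All terms of the closed form with \<open>s \<ge> 1\<close> have a factor \<open>x\<close> on the left.
\<close>

lemma fischer_proj_decomp:
  fixes c :: "'m::{finite,linorder} coeffs"
  assumes "hom k c"
  shows "k = 0 \<Longrightarrow> fischer_proj k c = c"
    and "k = Suc l \<Longrightarrow> \<exists>q. hom l q \<and> c = (\<lambda>\<alpha>. fischer_proj k c \<alpha> + vmul q \<alpha>)"
proof -
  show "fischer_proj k c = c" if "k = 0"
    by (simp add: fischer_proj_def that)
  assume k: "k = Suc l"
  let ?\<kappa> = "fischer_coeff CARD('m) k"
  \<comment> \<open>Strip one factor \<open>x\<close> from the terms with \<open>s \<ge> 1\<close>.\<close>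
  define q where "q \<alpha> = (\<Sum>s\<le>l. (- ?\<kappa> (Suc s)) *\<^sub>R (vmul ^^ s) ((fdirac ^^ Suc s) c) \<alpha>)" for \<alpha>
  have "hom l q"
    unfolding hom_def q_def
  proof (intro allI impI sum.neutral ballI)
    fix \<alpha> :: "'m \<Rightarrow> nat" and s assume d: "deg \<alpha> \<noteq> l" and s: "s \<in> {..l}"
    then have "hom l ((vmul ^^ s) ((fdirac ^^ Suc s) c))"
      using hom_vmul_pow[OF hom_fdirac_pow[OF assms], of "Suc s" s] by (simp add: k)
    then show "(- ?\<kappa> (Suc s)) *\<^sub>R (vmul ^^ s) ((fdirac ^^ Suc s) c) \<alpha> = 0"
      using d by (simp add: hom_def)
  qed
  moreover have "c = (\<lambda>\<alpha>. fischer_proj k c \<alpha> + vmul q \<alpha>)"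
  proof
    fix \<alpha>
    have "vmul q = (\<lambda>\<alpha>. \<Sum>s\<le>l. (- ?\<kappa> (Suc s)) *\<^sub>R (vmul ^^ Suc s) ((fdirac ^^ Suc s) c) \<alpha>)"
      unfolding q_def[abs_def] vmul_lin by simp
    then have "vmul q \<alpha> = - (\<Sum>s\<le>l. ?\<kappa> (Suc s) *\<^sub>R (vmul ^^ Suc s) ((fdirac ^^ Suc s) c) \<alpha>)"
      by (simp add: sum_negf del: fischer_coeff.simps)
    moreover have "fischer_proj k c \<alpha> = c \<alpha>
        + (\<Sum>s\<le>l. ?\<kappa> (Suc s) *\<^sub>R (vmul ^^ Suc s) ((fdirac ^^ Suc s) c) \<alpha>)"
      unfolding fischer_proj_def k by (subst sum.atMost_Suc_shift) simp
    ultimately show "c \<alpha> = fischer_proj k c \<alpha> + vmul q \<alpha>" by simp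
  qed
  ultimately show "\<exists>q. hom l q \<and> c = (\<lambda>\<alpha>. fischer_proj k c \<alpha> + vmul q \<alpha>)" by blast
qed

lemma vmul_rlin: "vmul (\<lambda>\<alpha>. \<Sum>i\<in>I. c i \<alpha> \<odot> a i) = (\<lambda>\<alpha>. \<Sum>i\<in>I. vmul (c i) \<alpha> \<odot> a i)"
  using vmul_lin[of "\<lambda>_. 1" "\<lambda>i \<alpha>. c i \<alpha> \<odot> a i" I] by (simp add: vmul_rmult)

lemma fdirac_rlin: "fdirac (\<lambda>\<alpha>. \<Sum>i\<in>I. c i \<alpha> \<odot> a i) = (\<lambda>\<alpha>. \<Sum>i\<in>I. fdirac (c i) \<alpha> \<odot> a i)"
  using fdirac_lin[of "\<lambda>_. 1" "\<lambda>i \<alpha>. c i \<alpha> \<odot> a i" I] by (simp add: fdirac_rmult)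

text \<open>
  Both operators act from the left, so the projection is linear over Clifford constants on the
  right. This is why it passes through an integral against a Clifford-valued weight.
\<close>

lemma fischer_proj_rlin:
  "fischer_proj k (\<lambda>\<alpha>. \<Sum>i\<in>I. c i \<alpha> \<odot> a i) = (\<lambda>\<alpha>. \<Sum>i\<in>I. fischer_proj k (c i) \<alpha> \<odot> a i)"
proof
  fix \<alpha>
  have 1: "(fdirac ^^ s) (\<lambda>\<alpha>. \<Sum>i\<in>I. c i \<alpha> \<odot> a i) = (\<lambda>\<alpha>. \<Sum>i\<in>I. (fdirac ^^ s) (c i) \<alpha> \<odot> a i)" for s
    by (induction s) (simp_all add: fdirac_rlin)
  have 2: "(vmul ^^ s) (\<lambda>\<alpha>. \<Sum>i\<in>I. d i \<alpha> \<odot> a i) = (\<lambda>\<alpha>. \<Sum>i\<in>I. (vmul ^^ s) (d i) \<alpha> \<odot> a i)" for s d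
    by (induction s) (simp_all add: vmul_rlin)
  show "fischer_proj k (\<lambda>\<alpha>. \<Sum>i\<in>I. c i \<alpha> \<odot> a i) \<alpha> = (\<Sum>i\<in>I. fischer_proj k (c i) \<alpha> \<odot> a i)"
    unfolding fischer_proj_def 1 2 cl.sum_left cl.scaleR_left scaleR_sum_right by (rule sum.swap)
qed

definition restr :: "nat \<Rightarrow> 'm::{finite,linorder} coeffs \<Rightarrow> 'm coeffs" where
  "restr k c = (\<lambda>\<alpha>. if deg \<alpha> = k then c \<alpha> else 0)"

definition unit_coeff :: "('m \<Rightarrow> nat) \<Rightarrow> 'm::{finite,linorder} coeffs" where
  "unit_coeff \<beta> = (\<lambda>\<alpha>. if \<alpha> = \<beta> then cl_one else 0)"

lemma hom_restr [simp]: "hom k (restr k c)"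
  by (simp add: hom_def restr_def)

lemma restr_eq_sum_unit: "restr k c = (\<lambda>\<alpha>. \<Sum>\<beta>\<in>multi_indices k. unit_coeff \<beta> \<alpha> \<odot> c \<beta>)"
proof
  fix \<alpha>
  have "(\<Sum>\<beta>\<in>multi_indices k. unit_coeff \<beta> \<alpha> \<odot> c \<beta>) = (\<Sum>\<beta>\<in>multi_indices k. if \<beta> = \<alpha> then c \<alpha> else 0)"
    by (intro sum.cong refl) (auto simp: unit_coeff_def cl_one_left cl.zero_left)
  then show "restr k c \<alpha> = (\<Sum>\<beta>\<in>multi_indices k. unit_coeff \<beta> \<alpha> \<odot> c \<beta>)"
    by (simp add: restr_def multi_indices_iff)
qed

section \<open>Growth of the projection\<close>

definition cnorm :: "nat \<Rightarrow> 'm::{finite,linorder} coeffs \<Rightarrow> real" where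
  "cnorm k c = (\<Sum>\<alpha>\<in>multi_indices k. norm (c \<alpha>))"

lemma cnorm_nonneg [simp]: "cnorm k c \<ge> 0"
  by (simp add: cnorm_def sum_nonneg)

lemma cnorm_vmul_le:
  "cnorm (Suc k) (vmul c) \<le> (cl_const TYPE('m) * CARD('m)) * cnorm k c"
  for c :: "'m::{finite,linorder} coeffs"
proof -
  let ?K = "cl_const TYPE('m)"
  have "norm (vmul c \<beta>) \<le> (\<Sum>j\<in>UNIV. if \<beta> j > 0 then ?K * norm (c (dec j \<beta>)) else 0)" for \<beta>
    unfolding vmul_def by (rule sum_norm_le) (auto intro: norm_cl_e_mult_le)
  then have "cnorm (Suc k) (vmul c)
      \<le> (\<Sum>\<beta>\<in>multi_indices (Suc k). \<Sum>j\<in>UNIV. if \<beta> j > 0 then ?K * norm (c (dec j \<beta>)) else 0)"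
    unfolding cnorm_def by (rule sum_mono)
  also have "\<dots> = (\<Sum>j\<in>UNIV. \<Sum>\<beta>\<in>multi_indices (Suc k). if \<beta> j > 0 then ?K * norm (c (dec j \<beta>)) else 0)"
    by (rule sum.swap)
  also have "\<dots> = (\<Sum>j\<in>(UNIV :: 'm set). ?K * cnorm k c)"
    unfolding sum_multi_indices_Suc by (simp add: cnorm_def sum_distrib_left)
  finally show ?thesis by (simp add: mult_ac)
qed

lemma cnorm_fdirac_le:
  "cnorm k (fdirac c) \<le> (real (Suc k) * cl_const TYPE('m)) * cnorm (Suc k) c"
  for c :: "'m::{finite,linorder} coeffs"
proof -
  let ?K = "cl_const TYPE('m)"
  have "norm (fdirac c \<alpha>) \<le> (\<Sum>j\<in>UNIV. real (Suc (\<alpha> j)) * (?K * norm (c (inc j \<alpha>))))" for \<alpha>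
    unfolding fdirac_def by (rule sum_norm_le) (auto intro!: norm_cl_e_mult_le mult_left_mono)
  then have "cnorm k (fdirac c)
      \<le> (\<Sum>\<alpha>\<in>multi_indices k. \<Sum>j\<in>UNIV. real (Suc (\<alpha> j)) * (?K * norm (c (inc j \<alpha>))))"
    unfolding cnorm_def by (rule sum_mono)
  also have "\<dots> = (\<Sum>j\<in>UNIV. \<Sum>\<alpha>\<in>multi_indices k. real (inc j \<alpha> j) * (?K * norm (c (inc j \<alpha>))))"
    by (subst sum.swap) simp
  also have "\<dots> = (\<Sum>j\<in>UNIV. \<Sum>\<beta>\<in>multi_indices (Suc k). if \<beta> j > 0 then real (\<beta> j) * (?K * norm (c \<beta>)) else 0)"
    by (simp only: sum_multi_indices_Suc)
  also have "\<dots> = (\<Sum>j\<in>UNIV. \<Sum>\<beta>\<in>multi_indices (Suc k). real (\<beta> j) * (?K * norm (c \<beta>)))"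
    by (intro sum.cong refl) auto
  also have "\<dots> = (\<Sum>\<beta>\<in>multi_indices (Suc k). (\<Sum>j\<in>UNIV. real (\<beta> j)) * (?K * norm (c \<beta>)))"
    by (subst sum.swap) (simp add: sum_distrib_right)
  also have "\<dots> = (\<Sum>\<beta>\<in>multi_indices (Suc k). real (Suc k) * (?K * norm (c \<beta>)))"
    by (intro sum.cong refl) (simp add: multi_indices_iff flip: of_nat_sum)
  finally show ?thesis by (simp add: cnorm_def sum_distrib_left mult_ac)
qed

definition proj_const :: "'m::{finite,linorder} itself \<Rightarrow> real" where
  "proj_const T = 1 + cl_const T * CARD('m) * cl_const T"

lemma proj_const_ge_1: "proj_const TYPE('m::{finite,linorder}) \<ge> 1"
  using cl_const_pos[where 'm = 'm] by (simp add: proj_const_def)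

text \<open>
  The operator \<open>\<partial>\<^sup>s\<close> costs at most \<open>C\<^sup>s k!/(k-s)!\<close> on degree \<open>k\<close> and \<open>x\<^sup>s\<close> at most \<open>C\<^sup>s\<close>. With
  \<open>|\<kappa>\<^sub>s| \<le> 1/s!\<close> the bound becomes a binomial sum, so the projection grows only exponentially with
  the degree and preserves entire series.
\<close>

lemma cnorm_fischer_proj_le:
  fixes c :: "'m::{finite,linorder} coeffs"
  shows "cnorm k (fischer_proj k c) \<le> proj_const TYPE('m) ^ k * cnorm k c"
proof -
  define K where "K = cl_const TYPE('m)"
  define A where "A = K * CARD('m)"
  have K: "K \<ge> 0" and A: "A \<ge> 0" using cl_const_pos[where 'm = 'm] by (simp_all add: K_def A_def)
  have V: "cnorm (l + s) ((vmul ^^ s) d) \<le> A ^ s * cnorm l d" for l s and d :: "'m coeffs"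
  proof (induction s)
    case (Suc s)
    have "cnorm (l + Suc s) ((vmul ^^ Suc s) d) \<le> A * cnorm (l + s) ((vmul ^^ s) d)"
      using cnorm_vmul_le[of "l + s" "(vmul ^^ s) d"] by (simp add: A_def K_def)
    also have "\<dots> \<le> A * (A ^ s * cnorm l d)" using Suc A by (rule mult_left_mono)
    finally show ?case by (simp add: mult_ac)
  qed simp
  have D: "s \<le> k \<Longrightarrow> cnorm (k - s) ((fdirac ^^ s) c) \<le> K ^ s * (fact k / fact (k - s)) * cnorm k c" for s
  proof (induction s)
    case (Suc s)
    then have k: "Suc (k - Suc s) = k - s" by simp
    have "cnorm (k - Suc s) ((fdirac ^^ Suc s) c) \<le> (real (k - s) * K) * cnorm (k - s) ((fdirac ^^ s) c)"
      using cnorm_fdirac_le[of "k - Suc s" "(fdirac ^^ s) c"] unfolding k by (simp add: K_def)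
    also have "\<dots> \<le> (real (k - s) * K) * (K ^ s * (fact k / fact (k - s)) * cnorm k c)"
      using Suc K by (intro mult_left_mono) auto
    also have "\<dots> = K ^ Suc s * (fact k * (real (k - s) / fact (k - s))) * cnorm k c"
      by simp
    also have "real (k - s) / fact (k - s) = 1 / fact (k - Suc s)"
      unfolding k[symmetric] fact_Suc by simp
    finally show ?case by simp
  qed simp
  have "cnorm k (fischer_proj k c)
      \<le> (\<Sum>\<alpha>\<in>multi_indices k. \<Sum>s\<le>k. \<bar>fischer_coeff CARD('m) k s\<bar> * norm ((vmul ^^ s) ((fdirac ^^ s) c) \<alpha>))"
    unfolding cnorm_def fischer_proj_def by (intro sum_mono sum_norm_le) simp
  also have "\<dots> = (\<Sum>s\<le>k. \<bar>fischer_coeff CARD('m) k s\<bar> * cnorm k ((vmul ^^ s) ((fdirac ^^ s) c)))"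
    by (subst sum.swap) (simp add: cnorm_def sum_distrib_left)
  also have "\<dots> \<le> (\<Sum>s\<le>k. real (k choose s) * (A * K) ^ s * cnorm k c)"
  proof (rule sum_mono)
    fix s assume "s \<in> {..k}"
    then have s: "s \<le> k" by simp
    have "cnorm k ((vmul ^^ s) ((fdirac ^^ s) c)) \<le> A ^ s * cnorm (k - s) ((fdirac ^^ s) c)"
      using V[of "k - s" s "(fdirac ^^ s) c"] s by simp
    also have "\<dots> \<le> A ^ s * (K ^ s * (fact k / fact (k - s)) * cnorm k c)"
      using D[OF s] A by (intro mult_left_mono) auto
    finally have "\<bar>fischer_coeff CARD('m) k s\<bar> * cnorm k ((vmul ^^ s) ((fdirac ^^ s) c))
        \<le> (1 / fact s) * (A ^ s * (K ^ s * (fact k / fact (k - s)) * cnorm k c))"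
      using abs_fischer_coeff_le[OF _ s] by (intro mult_mono) auto
    also have "\<dots> = real (k choose s) * (A * K) ^ s * cnorm k c"
      using s by (simp add: binomial_fact power_mult_distrib)
    finally show "\<bar>fischer_coeff CARD('m) k s\<bar> * cnorm k ((vmul ^^ s) ((fdirac ^^ s) c))
        \<le> real (k choose s) * (A * K) ^ s * cnorm k c" .
  qed
  also have "\<dots> = (A * K + 1) ^ k * cnorm k c"
    by (simp add: binomial_ring sum_distrib_right)
  finally show ?thesis by (simp add: proj_const_def A_def K_def add.commute)
qed

section \<open>Evaluation of homogeneous polynomials\<close>

definition mon :: "'a::comm_semiring_1 ^ 'm::finite \<Rightarrow> ('m \<Rightarrow> nat) \<Rightarrow> 'a" where
  "mon z \<alpha> = (\<Prod>j\<in>UNIV. (z $ j) ^ \<alpha> j)"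

lemma mon_inc: "mon z (inc j \<alpha>) = z $ j * mon z \<alpha>"
proof -
  have "mon z (inc j \<alpha>) = z $ j ^ Suc (\<alpha> j) * (\<Prod>i\<in>UNIV - {j}. z $ i ^ inc j \<alpha> i)"
    unfolding mon_def by (subst prod.remove[of _ j]) auto
  also have "(\<Prod>i\<in>UNIV - {j}. z $ i ^ inc j \<alpha> i) = (\<Prod>i\<in>UNIV - {j}. z $ i ^ \<alpha> i)"
    by (intro prod.cong) (auto simp: inc_other)
  also have "z $ j ^ Suc (\<alpha> j) * \<dots> = z $ j * mon z \<alpha>"
    unfolding mon_def by (subst (2) prod.remove[of _ j]) (auto simp: mult_ac)
  finally show ?thesis .
qed

lemma mon_0 [simp]: "mon z (\<lambda>_. 0) = 1"
  by (simp add: mon_def)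

lemma mon_complexify: "mon (complexify x) \<alpha> = complex_of_real (mon x \<alpha>)"
  by (simp add: mon_def complexify_def)

lemma norm_mon_le:
  fixes z :: "'a::real_normed_field ^ 'm::finite"
  shows "norm (mon z \<alpha>) \<le> norm z ^ deg \<alpha>"
proof -
  have "norm (mon z \<alpha>) = (\<Prod>j\<in>UNIV. norm (z $ j) ^ \<alpha> j)"
    by (simp add: mon_def norm_power flip: prod_norm)
  also have "\<dots> \<le> (\<Prod>j\<in>(UNIV :: 'm set). norm z ^ \<alpha> j)"
    by (intro prod_mono conjI power_mono) (simp_all add: Finite_Cartesian_Product.norm_nth_le)
  also have "\<dots> = norm z ^ deg \<alpha>" by (simp add: power_sum)
  finally show ?thesis .
qed

lemma has_derivative_mon:
  fixes z :: "'a::real_normed_field ^ 'm::finite"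
  shows "((\<lambda>z. mon z \<alpha>) has_derivative
     (\<lambda>h. \<Sum>j\<in>UNIV. h $ j * (of_nat (\<alpha> j) * mon z (dec j \<alpha>)))) (at z within S)"
proof -
  have "((\<lambda>z. mon z \<alpha>) has_derivative (\<lambda>h. \<Sum>j\<in>UNIV.
     (of_nat (\<alpha> j) * h $ j * (z $ j) ^ (\<alpha> j - 1)) * (\<Prod>i\<in>UNIV - {j}. (z $ i) ^ \<alpha> i))) (at z within S)"
    unfolding mon_def
    by (intro has_derivative_prod has_derivative_power
        bounded_linear.has_derivative[OF bounded_linear_vec_nth] has_derivative_ident)
  also have "(\<lambda>h. \<Sum>j\<in>UNIV.
     (of_nat (\<alpha> j) * h $ j * (z $ j) ^ (\<alpha> j - 1)) * (\<Prod>i\<in>UNIV - {j}. (z $ i) ^ \<alpha> i))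
     = (\<lambda>h. \<Sum>j\<in>UNIV. h $ j * (of_nat (\<alpha> j) * mon z (dec j \<alpha>)))"
  proof (intro ext sum.cong refl)
    fix h :: "'a ^ 'm" and j :: 'm
    have "mon z (dec j \<alpha>) = (z $ j) ^ (\<alpha> j - 1) * (\<Prod>i\<in>UNIV - {j}. (z $ i) ^ dec j \<alpha> i)"
      unfolding mon_def by (subst prod.remove[of _ j]) auto
    also have "(\<Prod>i\<in>UNIV - {j}. (z $ i) ^ dec j \<alpha> i) = (\<Prod>i\<in>UNIV - {j}. (z $ i) ^ \<alpha> i)"
      by (intro prod.cong) (auto simp: dec_other)
    finally show "(of_nat (\<alpha> j) * h $ j * (z $ j) ^ (\<alpha> j - 1)) * (\<Prod>i\<in>UNIV - {j}. (z $ i) ^ \<alpha> i)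
       = h $ j * (of_nat (\<alpha> j) * mon z (dec j \<alpha>))" by simp
  qed
  finally show ?thesis .
qed

text \<open>
  Only the coefficients of degree \<open>k\<close> enter, so a single family \<open>c\<close> describes all the homogeneous
  components of a series.
\<close>

definition ceval :: "nat \<Rightarrow> 'm::{finite,linorder} coeffs \<Rightarrow> 'm cspace \<Rightarrow> 'm clifford" where
  "ceval k c z = (\<Sum>\<alpha>\<in>multi_indices k. mon z \<alpha> *s c \<alpha>)"

definition reval :: "nat \<Rightarrow> 'm::{finite,linorder} coeffs \<Rightarrow> 'm rspace \<Rightarrow> 'm clifford" where
  "reval k c x = (\<Sum>\<alpha>\<in>multi_indices k. mon x \<alpha> *\<^sub>R c \<alpha>)"

definition pdiff :: "'m \<Rightarrow> 'm::{finite,linorder} coeffs \<Rightarrow> 'm coeffs" where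
  "pdiff j c \<alpha> = real (Suc (\<alpha> j)) *\<^sub>R c (inc j \<alpha>)"

lemma ceval_complexify: "ceval k c (complexify x) = reval k c x"
  by (simp add: ceval_def reval_def mon_complexify of_real_smult)

lemma chomogeneous_poly_iff: "chomogeneous_poly k P \<longleftrightarrow> (\<exists>c. P = ceval k c)"
  by (auto simp: chomogeneous_poly_def ceval_def mon_def fun_eq_iff)

lemma homogeneous_poly_iff: "homogeneous_poly k P \<longleftrightarrow> (\<exists>c. P = reval k c)"
  by (auto simp: homogeneous_poly_def reval_def mon_def fun_eq_iff)

lemma ceval_cong: "(\<And>\<alpha>. deg \<alpha> = k \<Longrightarrow> c \<alpha> = d \<alpha>) \<Longrightarrow> ceval k c = ceval k d"
  by (auto simp: ceval_def fun_eq_iff multi_indices_iff intro!: sum.cong)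

lemma reval_cong: "(\<And>\<alpha>. deg \<alpha> = k \<Longrightarrow> c \<alpha> = d \<alpha>) \<Longrightarrow> reval k c = reval k d"
  by (auto simp: reval_def fun_eq_iff multi_indices_iff intro!: sum.cong)

lemma ceval_add: "ceval k (\<lambda>\<alpha>. c \<alpha> + d \<alpha>) z = ceval k c z + ceval k d z"
  by (simp add: ceval_def sum.distrib vector_add_ldistrib)

lemma reval_diff: "reval k (\<lambda>\<alpha>. c \<alpha> - d \<alpha>) z = reval k c z - reval k d z"
  by (simp add: reval_def sum_subtractf scaleR_diff_right)

lemma ceval_rmult: "ceval k (\<lambda>\<alpha>. c \<alpha> \<odot> a) z = ceval k c z \<odot> a"
  by (simp add: ceval_def cl.sum_left cl_mult_smult_left)

lemma ceval_sum: "ceval k (\<lambda>\<alpha>. \<Sum>i\<in>I. c i \<alpha>) z = (\<Sum>i\<in>I. ceval k (c i) z)"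
  unfolding ceval_def sm.sum_right by (rule sum.swap)

lemma ceval_0: "ceval 0 c z = c (\<lambda>_. 0)"
  by (simp add: ceval_def multi_indices_0)

lemma norm_ceval_le: "norm (ceval k c z) \<le> norm z ^ k * cnorm k c"
proof -
  have "norm (ceval k c z) \<le> (\<Sum>\<alpha>\<in>multi_indices k. norm z ^ k * norm (c \<alpha>))"
    unfolding ceval_def
  proof (rule sum_norm_le)
    fix \<alpha> :: "'a \<Rightarrow> nat" assume "\<alpha> \<in> multi_indices k"
    then show "norm (mon z \<alpha> *s c \<alpha>) \<le> norm z ^ k * norm (c \<alpha>)"
      using norm_mon_le[of z \<alpha>] by (simp add: norm_smult_complex multi_indices_iff mult_right_mono)
  qed
  then show ?thesis by (simp add: cnorm_def sum_distrib_left)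
qed

lemma cvector_mult_ceval: "cvector z \<odot> ceval k c z = ceval (Suc k) (vmul c) z"
proof -
  have "ceval (Suc k) (vmul c) z = (\<Sum>\<beta>\<in>multi_indices (Suc k). \<Sum>j\<in>UNIV.
      if \<beta> j > 0 then mon z \<beta> *s (cl_e j \<odot> c (dec j \<beta>)) else 0)"
    unfolding ceval_def vmul_def sm.sum_right by (intro sum.cong refl) auto
  also have "\<dots> = (\<Sum>j\<in>UNIV. \<Sum>\<alpha>\<in>multi_indices k. mon z (inc j \<alpha>) *s (cl_e j \<odot> c \<alpha>))"
    by (subst sum.swap) (simp add: sum_multi_indices_Suc)
  also have "\<dots> = cvector z \<odot> ceval k c z"
    unfolding cvector_def ceval_def cl.sum_left unfolding cl.sum_right
    by (simp add: cl_mult_smult_left cl_mult_smult_right mon_inc vector_smult_assoc mult_ac)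
  finally show ?thesis by simp
qed

lemma has_derivative_ceval_Suc:
  "(ceval (Suc k) c has_derivative (\<lambda>h. \<Sum>j\<in>UNIV. h $ j *s ceval k (pdiff j c) z)) (at z within S)"
proof -
  have "(ceval (Suc k) c has_derivative (\<lambda>h. \<Sum>\<beta>\<in>multi_indices (Suc k).
     (\<Sum>j\<in>UNIV. h $ j * (of_nat (\<beta> j) * mon z (dec j \<beta>))) *s c \<beta>)) (at z within S)"
    unfolding ceval_def
    by (intro has_derivative_sum bounded_linear.has_derivative[OF sm.bounded_linear_left]
        has_derivative_mon)
  also have "(\<lambda>h. \<Sum>\<beta>\<in>multi_indices (Suc k).
     (\<Sum>j\<in>UNIV. h $ j * (of_nat (\<beta> j) * mon z (dec j \<beta>))) *s c \<beta>)
     = (\<lambda>h. \<Sum>j\<in>UNIV. h $ j *s ceval k (pdiff j c) z)" (is "?L = ?R")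
  proof
    fix h
    have "?L h = (\<Sum>\<beta>\<in>multi_indices (Suc k). \<Sum>j\<in>UNIV.
        if \<beta> j > 0 then (h $ j * (of_nat (\<beta> j) * mon z (dec j \<beta>))) *s c \<beta> else 0)"
      unfolding sm.sum_left by (intro sum.cong refl) auto
    also have "\<dots> = (\<Sum>j\<in>UNIV. \<Sum>\<alpha>\<in>multi_indices k.
        (h $ j * (of_nat (Suc (\<alpha> j)) * mon z \<alpha>)) *s c (inc j \<alpha>))"
      by (subst sum.swap) (simp add: sum_multi_indices_Suc)
    also have "\<dots> = ?R h"
      unfolding ceval_def sm.sum_right pdiff_def
      by (intro sum.cong refl) (simp only: of_real_smult[symmetric] vector_smult_assoc, simp add: mult_ac)
    finally show "?L h = ?R h" .
  qed
  finally show ?thesis .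
qed

lemma has_derivative_ceval_0: "(ceval 0 c has_derivative (\<lambda>h. 0)) (at z within S)"
  by (simp add: ceval_0[abs_def])

lemma fdirac_eq_sum_pdiff: "fdirac c \<alpha> = (\<Sum>j\<in>UNIV. cl_e j \<odot> pdiff j c \<alpha>)"
  by (simp add: fdirac_def pdiff_def cl.scaleR_right)

lemma ceval_fdirac: "ceval k (fdirac c) z = (\<Sum>j\<in>UNIV. cl_e j \<odot> ceval k (pdiff j c) z)"
  unfolding fdirac_eq_sum_pdiff[abs_def]
  by (simp add: ceval_sum) (simp add: ceval_def cl.sum_right cl_mult_smult_right)

text \<open>
  A complex linear derivative given by its values \<open>d j\<close> on the coordinate vectors. The real
  operator, the complex operator and holomorphy of an entire function are all read off from it.
\<close>

definition complex_linear_derivative ::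
  "('m::finite cspace \<Rightarrow> complex ^ 'n::finite) \<Rightarrow> ('m \<Rightarrow> complex ^ 'n) \<Rightarrow> 'm cspace \<Rightarrow> bool" where
  "complex_linear_derivative F d z \<longleftrightarrow> (F has_derivative (\<lambda>h. \<Sum>j\<in>UNIV. h $ j *s d j)) (at z)"

lemma deriv_component:
  assumes "complex_linear_derivative F d z"
  shows "deriv (\<lambda>w. F (z + axis j w) $ A) 0 = d j $ A"
proof (rule DERIV_imp_deriv)
  have F: "(F has_derivative (\<lambda>h. \<Sum>j\<in>UNIV. h $ j *s d j)) (at (z + axis j 0))"
    using assms by (simp add: complex_linear_derivative_def axis_def vec_eq_iff zero_vec_def[symmetric])
  have ax: "((\<lambda>w. z + axis j w) has_derivative axis j) (at (0::complex))"
  proof -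
    have "bounded_linear (axis j :: complex \<Rightarrow> complex ^ 'a)"
      by (intro linear_conv_bounded_linear[THEN iffD1] linearI) (auto simp: axis_def vec_eq_iff)
    then show ?thesis
      by (auto intro!: derivative_eq_intros bounded_linear_imp_has_derivative)
  qed
  have "((\<lambda>w. F (z + axis j w) $ A) has_derivative (\<lambda>w. (\<Sum>i\<in>UNIV. axis j w $ i *s d i) $ A)) (at 0)"
    by (rule bounded_linear.has_derivative[OF bounded_linear_vec_nth has_derivative_compose[OF ax F]])
  also have "(\<lambda>w. (\<Sum>i\<in>UNIV. axis j w $ i *s d i) $ A) = (\<lambda>w. d j $ A * w)"
  proof
    fix w :: complex
    have "(\<Sum>i\<in>UNIV. axis j w $ i *s d i) = (\<Sum>i\<in>UNIV. if i = j then w *s d j else 0)"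
      by (intro sum.cong) (auto simp: axis_def)
    then show "(\<Sum>i\<in>UNIV. axis j w $ i *s d i) $ A = d j $ A * w" by simp
  qed
  finally show "((\<lambda>w. F (z + axis j w) $ A) has_field_derivative d j $ A) (at 0)"
    by (simp add: has_field_derivative_def)
qed

lemma cdirac_eq:
  assumes "complex_linear_derivative F d z"
  shows "cdirac F z = (\<Sum>j\<in>UNIV. cl_e j \<odot> d j)"
  unfolding cdirac_def deriv_component[OF assms] by simp

lemma bounded_linear_complexify: "bounded_linear (complexify :: 'm::finite rspace \<Rightarrow> _)"
  by (intro linear_conv_bounded_linear[THEN iffD1] linearI)
     (simp_all add: complexify_def vec_eq_iff complex_eq_iff)

lemma has_derivative_complexify:
  assumes "complex_linear_derivative F d (complexify x)"
  shows "((\<lambda>x. F (complexify x)) has_derivative (\<lambda>h. \<Sum>j\<in>UNIV. h $ j *\<^sub>R d j)) (at x)"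
proof -
  have "((\<lambda>x. F (complexify x)) has_derivative
      (\<lambda>h. \<Sum>j\<in>UNIV. complexify h $ j *s d j)) (at x)"
    using bounded_linear_imp_has_derivative[OF bounded_linear_complexify]
      assms[unfolded complex_linear_derivative_def]
    by (rule has_derivative_compose)
  then show ?thesis by (simp add: complexify_def of_real_smult)
qed

lemma partial_deriv_eq:
  assumes "(g has_derivative g') (at x)"
  shows "partial_deriv j g x = g' (axis j 1)"
  unfolding partial_deriv_def
proof (rule vector_derivative_at)
  have g: "(g has_derivative g') (at (x + 0 *\<^sub>R axis j 1))" using assms by simp
  have "((\<lambda>t. x + t *\<^sub>R axis j 1) has_derivative (\<lambda>t. t *\<^sub>R axis j 1)) (at (0::real))"
    by (auto intro!: derivative_eq_intros)
  from has_derivative_compose[OF this g]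
  show "((\<lambda>t. g (x + t *\<^sub>R axis j 1)) has_vector_derivative g' (axis j 1)) (at 0)"
    by (simp add: has_vector_derivative_def linear_cmul[OF has_derivative_linear[OF assms]])
qed

lemma partial_deriv_complexify:
  assumes "complex_linear_derivative F d (complexify x)"
  shows "partial_deriv j (\<lambda>x. F (complexify x)) x = d j"
proof -
  have "(\<Sum>i\<in>UNIV. axis j (1::real) $ i *\<^sub>R d i) = (\<Sum>i\<in>UNIV. if i = j then d j else 0)"
    by (intro sum.cong) (auto simp: axis_def)
  then show ?thesis
    by (subst partial_deriv_eq[OF has_derivative_complexify[OF assms]]) simp
qed

lemma complex_linear_derivative_ceval_Suc:
  "complex_linear_derivative (ceval (Suc k) c) (\<lambda>j. ceval k (pdiff j c) z) z"
  unfolding complex_linear_derivative_def by (rule has_derivative_ceval_Suc)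

lemma complex_linear_derivative_ceval_0:
  "complex_linear_derivative (ceval 0 c) (\<lambda>j. 0) z"
  unfolding complex_linear_derivative_def using has_derivative_ceval_0[of c z UNIV] by simp

lemma cdirac_ceval_Suc: "cdirac (ceval (Suc k) c) z = ceval k (fdirac c) z"
  by (simp add: cdirac_eq[OF complex_linear_derivative_ceval_Suc] ceval_fdirac)

lemma cdirac_ceval_0: "cdirac (ceval 0 c) z = 0"
  by (simp add: cdirac_eq[OF complex_linear_derivative_ceval_0] cl.zero_right)

lemma partial_deriv_reval_Suc: "partial_deriv j (reval (Suc k) c) x = reval k (pdiff j c) x"
  using partial_deriv_complexify[OF complex_linear_derivative_ceval_Suc, of j k c x]
  by (simp add: ceval_complexify)

lemma partial_deriv_reval_0: "partial_deriv j (reval 0 c) x = 0"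
  using partial_deriv_complexify[OF complex_linear_derivative_ceval_0, of j c x]
  by (simp add: ceval_complexify)

lemma dirac_reval_Suc: "dirac (reval (Suc k) c) x = reval k (fdirac c) x"
  by (simp add: dirac_def partial_deriv_reval_Suc ceval_fdirac flip: ceval_complexify)

lemma dirac_reval_0: "dirac (reval 0 c) x = 0"
  by (simp add: dirac_def partial_deriv_reval_0 cl.zero_right)

lemma rvector_mult_reval: "rvector x \<odot> reval k c x = reval (Suc k) (vmul c) x"
proof -
  have "rvector x = cvector (complexify x)"
    by (simp add: rvector_def cvector_def complexify_def of_real_smult)
  then show ?thesis using cvector_mult_ceval[of "complexify x" k c] by (simp add: ceval_complexify)
qed

section \<open>Uniqueness of coefficients\<close>

text \<open>
  Differentiation lowers the degree, down to the constants.
\<close>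

lemma reval_eq_0_imp:
  assumes "\<And>x. reval k c x = 0" "deg \<alpha> = k"
  shows "c \<alpha> = 0"
  using assms
proof (induction k arbitrary: c \<alpha>)
  case 0
  then have "\<alpha> = (\<lambda>_. 0)" by (auto simp: fun_eq_iff)
  then show ?case using 0(1)[of 0] by (simp add: reval_def multi_indices_0)
next
  case (Suc k)
  obtain j where j: "\<alpha> j > 0"
    using Suc.prems(2) by (metis gr0I sum.neutral nat.distinct(1))
  have "reval (Suc k) c = (\<lambda>_. 0)" using Suc.prems(1) by (simp add: fun_eq_iff)
  then have "reval k (pdiff j c) x = 0" for x
    using partial_deriv_reval_Suc[of j k c x] by (simp add: partial_deriv_def)
  then have "pdiff j c (dec j \<alpha>) = 0"
    using Suc.IH[of "pdiff j c" "dec j \<alpha>"] deg_dec[of \<alpha> j, OF j] Suc.prems(2) by simp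
  then show ?case by (simp add: pdiff_def inc_dec[of \<alpha> j, OF j])
qed

lemma reval_inject:
  assumes "\<And>x. reval k c x = reval k d x" "deg \<alpha> = k"
  shows "c \<alpha> = d \<alpha>"
  using reval_eq_0_imp[of k "\<lambda>\<alpha>. c \<alpha> - d \<alpha>"] assms by (simp add: reval_diff)

lemma ceval_inject:
  assumes "\<And>x. ceval k c x = ceval k d x" "deg \<alpha> = k"
  shows "c \<alpha> = d \<alpha>"
  using assms reval_inject[of k c d \<alpha>] by (simp flip: ceval_complexify)

lemma reval_scaleR: "reval k c (t *\<^sub>R x) = t ^ k *\<^sub>R reval k c x"
proof -
  have "mon (t *\<^sub>R x) \<alpha> = t ^ deg \<alpha> * mon x \<alpha>" for \<alpha>
    by (simp add: mon_def power_mult_distrib prod.distrib power_sum)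
  then show ?thesis
    by (simp add: reval_def scaleR_sum_right multi_indices_iff)
qed

lemma power_series_zero:
  fixes a :: "nat \<Rightarrow> real"
  assumes "\<delta> > 0" "\<And>t. \<bar>t\<bar> < \<delta> \<Longrightarrow> (\<lambda>k. a k * t ^ k) sums 0"
  shows "a k = 0"
proof (rule ccontr)
  assume "a k \<noteq> 0"
  have s: "\<And>x. norm x < \<delta> \<Longrightarrow> (\<lambda>n. a n * x ^ n) sums (\<lambda>_. 0) x" using assms(2) by simp
  have f0: "(\<lambda>_::real. 0::real) 0 = 0" by simp
  show False
  proof (cases "k = 0")
    case True
    have "(\<lambda>n. a n * 0 ^ n) sums (\<lambda>_. 0) (0::real)" using s[of 0] assms(1) by simp
    then have "a 0 = 0" by (metis powser_sums_zero_iff)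
    then show False using True \<open>a k \<noteq> 0\<close> by simp
  next
    case False
    then have "k > 0" by simp
    obtain s where "0 < s" "\<And>z::real. z \<in> cball 0 s - {0} \<Longrightarrow> (\<lambda>_. 0::real) z \<noteq> 0"
      using powser_0_nonzero[of \<delta> 0 a "\<lambda>_. 0" k] s f0 \<open>a k \<noteq> 0\<close> \<open>k > 0\<close> assms(1) by auto
    from this(2)[of s] \<open>0 < s\<close> show False by simp
  qed
qed

text \<open>
  Along each ray the expansion is a power series in one real variable, whose coefficients are the
  values of the homogeneous components.
\<close>

lemma reval_sums_0_imp:
  assumes "\<forall>\<^sub>F x in nhds 0. (\<lambda>k. reval k (c k) x) sums 0"
  shows "reval k (c k) x = 0"
proof -
  obtain \<delta> where \<delta>: "\<delta> > 0" "\<And>y. norm y < \<delta> \<Longrightarrow> (\<lambda>k. reval k (c k) y) sums 0"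
    using assms by (auto simp: eventually_nhds_metric)
  define \<epsilon> where "\<epsilon> = \<delta> / (1 + norm x)"
  have e: "\<epsilon> > 0" using \<delta>(1) by (simp add: \<epsilon>_def add_pos_nonneg)
  have s: "(\<lambda>k. t ^ k *\<^sub>R reval k (c k) x) sums 0" if "\<bar>t\<bar> < \<epsilon>" for t
  proof -
    have "\<bar>t\<bar> * norm x \<le> \<bar>t\<bar> * (1 + norm x)" by (simp add: mult_left_mono)
    also have "\<dots> < \<delta>" using that by (simp add: \<epsilon>_def pos_less_divide_eq add_pos_nonneg)
    finally show ?thesis using \<delta>(2)[of "t *\<^sub>R x"] by (simp add: reval_scaleR)
  qed
  have "reval k (c k) x $ A = 0" for A
  proof (rule complex_eqI)
    show "Re (reval k (c k) x $ A) = Re 0"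
    proof (simp, rule power_series_zero[OF e])
      fix t assume "\<bar>t\<bar> < \<epsilon>"
      from bounded_linear.sums[OF bounded_linear_compose[OF bounded_linear_Re bounded_linear_vec_nth] s[OF this], of A]
      show "(\<lambda>k. Re (reval k (c k) x $ A) * t ^ k) sums 0" by (simp add: mult.commute)
    qed
    show "Im (reval k (c k) x $ A) = Im 0"
    proof (simp, rule power_series_zero[OF e])
      fix t assume "\<bar>t\<bar> < \<epsilon>"
      from bounded_linear.sums[OF bounded_linear_compose[OF bounded_linear_Im bounded_linear_vec_nth] s[OF this], of A]
      show "(\<lambda>k. Im (reval k (c k) x $ A) * t ^ k) sums 0" by (simp add: mult.commute)
    qed
  qed
  then show ?thesis by (simp add: vec_eq_iff)
qed

lemma expansion_coeff_unique:
  assumes "\<forall>\<^sub>F x in nhds 0. (\<lambda>k. reval k (c k) x) sums F x"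
    and "\<forall>\<^sub>F x in nhds 0. (\<lambda>k. reval k (d k) x) sums F x"
    and "deg \<alpha> = k"
  shows "c k \<alpha> = d k \<alpha>"
proof -
  have "\<forall>\<^sub>F x in nhds 0. (\<lambda>k. reval k (\<lambda>\<alpha>. c k \<alpha> - d k \<alpha>) x) sums 0"
    using assms(1,2)
  proof eventually_elim
    case (elim x)
    from sums_diff[OF this] show ?case by (simp add: reval_diff)
  qed
  from reval_sums_0_imp[OF this] have "reval k (\<lambda>\<alpha>. c k \<alpha> - d k \<alpha>) x = 0" for x .
  from reval_eq_0_imp[OF this assms(3)] show ?thesis by simp
qed

lemma the_homogeneous_expansion:
  assumes "\<forall>\<^sub>F x in nhds 0. (\<lambda>k. reval k c x) sums F x"
  shows "(THE R. homogeneous_expansion F R) = (\<lambda>k. reval k c)"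
proof (rule the_equality)
  show "homogeneous_expansion F (\<lambda>k. reval k c)"
    using assms by (auto simp: homogeneous_expansion_def homogeneous_poly_iff)
  fix R assume R: "homogeneous_expansion F R"
  then have "\<forall>k. \<exists>d. R k = reval k d" by (simp add: homogeneous_expansion_def homogeneous_poly_iff)
  then obtain d where d: "R k = reval k (d k)" for k by metis
  have "\<forall>\<^sub>F x in nhds 0. (\<lambda>k. reval k (d k) x) sums F x"
    using R by (simp add: homogeneous_expansion_def d)
  from expansion_coeff_unique[OF this assms] have "reval k (d k) = reval k c" for k
    by (intro reval_cong) blast
  then show "R = (\<lambda>k. reval k c)" by (simp add: fun_eq_iff d)
qed

lemma the_chomogeneous_expansion:
  assumes "\<And>z. (\<lambda>k. ceval k c z) sums F z"
  shows "(THE R. chomogeneous_expansion F R) = (\<lambda>k. ceval k c)"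
proof (rule the_equality)
  show "chomogeneous_expansion F (\<lambda>k. ceval k c)"
    using assms by (auto simp: chomogeneous_expansion_def chomogeneous_poly_iff)
  fix R assume R: "chomogeneous_expansion F R"
  then have "\<forall>k. \<exists>d. R k = ceval k d" by (simp add: chomogeneous_expansion_def chomogeneous_poly_iff)
  then obtain d where d: "R k = ceval k (d k)" for k by metis
  have 1: "\<forall>\<^sub>F x in nhds 0. (\<lambda>k. reval k (d k) x) sums F (complexify x)"
    using R by (simp add: chomogeneous_expansion_def d flip: ceval_complexify)
  have 2: "\<forall>\<^sub>F x in nhds 0. (\<lambda>k. reval k c x) sums F (complexify x)"
    using assms by (simp flip: ceval_complexify)
  from expansion_coeff_unique[OF 1 2] have "ceval k (d k) = ceval k c" for k
    by (intro ceval_cong) blast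
  then show "R = (\<lambda>k. ceval k c)" by (simp add: fun_eq_iff d)
qed

section \<open>The monogenic part of a homogeneous polynomial\<close>

lemma fischer_proj_add:
  "fischer_proj k (\<lambda>\<alpha>. c \<alpha> + d \<alpha>) = (\<lambda>\<alpha>. fischer_proj k c \<alpha> + fischer_proj k d \<alpha>)"
  using fischer_proj_rlin[of k "\<lambda>i. if i then c else d" "\<lambda>_. cl_one" "{True, False}"]
  by (simp add: cl_one_right)

text \<open>
  The projection fixes the monogenic component and annihilates the component with a factor \<open>x\<close>.
\<close>

lemma fischer_unique:
  assumes c: "hom k c" and M: "hom k d" "fdirac d = (\<lambda>_. 0)"
    and Q: "if k = 0 then q = (\<lambda>_. 0) else hom (k - 1) q"
    and eq: "c = (\<lambda>\<alpha>. d \<alpha> + vmul q \<alpha>)"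
  shows "d = fischer_proj k c"
proof (cases k)
  case 0
  then have "vmul q = (\<lambda>_. 0)" using Q by simp
  then have "c = d" using eq by simp
  then show ?thesis using 0 by (simp add: fischer_proj_def)
next
  case (Suc l)
  then show ?thesis
    using fischer_proj_eq_self[OF M(2), of k] fischer_proj_vmul[of l q] Q Suc eq
    by (simp add: fischer_proj_add)
qed

text \<open>
  What the real and the complex Fischer decompositions have in common: homogeneous polynomials are
  evaluations of coefficient families, which they determine, and the differential operator and
  the multiplication by vectors act on the families by \<open>fdirac\<close> and \<open>vmul\<close>.
\<close>

locale polynomial_evaluation =
  fixes ev :: "nat \<Rightarrow> 'm::{finite,linorder} coeffs \<Rightarrow> 'v \<Rightarrow> 'm clifford"
    and hpoly :: "nat \<Rightarrow> ('v \<Rightarrow> 'm clifford) \<Rightarrow> bool"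
    and dir :: "('v \<Rightarrow> 'm clifford) \<Rightarrow> 'v \<Rightarrow> 'm clifford"
    and vec :: "'v \<Rightarrow> 'm clifford"
  assumes hpoly_iff: "hpoly k P \<longleftrightarrow> (\<exists>c. P = ev k c)"
    and ev_cong: "(\<And>\<alpha>. deg \<alpha> = k \<Longrightarrow> c \<alpha> = d \<alpha>) \<Longrightarrow> ev k c = ev k d"
    and ev_inject: "(\<And>x. ev k c x = ev k d x) \<Longrightarrow> deg \<alpha> = k \<Longrightarrow> c \<alpha> = d \<alpha>"
    and ev_add: "ev k (\<lambda>\<alpha>. c \<alpha> + d \<alpha>) x = ev k c x + ev k d x"
    and dir_ev_0: "dir (ev 0 c) x = 0"
    and dir_ev_Suc: "dir (ev (Suc k) c) x = ev k (fdirac c) x"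
    and vec_mult_ev: "vec x \<odot> ev k c x = ev (Suc k) (vmul c) x"
begin

lemma ev_restr: "ev k (restr k c) = ev k c"
  by (rule ev_cong) (simp add: restr_def)

lemma ev_zero: "ev k (\<lambda>_. 0) x = 0"
  using ev_add[of k "\<lambda>_. 0" "\<lambda>_. 0" x] by simp

lemma the_monogenic_part:
  "(THE M. hpoly k M \<and> (\<forall>x. dir M x = 0) \<and>
     (\<exists>Q. (if k = 0 then \<forall>x. Q x = 0 else hpoly (k - 1) Q) \<and>
          (\<forall>x. ev k c x = M x + vec x \<odot> Q x))) = ev k (fischer_proj k (restr k c))"
proof (rule the_equality)
  let ?c = "restr k c"
  let ?M = "fischer_proj k ?c"
  have hM: "hom k ?M" and dM: "fdirac ?M = (\<lambda>_. 0)"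
    by (simp_all add: hom_fischer_proj fdirac_fischer_proj)
  have "dir (ev k ?M) z = 0" for z
    using dM by (cases k) (simp_all add: dir_ev_0 dir_ev_Suc ev_zero)
  moreover have "\<exists>Q. (if k = 0 then \<forall>z. Q z = 0 else hpoly (k - 1) Q) \<and>
      (\<forall>z. ev k c z = ev k ?M z + vec z \<odot> Q z)"
  proof (cases k)
    case 0
    then show ?thesis
      using fischer_proj_decomp(1)[of k ?c] by (intro exI[of _ "\<lambda>_. 0"]) (simp add: cl.zero_right ev_restr)
  next
    case (Suc l)
    obtain q where q: "hom l q" "?c = (\<lambda>\<alpha>. ?M \<alpha> + vmul q \<alpha>)"
      using fischer_proj_decomp(2)[of k ?c l] Suc by auto
    have "ev k c z = ev k ?M z + vec z \<odot> ev l q z" for z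
      using arg_cong[OF q(2), of "\<lambda>c. ev k c z"] by (simp add: ev_add ev_restr vec_mult_ev Suc)
    then show ?thesis using Suc by (auto simp: hpoly_iff)
  qed
  ultimately show "hpoly k (ev k ?M) \<and> (\<forall>z. dir (ev k ?M) z = 0) \<and>
     (\<exists>Q. (if k = 0 then \<forall>z. Q z = 0 else hpoly (k - 1) Q) \<and>
      (\<forall>z. ev k c z = ev k ?M z + vec z \<odot> Q z))"
    by (auto simp: hpoly_iff)
next
  fix M assume "hpoly k M \<and> (\<forall>z. dir M z = 0) \<and>
     (\<exists>Q. (if k = 0 then \<forall>z. Q z = 0 else hpoly (k - 1) Q) \<and>
      (\<forall>z. ev k c z = M z + vec z \<odot> Q z))"
  then obtain d Q where d: "M = ev k d" and cd: "\<And>z. dir M z = 0"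
    and Q: "if k = 0 then \<forall>z. Q z = 0 else hpoly (k - 1) Q"
    and eq: "\<And>z. ev k c z = M z + vec z \<odot> Q z"
    by (auto simp: hpoly_iff)
  let ?d = "restr k d"
  have M: "M = ev k ?d" using d by (simp add: ev_restr)
  have "fdirac ?d = (\<lambda>_. 0)"
  proof (cases k)
    case 0
    then show ?thesis using hom_0_fdirac[of ?d] by simp
  next
    case (Suc l)
    have "ev l (fdirac ?d) z = ev l (\<lambda>_. 0) z" for z
      using cd[of z] unfolding M by (simp add: Suc dir_ev_Suc ev_zero)
    from ev_inject[OF this] have "deg \<alpha> = l \<Longrightarrow> fdirac ?d \<alpha> = 0" for \<alpha> by blast
    moreover have "hom l (fdirac ?d)" using hom_fdirac[of l ?d] Suc by simp
    ultimately show ?thesis by (auto simp: hom_def fun_eq_iff)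
  qed
  moreover have "\<exists>q. (if k = 0 then q = (\<lambda>_. 0) else hom (k - 1) q) \<and> restr k c = (\<lambda>\<alpha>. ?d \<alpha> + vmul q \<alpha>)"
  proof (cases k)
    case 0
    have "ev k c z = ev k d z" for z using eq[of z] Q 0 by (simp add: d cl.zero_right)
    from ev_inject[OF this] show ?thesis using 0 by (auto simp: restr_def fun_eq_iff)
  next
    case (Suc l)
    then obtain q where q: "Q = ev l q" using Q by (auto simp: hpoly_iff)
    have "ev k (restr k c) z = ev k (\<lambda>\<alpha>. ?d \<alpha> + vmul (restr l q) \<alpha>) z" for z
      using eq[of z] by (simp add: M q ev_add Suc ev_restr flip: vec_mult_ev)
    from ev_inject[OF this]
    have "deg \<alpha> = k \<Longrightarrow> restr k c \<alpha> = ?d \<alpha> + vmul (restr l q) \<alpha>" for \<alpha> .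
    moreover have "deg \<alpha> \<noteq> k \<Longrightarrow> restr k c \<alpha> = ?d \<alpha> + vmul (restr l q) \<alpha>" for \<alpha>
      using hom_vmul[OF hom_restr, of l q] by (simp add: restr_def[of "Suc l"] Suc hom_def)
    ultimately have "restr k c = (\<lambda>\<alpha>. ?d \<alpha> + vmul (restr l q) \<alpha>)" by (auto simp: fun_eq_iff)
    then show ?thesis using Suc by (intro exI[of _ "restr l q"]) simp
  qed
  ultimately have "?d = fischer_proj k (restr k c)"
    using fischer_unique[OF hom_restr hom_restr] by blast
  then show "M = ev k (fischer_proj k (restr k c))" using M by simp
qed

end

interpretation complex_eval: polynomial_evaluation ceval chomogeneous_poly cdirac cvector
  by unfold_locales (fact chomogeneous_poly_iff ceval_cong ceval_inject ceval_add cdirac_ceval_0 cdirac_ceval_Suc cvector_mult_ceval)+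

lemma reval_add: "reval k (\<lambda>\<alpha>. c \<alpha> + d \<alpha>) x = reval k c x + reval k d x"
  using ceval_add[of k c d "complexify x"] by (simp add: ceval_complexify)

interpretation real_eval: polynomial_evaluation reval homogeneous_poly dirac rvector
  by unfold_locales (fact homogeneous_poly_iff reval_cong reval_inject reval_add dirac_reval_0 dirac_reval_Suc rvector_mult_reval)+

lemma cfischer_part_ceval: "cfischer_part k (ceval k c) = ceval k (fischer_proj k (restr k c))"
  unfolding cfischer_part_def by (rule complex_eval.the_monogenic_part)

lemma fischer_part_reval: "fischer_part k (reval k c) = reval k (fischer_proj k (restr k c))"
  unfolding fischer_part_def by (rule real_eval.the_monogenic_part)

section \<open>Entire power series\<close>

text \<open>
  Multi-indices are grouped by their degree.
\<close>

lemma has_sum_imp_sums_degree: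
  fixes f :: "('m::finite \<Rightarrow> nat) \<Rightarrow> 'b::banach"
  assumes "(f has_sum S) UNIV"
  shows "(\<lambda>k. \<Sum>\<alpha>\<in>multi_indices k. f \<alpha>) sums S"
proof -
  let ?A = "Sigma UNIV (multi_indices :: nat \<Rightarrow> ('m \<Rightarrow> nat) set)"
  have inj: "inj_on snd ?A" by (auto simp: inj_on_def multi_indices_iff)
  have im: "snd ` ?A = UNIV" by (force simp: multi_indices_iff)
  have "(f \<circ> snd has_sum S) ?A"
    using has_sum_reindex[OF inj, of f S] assms by (simp add: im)
  then have "((\<lambda>k. \<Sum>\<alpha>\<in>multi_indices k. f \<alpha>) has_sum S) UNIV"
    by (rule has_sum_SigmaD) (auto intro: has_sum_finite)
  then show ?thesis by (rule has_sum_imp_sums)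
qed

text \<open>
  Absolute convergence on the whole of \<open>\<complex>\<^sup>m\<close>.
\<close>

definition rapid :: "'m::{finite,linorder} coeffs \<Rightarrow> bool" where
  "rapid c \<longleftrightarrow> (\<forall>r\<ge>0. summable (\<lambda>k. r ^ k * cnorm k c))"

definition pseries :: "'m::{finite,linorder} coeffs \<Rightarrow> 'm cspace \<Rightarrow> 'm clifford" where
  "pseries c z = (\<Sum>k. ceval k c z)"

lemma pseries_sums:
  assumes "rapid c"
  shows "(\<lambda>k. ceval k c z) sums pseries c z"
proof -
  have "summable (\<lambda>k. ceval k c z)"
  proof (rule summable_comparison_test)
    show "\<exists>N. \<forall>k\<ge>N. norm (ceval k c z) \<le> norm z ^ k * cnorm k c"
      using norm_ceval_le by blast
    show "summable (\<lambda>k. norm z ^ k * cnorm k c)" using assms by (simp add: rapid_def)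
  qed
  then show ?thesis unfolding pseries_def by (rule summable_sums)
qed

lemma pseries_0: "rapid c \<Longrightarrow> pseries c 0 = c (\<lambda>_. 0)"
proof -
  have z: "ceval k c 0 = (if k = 0 then c (\<lambda>_. 0) else 0)" for k
  proof (cases k)
    case (Suc l)
    have "norm (ceval (Suc l) c 0) \<le> 0" using norm_ceval_le[of "Suc l" c 0] by simp
    then show ?thesis by (simp add: Suc)
  qed (simp add: ceval_0)
  show "pseries c 0 = c (\<lambda>_. 0)"
    unfolding pseries_def z using sums_single[of 0 "\<lambda>_. c (\<lambda>_. 0)"] by (simp add: sums_iff)
qed

text \<open>
  The factor \<open>k + 1\<close> produced by differentiation is absorbed by doubling the radius.
\<close>

lemma rapid_pdiff:
  assumes "rapid c"
  shows "rapid (pdiff j c)"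
  unfolding rapid_def
proof (intro allI impI)
  fix r :: real assume r: "r \<ge> 0"
  define R where "R = 2 * (1 + r)"
  have "summable (\<lambda>k. R ^ Suc k * cnorm (Suc k) c)"
    using assms r by (subst summable_Suc_iff) (auto simp: rapid_def R_def)
  then show "summable (\<lambda>k. r ^ k * cnorm k (pdiff j c))"
  proof (rule summable_comparison_test'[where N = 0])
    fix k :: nat
    have "cnorm k (pdiff j c) = (\<Sum>\<alpha>\<in>multi_indices k. real (inc j \<alpha> j) * norm (c (inc j \<alpha>)))"
      by (simp add: cnorm_def pdiff_def)
    also have "\<dots> = (\<Sum>\<beta>\<in>multi_indices (Suc k). if \<beta> j > 0 then real (\<beta> j) * norm (c \<beta>) else 0)"
      by (simp only: sum_multi_indices_Suc)
    also have "\<dots> \<le> (\<Sum>\<beta>\<in>multi_indices (Suc k). real (Suc k) * norm (c \<beta>))"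
    proof (rule sum_mono)
      fix \<beta> :: "'a \<Rightarrow> nat" assume "\<beta> \<in> multi_indices (Suc k)"
      then have "\<beta> j \<le> Suc k" using member_le_sum[of j UNIV \<beta>] by (simp add: multi_indices_iff)
      then show "(if \<beta> j > 0 then real (\<beta> j) * norm (c \<beta>) else 0) \<le> real (Suc k) * norm (c \<beta>)"
        by (auto intro: mult_right_mono)
    qed
    finally have 1: "cnorm k (pdiff j c) \<le> real (Suc k) * cnorm (Suc k) c"
      by (simp add: cnorm_def sum_distrib_left)
    have "r ^ k * real (Suc k) \<le> (1 + r) ^ Suc k * 2 ^ Suc k"
    proof (rule mult_mono)
      have "r ^ k \<le> (1 + r) ^ k" using r by (intro power_mono) auto
      also have "\<dots> \<le> (1 + r) ^ Suc k" using r by (intro power_increasing) auto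
      finally show "r ^ k \<le> (1 + r) ^ Suc k" .
      show "real (Suc k) \<le> 2 ^ Suc k"
        using of_nat_less_two_power[of "Suc k", where 'a = real] by simp
    qed (use r in auto)
    also have "\<dots> = R ^ Suc k" by (simp only: R_def power_mult_distrib mult.commute)
    finally have 2: "r ^ k * real (Suc k) \<le> R ^ Suc k" .
    have "r ^ k * cnorm k (pdiff j c) \<le> r ^ k * (real (Suc k) * cnorm (Suc k) c)"
      using 1 r by (intro mult_left_mono) auto
    also have "\<dots> \<le> R ^ Suc k * cnorm (Suc k) c"
      using 2 by (simp only: flip: mult.assoc) (intro mult_right_mono; simp)
    finally show "norm (r ^ k * cnorm k (pdiff j c)) \<le> R ^ Suc k * cnorm (Suc k) c"
      using r by simp
  qed
qed

lemma pseries_tail_le: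
  assumes "rapid c" "norm x \<le> R"
  shows "norm (pseries c x - (\<Sum>k<N. ceval k c x)) \<le> (\<Sum>k. R ^ (k + N) * cnorm (k + N) c)"
proof -
  have R: "R \<ge> 0" using assms(2) norm_ge_zero order_trans by blast
  have s: "summable (\<lambda>k. ceval k c x)" "(\<lambda>k. ceval k c x) sums pseries c x"
    using pseries_sums[OF assms(1), of x] by (auto simp: sums_iff)
  have b: "norm (ceval (k + N) c x) \<le> R ^ (k + N) * cnorm (k + N) c" for k
  proof -
    have "norm (ceval (k + N) c x) \<le> norm x ^ (k + N) * cnorm (k + N) c" by (rule norm_ceval_le)
    also have "\<dots> \<le> R ^ (k + N) * cnorm (k + N) c"
      using assms(2) by (intro mult_right_mono power_mono) auto
    finally show ?thesis .
  qed
  have sR: "summable (\<lambda>k. R ^ (k + N) * cnorm (k + N) c)"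
    using assms(1) R summable_ignore_initial_segment[of "\<lambda>k. R ^ k * cnorm k c" N]
    by (simp add: rapid_def)
  have "pseries c x - (\<Sum>k<N. ceval k c x) = (\<Sum>k. ceval (k + N) c x)"
    using suminf_split_initial_segment[OF s(1), of N] by (simp add: pseries_def)
  also have "norm \<dots> \<le> (\<Sum>k. R ^ (k + N) * cnorm (k + N) c)"
    using b by (rule norm_suminf_le[OF _ sR])
  finally show ?thesis .
qed

text \<open>
  Term-by-term differentiation. On a ball of radius \<open>R\<close> the tails of the differentiated series are
  dominated by the tails of the numerical series at \<open>R\<close>, which tend to zero.
\<close>

lemma complex_linear_derivative_pseries:
  fixes c :: "'m::{finite,linorder} coeffs"
  assumes c: "rapid c"
  shows "complex_linear_derivative (pseries c) (\<lambda>j. pseries (pdiff j c) z) z"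
proof -
  define S where "S = ball (0 :: 'm cspace) (norm z + 1)"
  define R where "R = norm z + 1"
  define f' where "f' n x h = (case n of 0 \<Rightarrow> 0
      | Suc k \<Rightarrow> \<Sum>j\<in>UNIV. h $ j *s ceval k (pdiff j c) x)" for n x and h :: "'m cspace"
  define g' where "g' x h = (\<Sum>j\<in>UNIV. h $ j *s pseries (pdiff j c) x)" for x and h :: "'m cspace"
  define T where "T N = (\<Sum>j\<in>UNIV. \<Sum>k. R ^ (k + N) * cnorm (k + N) (pdiff j c))" for N
  have "(\<lambda>N. \<Sum>k. R ^ (k + N) * cnorm (k + N) (pdiff j c)) \<longlonglongrightarrow> 0" for j
    by (rule suminf_exist_split2) (use rapid_pdiff[OF c, of j] in \<open>simp add: rapid_def R_def\<close>)
  then have T: "T \<longlonglongrightarrow> 0" unfolding T_def by (intro tendsto_null_sum) auto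
  have bound: "norm (sum (\<lambda>i. f' i x h) {..<Suc N} - g' x h) \<le> T N * norm h" if "x \<in> S" for x h N
  proof -
    have x: "norm x \<le> R" using that by (simp add: S_def R_def)
    have "sum (\<lambda>i. f' i x h) {..<Suc N} = (\<Sum>k<N. \<Sum>j\<in>UNIV. h $ j *s ceval k (pdiff j c) x)"
      by (subst sum.lessThan_Suc_shift) (simp add: f'_def)
    also have "\<dots> = (\<Sum>j\<in>UNIV. h $ j *s (\<Sum>k<N. ceval k (pdiff j c) x))"
      unfolding sm.sum_right by (rule sum.swap)
    finally have "norm (sum (\<lambda>i. f' i x h) {..<Suc N} - g' x h)
        = norm (\<Sum>j\<in>UNIV. h $ j *s (pseries (pdiff j c) x - (\<Sum>k<N. ceval k (pdiff j c) x)))"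
      by (simp add: g'_def sm.diff_right sum_subtractf norm_minus_commute)
    also have "\<dots> \<le> (\<Sum>j\<in>UNIV. norm h * (\<Sum>k. R ^ (k + N) * cnorm (k + N) (pdiff j c)))"
      by (intro sum_norm_le)
         (unfold norm_smult_complex, intro mult_mono Finite_Cartesian_Product.norm_nth_le
           pseries_tail_le rapid_pdiff c x norm_ge_zero)
    finally show ?thesis by (simp add: T_def sum_distrib_left mult.commute)
  qed
  have "\<exists>g. \<forall>x\<in>S. (\<lambda>n. ceval n c x) sums g x \<and> (g has_derivative g' x) (at x within S)"
  proof (rule has_derivative_series)
    show "convex S" by (simp add: S_def)
    show "(ceval n c has_derivative f' n x) (at x within S)" for n x
      by (cases n) (simp_all add: f'_def[abs_def] has_derivative_ceval_0 has_derivative_ceval_Suc)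
    show "\<forall>\<^sub>F n in sequentially. \<forall>x\<in>S. \<forall>h. norm (sum (\<lambda>i. f' i x h) {..<n} - g' x h) \<le> e * norm h"
      if "e > 0" for e
    proof -
      have "\<forall>\<^sub>F N in sequentially. T N < e" using order_tendstoD(2)[OF T that] .
      then have "\<forall>\<^sub>F N in sequentially. \<forall>x\<in>S. \<forall>h. norm (sum (\<lambda>i. f' i x h) {..<Suc N} - g' x h) \<le> e * norm h"
      proof eventually_elim
        case (elim N)
        show ?case
        proof (intro ballI allI)
          fix x h assume "x \<in> S"
          then have "norm (sum (\<lambda>i. f' i x h) {..<Suc N} - g' x h) \<le> T N * norm h" by (rule bound)
          also have "\<dots> \<le> e * norm h" using elim by (intro mult_right_mono) auto
          finally show "norm (sum (\<lambda>i. f' i x h) {..<Suc N} - g' x h) \<le> e * norm h" .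
        qed
      qed
      then show ?thesis by (subst eventually_sequentially_Suc[symmetric])
    qed
    show "0 \<in> S" by (simp add: S_def add_nonneg_pos)
    show "(\<lambda>n. ceval n c 0) sums pseries c 0" by (rule pseries_sums[OF c])
  qed
  then obtain g where g: "\<And>x. x \<in> S \<Longrightarrow> (\<lambda>n. ceval n c x) sums g x"
    "\<And>x. x \<in> S \<Longrightarrow> (g has_derivative g' x) (at x within S)" by blast
  have zS: "z \<in> S" "open S" by (simp_all add: S_def)
  have eq: "pseries c x = g x" if "x \<in> S" for x
    using sums_unique2[OF pseries_sums[OF c] g(1)[OF that]] .
  have "(g has_derivative g' z) (at z)" using g(2)[OF zS(1)] unfolding at_within_open[OF zS] .
  then have "(pseries c has_derivative g' z) (at z)"
    by (rule has_derivative_transform_within_open[OF _ zS(2) zS(1)]) (simp add: eq)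
  then show ?thesis by (simp add: complex_linear_derivative_def g'_def[abs_def])
qed

lemma complex_linear_derivative_imp_entire:
  assumes "\<And>z. \<exists>d. complex_linear_derivative F d z"
  shows "entire F"
  unfolding entire_def
proof
  fix z
  obtain d where "complex_linear_derivative F d z" using assms by blast
  then show "\<exists>F'. (F has_derivative F') (at z) \<and> (\<forall>c v. F' (c *s v) = c *s F' v)"
    unfolding complex_linear_derivative_def
    by (intro exI[of _ "\<lambda>h. \<Sum>j\<in>UNIV. h $ j *s d j"]) (simp add: sm.sum_right vector_smult_assoc)
qed

lemma entire_pseries: "rapid c \<Longrightarrow> entire (pseries c)"
  using complex_linear_derivative_imp_entire complex_linear_derivative_pseries by blast

lemma partial_deriv_pseries:
  assumes "rapid c"
  shows "partial_deriv j (\<lambda>x. pseries c (complexify x)) = (\<lambda>x. pseries (pdiff j c) (complexify x))"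
  using partial_deriv_complexify[OF complex_linear_derivative_pseries[OF assms]] by (simp add: fun_eq_iff)

section \<open>Uniqueness of holomorphic extensions\<close>

text \<open>
  The point \<open>z = x + iy\<close> lies on the complex line \<open>w \<mapsto> x + wy\<close>. Restricted to it, the function is
  entire in one variable and vanishes for real \<open>w\<close>.
\<close>

lemma entire_zero_on_reals:
  fixes F :: "'m::finite cspace \<Rightarrow> complex ^ 'n::finite"
  assumes "entire F" "\<And>x. F (complexify x) = 0"
  shows "F z = 0"
proof -
  define x y :: "'m rspace" where "x = (\<chi> j. Re (z $ j))" and "y = (\<chi> j. Im (z $ j))"
  define \<gamma> where "\<gamma> w = complexify x + w *s complexify y" for w :: complex
  have z: "\<gamma> \<i> = z"
    by (simp add: \<gamma>_def x_def y_def complexify_def vec_eq_iff complex_eq_iff)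
  have real0: "F (\<gamma> (of_real t)) = 0" for t
  proof -
    have "\<gamma> (of_real t) = complexify (x + t *\<^sub>R y)"
      by (simp add: \<gamma>_def complexify_def vec_eq_iff)
    then show ?thesis using assms(2) by simp
  qed
  have "F z $ A = 0" for A
  proof -
    have "(\<lambda>w. F (\<gamma> w) $ A) holomorphic_on UNIV"
      unfolding holomorphic_on_def field_differentiable_def
    proof
      fix w
      obtain F' where F': "(F has_derivative F') (at (\<gamma> w))" "\<And>c v. F' (c *s v) = c *s F' v"
        using assms(1) unfolding entire_def by blast
      have "(\<gamma> has_derivative (\<lambda>h. 0 + h *s complexify y)) (at w)"
        unfolding \<gamma>_def[abs_def]
        by (intro has_derivative_add has_derivative_const bounded_linear_imp_has_derivative
            sm.bounded_linear_left)
      from bounded_linear.has_derivative[OF bounded_linear_vec_nth has_derivative_compose[OF this F'(1)]]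
      have "((\<lambda>w. F (\<gamma> w) $ A) has_derivative (\<lambda>h. (F' (complexify y) $ A) * h)) (at w)"
        by (simp add: F'(2) mult.commute)
      then show "\<exists>f'. ((\<lambda>w. F (\<gamma> w) $ A) has_field_derivative f') (at w within UNIV)"
        by (auto simp: has_field_derivative_def)
    qed
    then have "F (\<gamma> \<i>) $ A = 0"
    proof (rule analytic_continuation[where U = "range complex_of_real" and \<xi> = 0])
      show "(0::complex) islimpt range complex_of_real"
        unfolding islimpt_approachable
      proof (intro allI impI)
        fix e :: real assume "e > 0"
        then show "\<exists>x'\<in>range complex_of_real. x' \<noteq> 0 \<and> dist x' 0 < e"
          by (intro bexI[of _ "complex_of_real (e / 2)"]) (auto simp del: of_real_divide)
      qed
    qed (auto simp: real0)
    then show ?thesis by (simp add: z)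
  qed
  then show ?thesis by (simp add: vec_eq_iff)
qed

lemma entire_diff:
  assumes "entire F" "entire G"
  shows "entire (\<lambda>z. F z - G z)"
  unfolding entire_def
proof
  fix z
  obtain F' where "(F has_derivative F') (at z)" "\<And>c v. F' (c *s v) = c *s F' v"
    using assms(1) unfolding entire_def by blast
  moreover obtain G' where "(G has_derivative G') (at z)" "\<And>c v. G' (c *s v) = c *s G' v"
    using assms(2) unfolding entire_def by blast
  ultimately show "\<exists>H. ((\<lambda>z. F z - G z) has_derivative H) (at z) \<and> (\<forall>c v. H (c *s v) = c *s H v)"
    by (intro exI[of _ "\<lambda>h. F' h - G' h"]) (auto intro: has_derivative_diff simp: sm.diff_right)
qed

lemma holomorphic_extension_eq:
  assumes "is_holomorphic_extension g G"
  shows "holomorphic_extension g = G"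
  unfolding holomorphic_extension_def
proof (rule the_equality)
  show "is_holomorphic_extension g G" by (rule assms)
  fix H assume "is_holomorphic_extension g H"
  then have "entire (\<lambda>z. H z - G z)" "H (complexify x) - G (complexify x) = 0" for x
    using assms by (auto simp: is_holomorphic_extension_def intro: entire_diff)
  from entire_zero_on_reals[OF this] have "H z - G z = 0" for z .
  then show "H = G" by (simp add: fun_eq_iff)
qed

section \<open>Monogenic parts of entire series\<close>

definition monogenic_coeffs :: "'m::{finite,linorder} coeffs \<Rightarrow> 'm coeffs" where
  "monogenic_coeffs c \<alpha> = fischer_proj (deg \<alpha>) (restr (deg \<alpha>) c) \<alpha>"

lemma ceval_monogenic_coeffs: "ceval k (monogenic_coeffs c) = ceval k (fischer_proj k (restr k c))"
  by (rule ceval_cong) (simp add: monogenic_coeffs_def)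

lemma cnorm_cong: "(\<And>\<alpha>. deg \<alpha> = k \<Longrightarrow> c \<alpha> = d \<alpha>) \<Longrightarrow> cnorm k c = cnorm k d"
  by (auto simp: cnorm_def multi_indices_iff intro!: sum.cong)

lemma cnorm_monogenic_coeffs_le:
  "cnorm k (monogenic_coeffs c) \<le> proj_const TYPE('m) ^ k * cnorm k c"
  for c :: "'m::{finite,linorder} coeffs"
proof -
  have "cnorm k (monogenic_coeffs c) = cnorm k (fischer_proj k (restr k c))"
    by (rule cnorm_cong) (simp add: monogenic_coeffs_def)
  also have "\<dots> \<le> proj_const TYPE('m) ^ k * cnorm k (restr k c)" by (rule cnorm_fischer_proj_le)
  also have "cnorm k (restr k c) = cnorm k c" by (rule cnorm_cong) (simp add: restr_def)
  finally show ?thesis .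
qed

lemma rapid_monogenic_coeffs:
  fixes c :: "'m::{finite,linorder} coeffs"
  assumes "rapid c"
  shows "rapid (monogenic_coeffs c)"
  unfolding rapid_def
proof (intro allI impI)
  fix r :: real assume r: "r \<ge> 0"
  let ?p = "proj_const TYPE('m)"
  have p: "?p \<ge> 0" using proj_const_ge_1[where 'm = 'm] by simp
  have "summable (\<lambda>k. (r * ?p) ^ k * cnorm k c)" using assms r p by (simp add: rapid_def)
  then show "summable (\<lambda>k. r ^ k * cnorm k (monogenic_coeffs c))"
  proof (rule summable_comparison_test'[where N = 0])
    fix k
    have "r ^ k * cnorm k (monogenic_coeffs c) \<le> r ^ k * (?p ^ k * cnorm k c)"
      using r by (intro mult_left_mono cnorm_monogenic_coeffs_le) auto
    then show "norm (r ^ k * cnorm k (monogenic_coeffs c)) \<le> (r * ?p) ^ k * cnorm k c"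
      using r by (simp add: power_mult_distrib mult.assoc)
  qed
qed

lemma cmonogenic_part_pseries:
  assumes "rapid c"
  shows "cmonogenic_part (pseries c) = pseries (monogenic_coeffs c)"
proof -
  have "(THE R. chomogeneous_expansion (pseries c) R) = (\<lambda>k. ceval k c)"
    by (rule the_chomogeneous_expansion) (rule pseries_sums[OF assms])
  then show ?thesis
    by (intro ext) (simp add: cmonogenic_part_def cfischer_part_ceval ceval_monogenic_coeffs pseries_def)
qed

lemma monogenic_part_pseries:
  assumes "rapid c"
  shows "monogenic_part (\<lambda>x. pseries c (complexify x)) x = pseries (monogenic_coeffs c) (complexify x)"
proof -
  have "(THE R. homogeneous_expansion (\<lambda>x. pseries c (complexify x)) R) = (\<lambda>k. reval k c)"
    using pseries_sums[OF assms]
    by (intro the_homogeneous_expansion) (simp flip: ceval_complexify)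
  then show ?thesis
    by (simp add: monogenic_part_def fischer_part_reval pseries_def ceval_monogenic_coeffs
        flip: ceval_complexify)
qed

text \<open>
  The monogenic part of the monomial \<open>z\<^sup>\<beta>\<close>. The Fourier-Borel kernel is \<open>\<Sum>\<^sub>\<beta> u\<^sup>\<beta>/\<beta>! M(z\<^sup>\<beta>)\<close>, and the
  monogenic part of any series \<open>\<Sum>\<^sub>\<beta> z\<^sup>\<beta> c\<^sub>\<beta>\<close> is \<open>\<Sum>\<^sub>\<beta> M(z\<^sup>\<beta>) c\<^sub>\<beta>\<close>.
\<close>

definition mono_proj :: "('m \<Rightarrow> nat) \<Rightarrow> 'm::{finite,linorder} cspace \<Rightarrow> 'm clifford" where
  "mono_proj \<beta> z = ceval (deg \<beta>) (fischer_proj (deg \<beta>) (unit_coeff \<beta>)) z"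

lemma ceval_monogenic_coeffs_eq_sum:
  "ceval k (monogenic_coeffs c) z = (\<Sum>\<beta>\<in>multi_indices k. mono_proj \<beta> z \<odot> c \<beta>)"
proof -
  have "ceval k (monogenic_coeffs c) z
      = (\<Sum>\<beta>\<in>multi_indices k. ceval k (fischer_proj k (unit_coeff \<beta>)) z \<odot> c \<beta>)"
    by (simp add: ceval_monogenic_coeffs restr_eq_sum_unit fischer_proj_rlin ceval_sum ceval_rmult)
  then show ?thesis by (simp add: mono_proj_def multi_indices_iff)
qed

lemma cnorm_unit_coeff: "cnorm (deg \<beta>) (unit_coeff \<beta> :: 'm::{finite,linorder} coeffs) = 1"
proof -
  have "cnorm (deg \<beta>) (unit_coeff \<beta> :: 'm coeffs)
      = (\<Sum>\<alpha>\<in>multi_indices (deg \<beta>). if \<alpha> = \<beta> then 1 else 0)"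
    unfolding cnorm_def by (intro sum.cong) (auto simp: unit_coeff_def)
  then show ?thesis by (simp add: multi_indices_iff)
qed

lemma norm_mono_proj_le:
  "norm (mono_proj \<beta> z) \<le> (norm z * proj_const TYPE('m)) ^ deg \<beta>"
  for z :: "'m::{finite,linorder} cspace"
proof -
  have "norm (mono_proj \<beta> z) \<le> norm z ^ deg \<beta> * cnorm (deg \<beta>) (fischer_proj (deg \<beta>) (unit_coeff \<beta> :: 'm coeffs))"
    unfolding mono_proj_def by (rule norm_ceval_le)
  also have "\<dots> \<le> norm z ^ deg \<beta> * (proj_const TYPE('m) ^ deg \<beta> * 1)"
    using cnorm_fischer_proj_le[of "deg \<beta>" "unit_coeff \<beta> :: 'm coeffs"]
    by (intro mult_left_mono) (simp_all add: cnorm_unit_coeff)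
  finally show ?thesis by (simp add: power_mult_distrib)
qed

section \<open>The Hermite generating function\<close>

text \<open>
  The Taylor coefficients of \<open>exp(\<sigma>z\<^sup>2/2)\<close>. The parameter serves three purposes: \<open>\<sigma> = -1\<close> gives the
  Hermite generating function, \<open>\<sigma> = 0\<close> the plain exponential, and \<open>\<sigma> = 1\<close> a majorant for the first.
\<close>

fun gcoef :: "real \<Rightarrow> nat \<Rightarrow> real" where
  "gcoef \<sigma> 0 = 1"
| "gcoef \<sigma> (Suc 0) = 0"
| "gcoef \<sigma> (Suc (Suc i)) = \<sigma> * gcoef \<sigma> i / real (Suc (Suc i))"

lemma gcoef_even: "gcoef \<sigma> (2 * k) = (\<sigma> / 2) ^ k / fact k"
proof (induction k)
  case (Suc k)
  have "2 * Suc k = Suc (Suc (2 * k))" "real (Suc (Suc (2 * k))) = 2 * real (Suc k)" by simp_all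
  then have "gcoef \<sigma> (2 * Suc k) = \<sigma> * gcoef \<sigma> (2 * k) / (2 * real (Suc k))"
    by (simp only: gcoef.simps)
  then show ?case unfolding Suc.IH fact_Suc power_Suc by (simp del: of_nat_Suc)
qed simp

lemma gcoef_odd: "odd i \<Longrightarrow> gcoef \<sigma> i = 0"
  by (induction \<sigma> i rule: gcoef.induct) auto

lemma abs_gcoef: "\<bar>gcoef \<sigma> i\<bar> = gcoef \<bar>\<sigma>\<bar> i"
  by (induction \<sigma> i rule: gcoef.induct) (auto simp: abs_mult)

lemma gcoef_sums:
  fixes z :: "'a::{real_normed_field,banach}"
  shows "(\<lambda>i. of_real (gcoef \<sigma> i) * z ^ i) sums exp (of_real (\<sigma> / 2) * z\<^sup>2)"
proof -
  have "(of_real (\<sigma> / 2) * z\<^sup>2) ^ k /\<^sub>R fact k = of_real (gcoef \<sigma> (2 * k)) * z ^ (2 * k)" for k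
  proof -
    define s y where "s = \<sigma> / 2" and "y = z\<^sup>2"
    have "(of_real s * y) ^ k /\<^sub>R fact k = of_real (s ^ k / fact k) * y ^ k"
      by (simp add: power_mult_distrib scaleR_conv_of_real field_simps)
    then show ?thesis by (simp only: gcoef_even s_def y_def power_mult)
  qed
  then have "(\<lambda>k. of_real (gcoef \<sigma> (2 * k)) * z ^ (2 * k)) sums exp (of_real (\<sigma> / 2) * z\<^sup>2)"
    using exp_converges[of "of_real (\<sigma> / 2) * z\<^sup>2"] by presburger
  moreover have "strict_mono ((*) (2::nat))" by (simp add: strict_mono_def)
  moreover have "of_real (gcoef \<sigma> n) * z ^ n = 0" if "n \<notin> range ((*) 2)" for n
    using that gcoef_odd[of n \<sigma>] by (auto elim!: evenE)
  ultimately show ?thesis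
    using sums_mono_reindex[of "(*) 2" "\<lambda>i. of_real (gcoef \<sigma> i) * z ^ i"] by (simp add: o_def)
qed

lemma gcoef_abs_summable:
  fixes z :: "'a::{real_normed_field,banach}"
  shows "summable (\<lambda>i. norm (of_real (gcoef \<sigma> i) * z ^ i))"
  using gcoef_sums[of "\<bar>\<sigma>\<bar>" "norm z"]
  by (simp add: norm_mult norm_power abs_gcoef sums_iff)

text \<open>
  The coefficient of \<open>z\<^sup>n\<close> in \<open>exp(\<sigma>z\<^sup>2/2 + tz)\<close>; for \<open>\<sigma> = -1\<close> the \<open>n\<close>-th Hermite polynomial at \<open>t\<close>
  divided by \<open>n!\<close>.
\<close>

definition hgen :: "real \<Rightarrow> nat \<Rightarrow> real \<Rightarrow> real" where
  "hgen \<sigma> n t = (\<Sum>i\<le>n. gcoef \<sigma> i * (t ^ (n - i) / fact (n - i)))"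

lemma hgen_sums:
  fixes z :: "'a::{real_normed_field,banach}"
  shows "(\<lambda>n. of_real (hgen \<sigma> n t) * z ^ n) sums exp (of_real (\<sigma> / 2) * z\<^sup>2 + of_real t * z)"
proof -
  let ?a = "\<lambda>i. of_real (gcoef \<sigma> i) * z ^ i"
  let ?b = "\<lambda>i. (of_real t * z) ^ i /\<^sub>R fact i"
  have b: "summable (\<lambda>i. norm (?b i))"
    by (rule summable_norm_exp)
  have "(\<lambda>n. \<Sum>i\<le>n. ?a i * ?b (n - i)) sums ((\<Sum>i. ?a i) * (\<Sum>i. ?b i))"
    by (rule Cauchy_product_sums[OF gcoef_abs_summable b])
  also have "(\<Sum>i. ?a i) = exp (of_real (\<sigma> / 2) * z\<^sup>2)"
    using gcoef_sums[of \<sigma> z] by (simp add: sums_iff)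
  also have "(\<Sum>i. ?b i) = exp (of_real t * z)" by (simp add: exp_def)
  also have "(\<lambda>n. \<Sum>i\<le>n. ?a i * ?b (n - i)) = (\<lambda>n. of_real (hgen \<sigma> n t) * z ^ n)"
  proof
    fix n
    have "?a i * ?b (n - i) = of_real (gcoef \<sigma> i * (t ^ (n - i) / fact (n - i))) * z ^ n"
      if "i \<le> n" for i
    proof -
      have "z ^ n = z ^ i * z ^ (n - i)" using that by (simp flip: power_add)
      then show ?thesis
        by (simp add: scaleR_conv_of_real power_mult_distrib divide_inverse mult_ac)
    qed
    then show "(\<Sum>i\<le>n. ?a i * ?b (n - i)) = of_real (hgen \<sigma> n t) * z ^ n"
      by (simp add: hgen_def sum_distrib_right)
  qed
  finally show ?thesis by (simp add: exp_add)
qed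

lemma abs_hgen_le: "\<bar>hgen \<sigma> n t\<bar> \<le> hgen \<bar>\<sigma>\<bar> n \<bar>t\<bar>"
  unfolding hgen_def
  by (rule order_trans[OF sum_abs]) (simp add: abs_mult power_abs abs_gcoef)

lemma hgen_0_left: "hgen 0 n t = t ^ n / fact n"
proof -
  have g: "gcoef 0 i = (if i = 0 then 1 else 0)" for i
    by (cases "(0::real, i)" rule: gcoef.cases) auto
  have "hgen 0 n t = (\<Sum>i\<le>n. if i = 0 then t ^ n / fact n else 0)"
    unfolding hgen_def by (intro sum.cong) (auto simp: g)
  then show ?thesis by simp
qed

text \<open>
  The differential equation \<open>F' = (t + \<sigma>z) F\<close> of the generating function.
\<close>

lemma hgen_Suc:
  "real (Suc n) * hgen \<sigma> (Suc n) t = t * hgen \<sigma> n t + \<sigma> * (if n > 0 then hgen \<sigma> (n - 1) t else 0)"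
proof -
  define B where "B k = t ^ k / fact k" for k
  have B: "real (Suc k) * B (Suc k) = t * B k" for k by (simp add: B_def del: of_nat_Suc)
  have h: "hgen \<sigma> k t = (\<Sum>i\<le>k. gcoef \<sigma> i * B (k - i))" for k by (simp add: hgen_def B_def)
  have "real (Suc n) * hgen \<sigma> (Suc n) t = (\<Sum>i\<le>Suc n. (real i * gcoef \<sigma> i) * B (Suc n - i))
     + (\<Sum>i\<le>Suc n. gcoef \<sigma> i * (real (Suc n - i) * B (Suc n - i)))"
    unfolding h sum_distrib_left sum.distrib[symmetric]
    by (intro sum.cong refl) (auto simp: of_nat_diff algebra_simps)
  also have "(\<Sum>i\<le>Suc n. gcoef \<sigma> i * (real (Suc n - i) * B (Suc n - i))) = t * hgen \<sigma> n t"
  proof -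
    have e: "gcoef \<sigma> i * (real (Suc n - i) * B (Suc n - i)) = t * (gcoef \<sigma> i * B (n - i))" if "i \<le> n" for i
      unfolding Suc_diff_le[OF that] B by simp
    have "(\<Sum>i\<le>Suc n. gcoef \<sigma> i * (real (Suc n - i) * B (Suc n - i)))
        = (\<Sum>i\<le>n. gcoef \<sigma> i * (real (Suc n - i) * B (Suc n - i)))" by simp
    also have "\<dots> = (\<Sum>i\<le>n. t * (gcoef \<sigma> i * B (n - i)))" by (intro sum.cong refl e) simp
    finally show ?thesis by (simp only: h sum_distrib_left)
  qed
  also have "(\<Sum>i\<le>Suc n. (real i * gcoef \<sigma> i) * B (Suc n - i)) = \<sigma> * (if n > 0 then hgen \<sigma> (n - 1) t else 0)"
  proof (cases n)
    case (Suc l)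
    have "(\<Sum>i\<le>Suc (Suc l). (real i * gcoef \<sigma> i) * B (Suc (Suc l) - i))
        = (\<Sum>i\<le>l. (real (Suc (Suc i)) * gcoef \<sigma> (Suc (Suc i))) * B (l - i))"
      by (simp add: sum.atMost_Suc_shift del: gcoef.simps sum.atMost_Suc of_nat_Suc) simp
    also have "\<dots> = \<sigma> * hgen \<sigma> l t"
      by (simp add: h sum_distrib_left mult_ac del: of_nat_Suc)
    finally show ?thesis by (simp add: Suc)
  qed simp
  finally show ?thesis by simp
qed

lemma continuous_on_hgen [continuous_intros]:
  "continuous_on S f \<Longrightarrow> continuous_on S (\<lambda>x. hgen \<sigma> n (f x))"
  unfolding hgen_def by (intro continuous_intros) auto

definition hcoef :: "real \<Rightarrow> 'm::finite rspace \<Rightarrow> ('m \<Rightarrow> nat) \<Rightarrow> real" where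
  "hcoef \<sigma> x \<alpha> = (\<Prod>j\<in>UNIV. hgen \<sigma> (\<alpha> j) (x $ j))"

definition absv :: "'m::finite rspace \<Rightarrow> 'm rspace" where
  "absv x = (\<chi> j. \<bar>x $ j\<bar>)"

lemma abs_hcoef_le: "\<bar>hcoef \<sigma> x \<alpha>\<bar> \<le> hcoef \<bar>\<sigma>\<bar> (absv x) \<alpha>"
  unfolding hcoef_def abs_prod by (rule prod_mono) (simp add: absv_def abs_hgen_le)

lemma hcoef_nonneg: "hcoef \<bar>\<sigma>\<bar> (absv x) \<alpha> \<ge> 0"
  using abs_hcoef_le[of \<sigma> x \<alpha>] by linarith

lemma hcoef_0: "hcoef \<sigma> x (\<lambda>_. 0) = 1"
  by (simp add: hcoef_def hgen_def)

lemma hcoef_0_left: "hcoef 0 x \<alpha> = mon x \<alpha> / (\<Prod>j\<in>UNIV. fact (\<alpha> j))"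
  by (simp add: hcoef_def hgen_0_left mon_def prod_dividef)

lemma continuous_on_hcoef: "continuous_on S (\<lambda>x. hcoef \<sigma> x \<alpha>)"
  unfolding hcoef_def by (intro continuous_intros)

lemma summable_norm_prod:
  fixes f :: "'m::finite \<Rightarrow> nat \<Rightarrow> 'a::real_normed_field"
  assumes "\<And>j. summable (\<lambda>n. norm (f j n))"
  shows "(\<lambda>\<alpha>. norm (\<Prod>j\<in>UNIV. f j (\<alpha> j))) summable_on UNIV"
proof (rule nonneg_bdd_above_summable_on)
  show "bdd_above (sum (\<lambda>\<alpha>. norm (\<Prod>j\<in>UNIV. f j (\<alpha> j))) ` {F. F \<subseteq> UNIV \<and> finite F})"
  proof (intro bdd_aboveI2[where M = "\<Prod>j\<in>UNIV. \<Sum>n. norm (f j n)"])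
    fix F :: "('m \<Rightarrow> nat) set" assume "F \<in> {F. F \<subseteq> UNIV \<and> finite F}"
    then have fin: "finite F" by simp
    define N where "N = Max (insert 0 (\<Union>\<alpha>\<in>F. range \<alpha>))"
    have "\<alpha> j \<le> N" if "\<alpha> \<in> F" for \<alpha> j
      unfolding N_def using fin that by (intro Max_ge) auto
    then have "F \<subseteq> PiE UNIV (\<lambda>_. {..N})" by auto
    then have "(\<Sum>\<alpha>\<in>F. norm (\<Prod>j\<in>UNIV. f j (\<alpha> j)))
        \<le> (\<Sum>\<alpha>\<in>PiE UNIV (\<lambda>_. {..N}). norm (\<Prod>j\<in>UNIV. f j (\<alpha> j)))"
      by (intro sum_mono2 finite_PiE) auto
    also have "\<dots> = (\<Prod>j\<in>UNIV. \<Sum>n\<le>N. norm (f j n))"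
      by (subst prod_sum_PiE) (auto simp flip: prod_norm)
    also have "\<dots> \<le> (\<Prod>j\<in>UNIV. \<Sum>n. norm (f j n))"
      using assms by (intro prod_mono conjI sum_nonneg sum_le_suminf) auto
    finally show "(\<Sum>\<alpha>\<in>F. norm (\<Prod>j\<in>UNIV. f j (\<alpha> j))) \<le> (\<Prod>j\<in>UNIV. \<Sum>n. norm (f j n))" .
  qed
qed simp

lemma hcoef_has_sum:
  fixes z :: "'a::{real_normed_field,banach} ^ 'm::finite"
  shows "((\<lambda>\<alpha>. of_real (hcoef \<sigma> x \<alpha>) * mon z \<alpha>)
     has_sum exp (\<Sum>j\<in>UNIV. of_real (\<sigma> / 2) * (z $ j)\<^sup>2 + of_real (x $ j) * z $ j)) UNIV"
proof -
  define f where "f j n = of_real (hgen \<sigma> n (x $ j)) * (z $ j) ^ n" for j n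
  have abs: "summable (\<lambda>n. norm (f j n))" for j
  proof (rule summable_comparison_test'[where N = 0])
    show "summable (\<lambda>n. hgen \<bar>\<sigma>\<bar> n \<bar>x $ j\<bar> * norm (z $ j) ^ n)"
      using hgen_sums[of "\<bar>\<sigma>\<bar>" "\<bar>x $ j\<bar>" "norm (z $ j)"] by (simp add: sums_iff)
    show "norm (norm (f j n)) \<le> hgen \<bar>\<sigma>\<bar> n \<bar>x $ j\<bar> * norm (z $ j) ^ n" for n
      by (simp add: f_def norm_mult norm_power mult_right_mono abs_hgen_le)
  qed
  have abs': "(\<lambda>n. norm (f j n)) summable_on UNIV" for j
    using abs[of j] by (simp add: summable_on_UNIV_nonneg_real_iff)
  have f: "infsum (f j) UNIV = exp (of_real (\<sigma> / 2) * (z $ j)\<^sup>2 + of_real (x $ j) * z $ j)" for j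
  proof -
    have "f j sums infsum (f j) UNIV"
      by (rule has_sum_imp_sums[OF has_sum_infsum[OF abs_summable_summable[OF abs']]])
    moreover have "(\<lambda>n. f j n) sums exp (of_real (\<sigma> / 2) * (z $ j)\<^sup>2 + of_real (x $ j) * z $ j)"
      unfolding f_def by (rule hgen_sums)
    ultimately show ?thesis by (rule sums_unique2)
  qed
  have UN: "PiE UNIV (\<lambda>_. UNIV) = (UNIV :: ('m \<Rightarrow> nat) set)" by auto
  have "infsum (\<lambda>\<alpha>. \<Prod>j\<in>UNIV. f j (\<alpha> j)) (PiE UNIV (\<lambda>_. UNIV)) = (\<Prod>j\<in>UNIV. infsum (f j) UNIV)"
    using abs' by (intro infsum_prod_PiE_abs) auto
  moreover have "(\<lambda>\<alpha>. \<Prod>j\<in>UNIV. f j (\<alpha> j)) summable_on (UNIV :: ('m \<Rightarrow> nat) set)"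
    by (rule abs_summable_summable[OF summable_norm_prod[OF abs]])
  ultimately have "((\<lambda>\<alpha>. \<Prod>j\<in>UNIV. f j (\<alpha> j)) has_sum (\<Prod>j\<in>UNIV. infsum (f j) UNIV)) UNIV"
    unfolding UN using has_sum_infsum by metis
  then show ?thesis
    unfolding f by (simp add: exp_sum f_def hcoef_def mon_def prod.distrib)
qed

lemma mon_const: "mon (\<chi> j. r) \<alpha> = r ^ deg \<alpha>"
  by (simp add: mon_def power_sum)

text \<open>
  The value at \<open>(r, \<dots>, r)\<close> of the generating function with all coefficients made positive. It
  dominates every partial sum below, and grows in \<open>x\<close> only like \<open>exp(mr|x|)\<close>.
\<close>

definition majorant :: "real \<Rightarrow> real \<Rightarrow> 'm::finite rspace \<Rightarrow> real" where
  "majorant \<sigma> r x = exp (\<Sum>j\<in>UNIV. \<bar>\<sigma>\<bar> / 2 * r\<^sup>2 + \<bar>x $ j\<bar> * r)"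

lemma majorant_has_sum:
  "((\<lambda>\<alpha>. hcoef \<bar>\<sigma>\<bar> (absv x) \<alpha> * r ^ deg \<alpha>) has_sum majorant \<sigma> r x) UNIV"
  using hcoef_has_sum[of "\<bar>\<sigma>\<bar>" "absv x" "\<chi> j. r"] by (simp add: mon_const majorant_def absv_def)

lemma majorant_le:
  fixes x :: "'m::finite rspace" and r :: real
  assumes "r \<ge> 0"
  shows "majorant \<sigma> r x \<le> exp (CARD('m) * (\<bar>\<sigma>\<bar> / 2 * r\<^sup>2)) * exp ((CARD('m) * r) * norm x)"
proof -
  have "(\<Sum>j\<in>UNIV. \<bar>\<sigma>\<bar> / 2 * r\<^sup>2 + \<bar>x $ j\<bar> * r) \<le> (\<Sum>j\<in>(UNIV :: 'm set). \<bar>\<sigma>\<bar> / 2 * r\<^sup>2 + norm x * r)"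
    using assms by (intro sum_mono add_mono mult_right_mono component_le_norm_cart) auto
  then show ?thesis by (simp add: majorant_def algebra_simps flip: exp_add)
qed

lemma sum_degrees_le_majorant:
  assumes "r \<ge> 0"
  shows "(\<Sum>k<N. \<Sum>\<alpha>\<in>multi_indices k. \<bar>hcoef \<sigma> x \<alpha>\<bar> * r ^ k) \<le> majorant \<sigma> r x"
proof -
  have s: "(\<lambda>k. \<Sum>\<alpha>\<in>multi_indices k. hcoef \<bar>\<sigma>\<bar> (absv x) \<alpha> * r ^ deg \<alpha>) sums majorant \<sigma> r x"
    by (rule has_sum_imp_sums_degree[OF majorant_has_sum])
  have "(\<Sum>k<N. \<Sum>\<alpha>\<in>multi_indices k. \<bar>hcoef \<sigma> x \<alpha>\<bar> * r ^ k)
      \<le> (\<Sum>k<N. \<Sum>\<alpha>\<in>multi_indices k. hcoef \<bar>\<sigma>\<bar> (absv x) \<alpha> * r ^ deg \<alpha>)"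
    using assms by (intro sum_mono) (auto simp: multi_indices_iff abs_hcoef_le intro!: mult_right_mono)
  also have "\<dots> \<le> majorant \<sigma> r x"
    using s assms by (intro sum_le_suminf[THEN order_trans[OF _ eq_refl]])
      (auto simp: sums_iff intro!: sum_nonneg mult_nonneg_nonneg hcoef_nonneg)
  finally show ?thesis .
qed

text \<open>
  For fixed \<open>x\<close>, the scalar series \<open>exp(\<sigma>z\<^sup>2/2 + x\<cdot>z)\<close> in \<open>z\<close> as a family of Clifford coefficients.
\<close>

definition hser :: "real \<Rightarrow> 'm::{finite,linorder} rspace \<Rightarrow> 'm coeffs" where
  "hser \<sigma> x \<alpha> = hcoef \<sigma> x \<alpha> *\<^sub>R cl_one"

lemma rapid_hser: "rapid (hser \<sigma> x)"
  unfolding rapid_def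
proof (intro allI impI)
  fix r :: real assume r: "r \<ge> 0"
  show "summable (\<lambda>k. r ^ k * cnorm k (hser \<sigma> x))"
  proof (rule bounded_imp_summable)
    show "(\<Sum>k\<le>n. r ^ k * cnorm k (hser \<sigma> x)) \<le> majorant \<sigma> r x" for n
      using sum_degrees_le_majorant[OF r, where N = "Suc n" and \<sigma> = \<sigma> and x = x]
      by (simp add: cnorm_def hser_def sum_distrib_left mult.commute lessThan_Suc_atMost)
  qed (use r in simp)
qed

lemma pseries_hser:
  "pseries (hser \<sigma> x) z
     = exp (\<Sum>j\<in>UNIV. of_real (\<sigma> / 2) * (z $ j)\<^sup>2 + of_real (x $ j) * z $ j) *s cl_one"
proof -
  have "((\<lambda>\<alpha>. (of_real (hcoef \<sigma> x \<alpha>) * mon z \<alpha>) *s cl_one) has_sum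
     exp (\<Sum>j\<in>UNIV. of_real (\<sigma> / 2) * (z $ j)\<^sup>2 + of_real (x $ j) * z $ j) *s (cl_one :: 'a clifford)) UNIV"
    by (rule has_sum_bounded_linear[OF sm.bounded_linear_left hcoef_has_sum, unfolded o_def])
  from has_sum_imp_sums_degree[OF this]
  have "(\<lambda>k. ceval k (hser \<sigma> x) z) sums
     (exp (\<Sum>j\<in>UNIV. of_real (\<sigma> / 2) * (z $ j)\<^sup>2 + of_real (x $ j) * z $ j) *s (cl_one :: 'a clifford))"
    by (simp add: ceval_def hser_def vector_smult_assoc mult.commute flip: of_real_smult)
  then show ?thesis using sums_unique2[OF pseries_sums[OF rapid_hser]] by blast
qed

section \<open>Hermite corrections and the monogenic part\<close>

text \<open>
  Multiplication of a series by the linear form \<open>x\<cdot>z\<close>.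
\<close>

definition xmul :: "'m rspace \<Rightarrow> 'm::{finite,linorder} coeffs \<Rightarrow> 'm coeffs" where
  "xmul x c \<alpha> = (\<Sum>j\<in>UNIV. if \<alpha> j > 0 then x $ j *\<^sub>R c (dec j \<alpha>) else 0)"

lemma dec_commute: "dec i (dec j \<alpha>) = dec j (dec i \<alpha>)"
  by (auto simp: dec_def)

lemma dec_pos_commute: "(\<alpha> j > 0 \<and> dec j \<alpha> i > 0) \<longleftrightarrow> (\<alpha> i > 0 \<and> dec i \<alpha> j > 0)"
  by (cases "i = j") (auto simp: dec_other)

lemma vmul_xmul: "vmul (xmul x c) = xmul x (vmul c)"
proof
  fix \<alpha>
  have "vmul (xmul x c) \<alpha> = (\<Sum>j\<in>UNIV. \<Sum>i\<in>UNIV. if \<alpha> j > 0 \<and> dec j \<alpha> i > 0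
      then x $ i *\<^sub>R (cl_e j \<odot> c (dec i (dec j \<alpha>))) else 0)"
    unfolding vmul_def xmul_def
    by (intro sum.cong refl) (auto simp: cl.sum_right cl.scaleR_right cl.zero_right intro!: sum.cong)
  also have "\<dots> = (\<Sum>i\<in>UNIV. \<Sum>j\<in>UNIV. if \<alpha> i > 0 \<and> dec i \<alpha> j > 0
      then x $ i *\<^sub>R (cl_e j \<odot> c (dec j (dec i \<alpha>))) else 0)"
    by (subst sum.swap) (intro sum.cong refl if_cong dec_pos_commute; simp add: dec_commute)
  also have "\<dots> = xmul x (vmul c) \<alpha>"
    unfolding vmul_def xmul_def
    by (intro sum.cong refl) (auto simp: scaleR_sum_right intro!: sum.cong)
  finally show "vmul (xmul x c) \<alpha> = xmul x (vmul c) \<alpha>" .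
qed

lemma xmul_add: "xmul x (\<lambda>\<alpha>. c \<alpha> + d \<alpha>) \<alpha> = xmul x c \<alpha> + xmul x d \<alpha>"
  unfolding xmul_def sum.distrib[symmetric] by (intro sum.cong) (auto simp: scaleR_add_right)

lemma xmul_cong: "(\<And>\<alpha>. deg \<alpha> = k \<Longrightarrow> c \<alpha> = d \<alpha>) \<Longrightarrow> deg \<beta> = Suc k \<Longrightarrow> xmul x c \<beta> = xmul x d \<beta>"
  unfolding xmul_def
proof (intro sum.cong refl if_cong)
  fix j assume "\<And>\<alpha>. deg \<alpha> = k \<Longrightarrow> c \<alpha> = d \<alpha>" "deg \<beta> = Suc k" "\<beta> j > 0"
  then show "x $ j *\<^sub>R c (dec j \<beta>) = x $ j *\<^sub>R d (dec j \<beta>)" using deg_dec[of \<beta> j] by simp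
qed

text \<open>
  In the Clifford algebra the square of a vector is the scalar \<open>-z\<cdot>z\<close>: the double sum is symmetrised
  and the anticommutators are evaluated.
\<close>

lemma vmul_vmul:
  "vmul (vmul c) \<alpha> = - (\<Sum>j\<in>UNIV. if dec j \<alpha> j > 0 then c (dec j (dec j \<alpha>)) else 0)"
proof -
  define T where "T j i = (if \<alpha> j > 0 \<and> dec j \<alpha> i > 0
     then cl_e j \<odot> (cl_e i \<odot> c (dec i (dec j \<alpha>))) else 0)" for j i
  have V: "vmul (vmul c) \<alpha> = (\<Sum>j\<in>UNIV. \<Sum>i\<in>UNIV. T j i)"
    unfolding vmul_def T_def
    by (intro sum.cong refl) (auto simp: cl.sum_right cl.zero_right intro!: sum.cong)
  have T: "T j i + T i j = (if i = j then - (2 *\<^sub>R (if dec j \<alpha> j > 0 then c (dec j (dec j \<alpha>)) else 0)) else 0)" for i j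
  proof (cases "\<alpha> j > 0 \<and> dec j \<alpha> i > 0")
    case True
    then have "\<alpha> i > 0 \<and> dec i \<alpha> j > 0" by (simp only: dec_pos_commute)
    then have "T j i + T i j = cl_e j \<odot> (cl_e i \<odot> c (dec i (dec j \<alpha>))) + cl_e i \<odot> (cl_e j \<odot> c (dec i (dec j \<alpha>)))"
      using True by (simp add: T_def dec_commute[of j i])
    then show ?thesis using True by (auto simp: cl_e_anticommute_mult)
  next
    case False
    then have "\<not> (\<alpha> i > 0 \<and> dec i \<alpha> j > 0)" by (simp only: dec_pos_commute not_False_eq_True)
    then have "T i j = 0" unfolding T_def by (rule if_not_P)
    moreover have "T j i = 0" unfolding T_def using False by (rule if_not_P)
    ultimately have "T j i + T i j = 0" by simp
    then show ?thesis using False by auto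
  qed
  have "2 *\<^sub>R vmul (vmul c) \<alpha> = (\<Sum>j\<in>UNIV. \<Sum>i\<in>UNIV. T j i) + (\<Sum>j\<in>UNIV. \<Sum>i\<in>UNIV. T i j)"
    using sum.swap[of T UNIV UNIV] by (simp add: V scaleR_2)
  also have "\<dots> = (\<Sum>j\<in>UNIV. \<Sum>i\<in>UNIV. T j i + T i j)" by (simp add: sum.distrib)
  also have "\<dots> = 2 *\<^sub>R (- (\<Sum>j\<in>UNIV. if dec j \<alpha> j > 0 then c (dec j (dec j \<alpha>)) else 0))"
    unfolding T by (simp add: sum_negf scaleR_sum_right)
  finally show ?thesis unfolding scaleR_cancel_left by simp
qed

lemma hcoef_inc:
  "real (Suc (\<alpha> j)) * hcoef \<sigma> x (inc j \<alpha>)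
     = x $ j * hcoef \<sigma> x \<alpha> + \<sigma> * (if \<alpha> j > 0 then hcoef \<sigma> x (dec j \<alpha>) else 0)"
proof -
  define P where "P = (\<Prod>i\<in>UNIV - {j}. hgen \<sigma> (\<alpha> i) (x $ i))"
  have h: "hcoef \<sigma> x \<beta> = hgen \<sigma> (\<beta> j) (x $ j) * P" if "\<And>i. i \<noteq> j \<Longrightarrow> \<beta> i = \<alpha> i" for \<beta>
    unfolding hcoef_def P_def using that by (subst prod.remove[of _ j]) (auto intro!: prod.cong)
  have "real (Suc (\<alpha> j)) * hcoef \<sigma> x (inc j \<alpha>) = (real (Suc (\<alpha> j)) * hgen \<sigma> (Suc (\<alpha> j)) (x $ j)) * P"
    by (subst h) (auto simp: inc_other)
  also have "\<dots> = x $ j * hcoef \<sigma> x \<alpha> + \<sigma> * (if \<alpha> j > 0 then hcoef \<sigma> x (dec j \<alpha>) else 0)"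
    unfolding hgen_Suc using h[of \<alpha>] h[of "dec j \<alpha>"] by (auto simp: algebra_simps dec_other)
  finally show ?thesis .
qed

text \<open>
  Euler's identity for the degree-\<open>k\<close> part, by \<open>\<Sum>\<^sub>j z\<^sub>j \<partial>\<^sub>j exp(\<sigma>z\<cdot>z/2 + x\<cdot>z) = (x\<cdot>z + \<sigma>z\<cdot>z) exp(\<dots>)\<close> and
  \<open>z\<cdot>z = -z\<^sup>2\<close>.
\<close>

lemma hser_euler:
  "real (deg \<beta>) *\<^sub>R hser \<sigma> x \<beta> = xmul x (hser \<sigma> x) \<beta> - \<sigma> *\<^sub>R vmul (vmul (hser \<sigma> x)) \<beta>"
proof -
  have "real (\<beta> j) *\<^sub>R hser \<sigma> x \<beta> = (if \<beta> j > 0 then x $ j *\<^sub>R hser \<sigma> x (dec j \<beta>) else 0)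
      + \<sigma> *\<^sub>R (if dec j \<beta> j > 0 then hser \<sigma> x (dec j (dec j \<beta>)) else 0)" for j
  proof (cases "\<beta> j > 0")
    case True
    then show ?thesis
      using arg_cong[OF hcoef_inc[of "dec j \<beta>" j \<sigma> x], of "\<lambda>r. r *\<^sub>R (cl_one :: 'a clifford)"]
      by (auto simp: hser_def inc_dec scaleR_add_left)
  qed simp
  then have "real (deg \<beta>) *\<^sub>R hser \<sigma> x \<beta> = (\<Sum>j\<in>UNIV. (if \<beta> j > 0 then x $ j *\<^sub>R hser \<sigma> x (dec j \<beta>) else 0)
      + \<sigma> *\<^sub>R (if dec j \<beta> j > 0 then hser \<sigma> x (dec j (dec j \<beta>)) else 0))"
    by (simp add: scaleR_sum_left)
  then show ?thesis by (simp add: xmul_def vmul_vmul sum.distrib scaleR_sum_right)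
qed

lemma hser_deg_0:
  assumes "deg \<beta> = 0"
  shows "hser \<sigma> x \<beta> = hser 0 x \<beta>"
proof -
  have "\<beta> = (\<lambda>_. 0)" using assms by (auto simp: fun_eq_iff)
  then show ?thesis by (simp add: hser_def hcoef_0)
qed

text \<open>
  Degree by degree, \<open>exp(\<sigma>z\<cdot>z/2 + x\<cdot>z)\<close> and \<open>exp(x\<cdot>z)\<close> differ by a left multiple of the vector \<open>z\<close>.
  In Euler's identity the \<open>\<sigma>\<close>-term is such a multiple, and multiplication by the scalar \<open>x\<cdot>z\<close>
  preserves the multiples found in the preceding degree.
\<close>

lemma hser_eq_vmul: "\<exists>q. \<forall>\<beta>. deg \<beta> = k \<longrightarrow> hser \<sigma> x \<beta> = hser 0 x \<beta> + vmul q \<beta>"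
proof (induction k)
  case 0
  have "hser \<sigma> x \<beta> = hser 0 x \<beta>" if "deg \<beta> = 0" for \<beta> using that by (rule hser_deg_0)
  then show ?case by (intro exI[of _ "\<lambda>_. 0"]) simp
next
  case (Suc k)
  then obtain q where q: "\<And>\<beta>. deg \<beta> = k \<Longrightarrow> hser \<sigma> x \<beta> = hser 0 x \<beta> + vmul q \<beta>" by blast
  \<comment> \<open>The cofactor in the next degree, before division by \<open>k + 1\<close>.\<close>
  define p where "p = (\<lambda>\<alpha>. xmul x q \<alpha> + (- \<sigma>) *\<^sub>R vmul (hser \<sigma> x) \<alpha>)"
  have "hser \<sigma> x \<beta> = hser 0 x \<beta> + vmul (\<lambda>\<alpha>. (1 / real (Suc k)) *\<^sub>R p \<alpha>) \<beta>" if \<beta>: "deg \<beta> = Suc k" for \<beta>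
  proof -
    have "xmul x (hser \<sigma> x) \<beta> = xmul x (\<lambda>\<alpha>. hser 0 x \<alpha> + vmul q \<alpha>) \<beta>"
      by (rule xmul_cong[OF _ \<beta>]) (rule q)
    then have "real (Suc k) *\<^sub>R hser \<sigma> x \<beta> = xmul x (\<lambda>\<alpha>. hser 0 x \<alpha> + vmul q \<alpha>) \<beta> - \<sigma> *\<^sub>R vmul (vmul (hser \<sigma> x)) \<beta>"
      using hser_euler[of \<beta> \<sigma> x] unfolding \<beta> by simp
    also have "xmul x (\<lambda>\<alpha>. hser 0 x \<alpha> + vmul q \<alpha>) \<beta> = real (Suc k) *\<^sub>R hser 0 x \<beta> + vmul (xmul x q) \<beta>"
      using hser_euler[of \<beta> 0 x] \<beta> by (simp add: xmul_add vmul_xmul)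
    also have "real (Suc k) *\<^sub>R hser 0 x \<beta> + vmul (xmul x q) \<beta> - \<sigma> *\<^sub>R vmul (vmul (hser \<sigma> x)) \<beta>
        = real (Suc k) *\<^sub>R hser 0 x \<beta> + vmul p \<beta>"
      by (simp only: p_def vmul_add vmul_scaleR) simp
    finally have "(1 / real (Suc k)) *\<^sub>R (real (Suc k) *\<^sub>R hser \<sigma> x \<beta>)
        = (1 / real (Suc k)) *\<^sub>R (real (Suc k) *\<^sub>R hser 0 x \<beta> + vmul p \<beta>)" by simp
    then show ?thesis by (simp add: scaleR_add_right vmul_scaleR del: of_nat_Suc)
  qed
  then show ?case by blast
qed

lemma restr_vmul:
  fixes q :: "'m::{finite,linorder} coeffs"
  shows "restr (Suc k) (vmul q) = vmul (restr k q)"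
proof
  fix \<alpha> :: "'m \<Rightarrow> nat"
  show "restr (Suc k) (vmul q) \<alpha> = vmul (restr k q) \<alpha>"
  proof (cases "deg \<alpha> = Suc k")
    case True
    then have "\<alpha> j > 0 \<Longrightarrow> deg (dec j \<alpha>) = k" for j using deg_dec[of \<alpha> j] by simp
    then show ?thesis using True
      by (simp add: restr_def[of "Suc k"] vmul_def) (intro sum.cong refl, simp add: restr_def)
  next
    case False
    then show ?thesis using hom_vmul[OF hom_restr, of k q] by (simp add: restr_def[of "Suc k"] hom_def)
  qed
qed

text \<open>
  The Gaussian factor in the kernel of the transform is invisible to the monogenic projection.
\<close>

lemma monogenic_coeffs_hser:
  fixes x :: "'m::{finite,linorder} rspace"
  shows "monogenic_coeffs (hser \<sigma> x) = monogenic_coeffs (hser 0 x)"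
proof
  fix \<alpha> :: "'m \<Rightarrow> nat"
  obtain q where q: "\<And>\<beta>. deg \<beta> = deg \<alpha> \<Longrightarrow> hser \<sigma> x \<beta> = hser 0 x \<beta> + vmul q \<beta>"
    using hser_eq_vmul by blast
  show "monogenic_coeffs (hser \<sigma> x) \<alpha> = monogenic_coeffs (hser 0 x) \<alpha>"
  proof (cases "deg \<alpha>")
    case 0
    then have "restr (deg \<alpha>) (hser \<sigma> x) = restr (deg \<alpha>) (hser 0 x)"
      using hser_deg_0[of _ \<sigma> x] unfolding 0 restr_def by (intro ext if_cong) auto
    then show ?thesis by (simp add: monogenic_coeffs_def)
  next
    case (Suc k)
    have "restr (deg \<alpha>) (hser \<sigma> x) = (\<lambda>\<beta>. restr (deg \<alpha>) (hser 0 x) \<beta> + restr (deg \<alpha>) (vmul q) \<beta>)"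
      using q by (auto simp: restr_def fun_eq_iff)
    then show ?thesis
      by (simp add: monogenic_coeffs_def fischer_proj_add Suc restr_vmul fischer_proj_vmul)
  qed
qed

section \<open>Integration against Gaussian weights\<close>

text \<open>
  Up to a constant, the Gaussian is a product of one-dimensional normal densities.
\<close>

lemma has_bochner_integral_gaussian:
  assumes "s > 0"
  shows "has_bochner_integral lborel (\<lambda>x :: 'm::finite rspace. exp (- (norm x)\<^sup>2 / (2 * s\<^sup>2)))
    (sqrt (2 * pi * s\<^sup>2) ^ CARD('m))"
proof (rule has_bochner_integral_nn_integral)
  define c where "c = sqrt (2 * pi * s\<^sup>2)"
  have c: "c > 0" using assms by (simp add: c_def)
  have e: "exp (- t\<^sup>2 / (2 * s\<^sup>2)) = c * normal_density 0 s t" for t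
    using c by (simp add: normal_density_def flip: c_def)
  have 1: "(\<integral>\<^sup>+t. ennreal (exp (- t\<^sup>2 / (2 * s\<^sup>2))) \<partial>lborel) = ennreal c"
  proof -
    have "integrable lborel (\<lambda>t. exp (- t\<^sup>2 / (2 * s\<^sup>2)))" unfolding e
      using assms by (intro integrable_mult_right) simp
    then have "(\<integral>\<^sup>+t. ennreal (exp (- t\<^sup>2 / (2 * s\<^sup>2))) \<partial>lborel)
        = ennreal (LINT t|lborel. exp (- t\<^sup>2 / (2 * s\<^sup>2)))"
      by (rule nn_integral_eq_integral) simp
    also have "(LINT t|lborel. exp (- t\<^sup>2 / (2 * s\<^sup>2))) = c"
      unfolding e using assms by simp
    finally show ?thesis .
  qed
  have 2: "ennreal (exp (- (norm x)\<^sup>2 / (2 * s\<^sup>2))) = (\<Prod>b\<in>Basis. ennreal (exp (- (x \<bullet> b)\<^sup>2 / (2 * s\<^sup>2))))"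
    for x :: "'m rspace"
  proof -
    have "(norm x)\<^sup>2 = (\<Sum>b\<in>Basis. (x \<bullet> b)\<^sup>2)"
      unfolding power2_norm_eq_inner by (subst euclidean_inner) (simp add: power2_eq_square)
    then show ?thesis
      by (simp add: prod_ennreal exp_sum sum_negf[symmetric] sum_divide_distrib)
  qed
  show "(\<integral>\<^sup>+x. ennreal (exp (- (norm (x :: 'm rspace))\<^sup>2 / (2 * s\<^sup>2))) \<partial>lborel) = ennreal (sqrt (2 * pi * s\<^sup>2) ^ CARD('m))"
    unfolding 2 using c
    by (subst nn_integral_lborel_prod) (simp_all add: 1[simplified] ennreal_power flip: c_def)
qed auto

lemma integrable_gaussian_lebesgue:
  assumes "s > 0"
  shows "integrable lebesgue (\<lambda>x :: 'm::finite rspace. exp (- (norm x)\<^sup>2 / (2 * s\<^sup>2)))"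
  using has_bochner_integral_gaussian[OF assms, where 'm = 'm]
  by (subst integrable_completion) (auto simp: has_bochner_integral_iff)

abbreviation gauss_const :: "'m::finite itself \<Rightarrow> real" where
  "gauss_const T \<equiv> 1 / (2 * pi) powr (real CARD('m) / 2)"

lemma gaussian_integral:
  "integrable lborel (\<lambda>x :: 'm::finite rspace. exp (- (norm x)\<^sup>2 / 2))"
  "(LINT x|lborel. exp (- (norm (x :: 'm rspace))\<^sup>2 / 2)) = (2 * pi) powr (real CARD('m) / 2)"
proof -
  have "sqrt (2 * pi) ^ CARD('m) = (2 * pi) powr (real CARD('m) / 2)"
    by (simp add: powr_half_sqrt[symmetric] powr_powr flip: powr_realpow)
  then show "integrable lborel (\<lambda>x :: 'm::finite rspace. exp (- (norm x)\<^sup>2 / 2))"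
    "(LINT x|lborel. exp (- (norm (x :: 'm rspace))\<^sup>2 / 2)) = (2 * pi) powr (real CARD('m) / 2)"
    using has_bochner_integral_gaussian[of 1, where 'm = 'm] by (simp_all add: has_bochner_integral_iff)
qed

text \<open>
  Exponential integrability of every order is what the majorants of the kernels call for.
\<close>

definition admissible_weight :: "('m::{finite,linorder} rspace \<Rightarrow> 'm clifford) \<Rightarrow> bool" where
  "admissible_weight w \<longleftrightarrow> w \<in> borel_measurable lebesgue \<and>
     (\<forall>a. integrable lebesgue (\<lambda>x. exp (a * norm x) * norm (w x)))"

lemma borel_measurable_lebesgue_continuous:
  fixes f :: "'a::euclidean_space \<Rightarrow> 'b::topological_space"
  assumes "continuous_on UNIV f"
  shows "f \<in> borel_measurable lebesgue"
proof -
  have "f \<in> borel_measurable lborel" using borel_measurable_continuous_onI[OF assms] by simp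
  then show ?thesis by (rule measurable_completion)
qed

text \<open>
  Half of the Gaussian decay pays for the exponential: with \<open>u = exp(a|x| - |x|\<^sup>2/4)\<close> one has
  \<open>u|f| \<le> u\<^sup>2 + |f|\<^sup>2\<close>, and \<open>u\<^sup>2 \<le> exp(4a\<^sup>2) exp(-|x|\<^sup>2/4)\<close>.
\<close>

lemma admissible_weight_gaussian:
  assumes f: "square_integrable f"
  shows "admissible_weight (\<lambda>x. exp (- (norm x)\<^sup>2 / 4) *\<^sub>R f x)"
  unfolding admissible_weight_def
proof (intro conjI allI)
  have [measurable]: "f \<in> borel_measurable lebesgue" using f by (simp add: square_integrable_def)
  have [measurable]: "(\<lambda>x :: 'a rspace. exp (- (norm x)\<^sup>2 / 4)) \<in> borel_measurable lebesgue"
    by (intro borel_measurable_lebesgue_continuous continuous_intros) auto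
  show m: "(\<lambda>x. exp (- (norm x)\<^sup>2 / 4) *\<^sub>R f x) \<in> borel_measurable lebesgue" by measurable
  fix a :: real
  have [measurable]: "(\<lambda>x :: 'a rspace. exp (a * norm x)) \<in> borel_measurable lebesgue"
    by (intro borel_measurable_lebesgue_continuous continuous_intros)
  show "integrable lebesgue (\<lambda>x. exp (a * norm x) * norm (exp (- (norm x)\<^sup>2 / 4) *\<^sub>R f x))"
  proof (rule Bochner_Integration.integrable_bound)
    show "integrable lebesgue (\<lambda>x. exp (4 * a\<^sup>2) * exp (- (norm x)\<^sup>2 / (2 * (sqrt 2)\<^sup>2)) + (norm (f x))\<^sup>2)"
      using f by (intro Bochner_Integration.integrable_add integrable_mult_right integrable_gaussian_lebesgue)
        (simp_all add: square_integrable_def)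
    show "(\<lambda>x. exp (a * norm x) * norm (exp (- (norm x)\<^sup>2 / 4) *\<^sub>R f x)) \<in> borel_measurable lebesgue"
      using m by measurable
    show "AE x in lebesgue. norm (exp (a * norm x) * norm (exp (- (norm x)\<^sup>2 / 4) *\<^sub>R f x))
       \<le> norm (exp (4 * a\<^sup>2) * exp (- (norm x)\<^sup>2 / (2 * (sqrt 2)\<^sup>2)) + (norm (f x))\<^sup>2)"
    proof (rule AE_I2)
      fix x :: "'a rspace"
      define t where "t = norm x"
      define u where "u = exp (a * t - t\<^sup>2 / 4)"
      have "2 * (a * t) \<le> 4 * a\<^sup>2 + t\<^sup>2 / 4"
        using zero_le_power2[of "2 * a - t / 2"] by (simp add: power2_eq_square algebra_simps)
      then have "u\<^sup>2 \<le> exp (4 * a\<^sup>2) * exp (- t\<^sup>2 / 4)"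
        by (simp add: u_def exp_double[symmetric] flip: exp_add)
      moreover have "u * norm (f x) \<le> u\<^sup>2 + (norm (f x))\<^sup>2"
      proof -
        have "2 * (u * norm (f x)) \<le> u\<^sup>2 + (norm (f x))\<^sup>2"
          using zero_le_power2[of "u - norm (f x)"] by (simp add: power2_eq_square algebra_simps)
        moreover have "u * norm (f x) \<ge> 0" by (simp add: u_def)
        ultimately show ?thesis by linarith
      qed
      moreover have "exp (a * t) * norm (exp (- t\<^sup>2 / 4) *\<^sub>R f x) = u * norm (f x)"
      proof -
        have "u = exp (a * t) * exp (- t\<^sup>2 / 4)" by (simp add: u_def flip: exp_add)
        then show ?thesis by simp
      qed
      ultimately have "exp (a * t) * norm (exp (- t\<^sup>2 / 4) *\<^sub>R f x) \<le> exp (4 * a\<^sup>2) * exp (- t\<^sup>2 / 4) + (norm (f x))\<^sup>2"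
        by linarith
      then show "norm (exp (a * norm x) * norm (exp (- (norm x)\<^sup>2 / 4) *\<^sub>R f x))
       \<le> norm (exp (4 * a\<^sup>2) * exp (- (norm x)\<^sup>2 / (2 * (sqrt 2)\<^sup>2)) + (norm (f x))\<^sup>2)"
        by (simp add: t_def)
    qed
  qed
qed

lemma integrable_majorant:
  fixes w :: "'m::{finite,linorder} rspace \<Rightarrow> 'm clifford"
  assumes "admissible_weight w" "r \<ge> 0"
  shows "integrable lebesgue (\<lambda>x. majorant \<sigma> r x * norm (w x))"
proof (rule Bochner_Integration.integrable_bound)
  have w: "w \<in> borel_measurable lebesgue" using assms by (simp add: admissible_weight_def)
  have m: "(\<lambda>x :: 'm rspace. majorant \<sigma> r x) \<in> borel_measurable lebesgue"
    unfolding majorant_def by (intro borel_measurable_lebesgue_continuous continuous_intros)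
  show "(\<lambda>x. majorant \<sigma> r x * norm (w x)) \<in> borel_measurable lebesgue"
    using w m by measurable
  let ?B = "\<lambda>x. exp (CARD('m) * (\<bar>\<sigma>\<bar> / 2 * r\<^sup>2)) * (exp ((CARD('m) * r) * norm x) * norm (w x))"
  show "integrable lebesgue ?B"
    using assms(1) by (intro integrable_mult_right) (simp add: admissible_weight_def)
  have "majorant \<sigma> r x * norm (w x) \<le> ?B x" for x
    using mult_right_mono[OF majorant_le[OF assms(2), of \<sigma> x], of "norm (w x)"] by (simp add: mult.assoc)
  then show "AE x in lebesgue. norm (majorant \<sigma> r x * norm (w x)) \<le> norm (?B x)"
    by (intro AE_I2) (simp add: majorant_def)
qed

lemma abs_hcoef_le_majorant: "\<bar>hcoef \<sigma> x \<beta>\<bar> \<le> majorant \<sigma> 1 x"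
proof -
  have "\<bar>hcoef \<sigma> x \<beta>\<bar> \<le> (\<Sum>\<alpha>\<in>multi_indices (deg \<beta>). \<bar>hcoef \<sigma> x \<alpha>\<bar> * 1 ^ deg \<beta>)"
    using member_le_sum[of \<beta> "multi_indices (deg \<beta>)" "\<lambda>\<alpha>. \<bar>hcoef \<sigma> x \<alpha>\<bar>"] by (simp add: multi_indices_iff)
  also have "\<dots> \<le> (\<Sum>k<Suc (deg \<beta>). \<Sum>\<alpha>\<in>multi_indices k. \<bar>hcoef \<sigma> x \<alpha>\<bar> * 1 ^ k)"
    by (rule member_le_sum) (auto intro: sum_nonneg)
  also have "\<dots> \<le> majorant \<sigma> 1 x" by (rule sum_degrees_le_majorant) simp
  finally show ?thesis .
qed

lemma integrable_hcoef:
  fixes w :: "'m::{finite,linorder} rspace \<Rightarrow> 'm clifford"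
  assumes "admissible_weight w"
  shows "integrable lebesgue (\<lambda>x. hcoef \<sigma> x \<beta> *\<^sub>R w x)"
proof (rule Bochner_Integration.integrable_bound[OF integrable_majorant[OF assms, of 1 \<sigma>]])
  have w: "w \<in> borel_measurable lebesgue" using assms by (simp add: admissible_weight_def)
  have m: "(\<lambda>x :: 'm rspace. hcoef \<sigma> x \<beta>) \<in> borel_measurable lebesgue"
    by (intro borel_measurable_lebesgue_continuous continuous_on_hcoef)
  show "(\<lambda>x. hcoef \<sigma> x \<beta> *\<^sub>R w x) \<in> borel_measurable lebesgue"
    using w m by measurable
  show "AE x in lebesgue. norm (hcoef \<sigma> x \<beta> *\<^sub>R w x) \<le> norm (majorant \<sigma> 1 x * norm (w x))"
    by (intro AE_I2) (use abs_hcoef_le_majorant[of \<sigma> _ \<beta>] in \<open>simp add: majorant_def mult_right_mono\<close>)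
qed simp

text \<open>
  Integration term by term, by dominated convergence. The vectors \<open>v \<beta>\<close> are the monomials \<open>z\<^sup>\<beta>\<close> for the
  transform itself and their monogenic parts for the Fourier-Borel integral.
\<close>

lemma hcoef_integral_sums:
  fixes w :: "'m::{finite,linorder} rspace \<Rightarrow> 'm clifford"
  assumes w: "admissible_weight w"
    and v: "\<And>\<beta>. norm (v \<beta>) \<le> r ^ deg \<beta>" "r \<ge> 0"
    and S: "\<And>x. (\<lambda>k. \<Sum>\<beta>\<in>multi_indices k. hcoef \<sigma> x \<beta> *\<^sub>R v \<beta>) sums S x"
  shows "integrable lebesgue (\<lambda>x. S x \<odot> w x)"
    and "(\<lambda>k. \<Sum>\<beta>\<in>multi_indices k. v \<beta> \<odot> (LINT x|lebesgue. hcoef \<sigma> x \<beta> *\<^sub>R w x))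
      sums (LINT x|lebesgue. S x \<odot> w x)"
proof -
  define s where "s N x = (\<Sum>k<N. \<Sum>\<beta>\<in>multi_indices k. v \<beta> \<odot> (hcoef \<sigma> x \<beta> *\<^sub>R w x))" for N x
  define B where "B x = cl_const TYPE('m) * (majorant \<sigma> r x * norm (w x))" for x
  have iv: "integrable lebesgue (\<lambda>x. v \<beta> \<odot> (hcoef \<sigma> x \<beta> *\<^sub>R w x))" for \<beta>
    by (rule integrable_bounded_linear[OF cl.bounded_linear_right integrable_hcoef[OF w]])
  have int_s: "integrable lebesgue (s N)" for N
    unfolding s_def by (intro Bochner_Integration.integrable_sum iv)
  then have ms: "s N \<in> borel_measurable lebesgue" for N by (rule borel_measurable_integrable)
  have s_eq: "s N x = (\<Sum>k<N. \<Sum>\<beta>\<in>multi_indices k. hcoef \<sigma> x \<beta> *\<^sub>R v \<beta>) \<odot> w x" for N x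
    by (simp add: s_def cl.sum_left cl.scaleR_left cl.scaleR_right)
  have lim: "(\<lambda>N. s N x) \<longlonglongrightarrow> S x \<odot> w x" for x
    unfolding s_eq using S[of x] unfolding sums_def by (intro cl.tendsto tendsto_const)
  have mS: "(\<lambda>x. S x \<odot> w x) \<in> borel_measurable lebesgue"
    by (rule borel_measurable_LIMSEQ_metric[OF ms lim])
  have iB: "integrable lebesgue B"
    unfolding B_def by (intro integrable_mult_right integrable_majorant w v)
  have sB: "norm (s N x) \<le> B x" for N x
  proof -
    have "norm (\<Sum>k<N. \<Sum>\<beta>\<in>multi_indices k. hcoef \<sigma> x \<beta> *\<^sub>R v \<beta>)
       \<le> (\<Sum>k<N. \<Sum>\<beta>\<in>multi_indices k. \<bar>hcoef \<sigma> x \<beta>\<bar> * r ^ k)"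
      using v by (intro sum_norm_le) (auto simp: multi_indices_iff intro!: mult_left_mono)
    also have "\<dots> \<le> majorant \<sigma> r x" by (rule sum_degrees_le_majorant[OF v(2)])
    finally have "norm (\<Sum>k<N. \<Sum>\<beta>\<in>multi_indices k. hcoef \<sigma> x \<beta> *\<^sub>R v \<beta>) \<le> majorant \<sigma> r x" .
    then have "cl_const TYPE('m) * norm (\<Sum>k<N. \<Sum>\<beta>\<in>multi_indices k. hcoef \<sigma> x \<beta> *\<^sub>R v \<beta>) * norm (w x) \<le> B x"
      using cl_const_pos[where 'm = 'm] by (simp add: B_def mult.assoc mult_right_mono)
    then show ?thesis unfolding s_eq using norm_cl_mult_le order_trans by blast
  qed
  show "integrable lebesgue (\<lambda>x. S x \<odot> w x)"
    by (rule integrable_dominated_convergence[OF mS ms iB]) (auto intro: lim sB)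
  have "(\<lambda>N. integral\<^sup>L lebesgue (s N)) \<longlonglongrightarrow> (LINT x|lebesgue. S x \<odot> w x)"
    by (rule integral_dominated_convergence[OF mS ms iB]) (auto intro: lim sB)
  moreover have "integral\<^sup>L lebesgue (s N)
      = (\<Sum>k<N. \<Sum>\<beta>\<in>multi_indices k. v \<beta> \<odot> (LINT x|lebesgue. hcoef \<sigma> x \<beta> *\<^sub>R w x))" for N
    unfolding s_def
    by (simp add: Bochner_Integration.integral_sum iv
        integral_bounded_linear[OF cl.bounded_linear_right integrable_hcoef[OF w]])
  ultimately show "(\<lambda>k. \<Sum>\<beta>\<in>multi_indices k. v \<beta> \<odot> (LINT x|lebesgue. hcoef \<sigma> x \<beta> *\<^sub>R w x))
      sums (LINT x|lebesgue. S x \<odot> w x)"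
    by (simp add: sums_def)
qed

section \<open>The Fourier-Borel kernel\<close>

lemma real_fourier_borel_eq:
  "real_fourier_borel x u = pseries (monogenic_coeffs (hser 0 u)) (complexify x)"
proof -
  have e: "(\<Sum>j\<in>UNIV. of_real (0 / 2) * (complexify y $ j)\<^sup>2 + of_real (u $ j) * complexify y $ j)
      = complex_of_real (y \<bullet> u)" for y
    by (simp add: complexify_def inner_vec_def mult.commute)
  have "(\<lambda>y. exp (y \<bullet> u) *\<^sub>R cl_one) = (\<lambda>y. pseries (hser 0 u) (complexify y))"
    unfolding pseries_hser e exp_of_real of_real_smult ..
  then show ?thesis
    unfolding real_fourier_borel_def by (simp only: monogenic_part_pseries[OF rapid_hser])
qed

lemma fourier_borel_eq: "fourier_borel z u = pseries (monogenic_coeffs (hser 0 u)) z"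
proof -
  have "is_holomorphic_extension (\<lambda>x. real_fourier_borel x u) (pseries (monogenic_coeffs (hser 0 u)))"
    by (simp add: is_holomorphic_extension_def real_fourier_borel_eq entire_pseries
        rapid_monogenic_coeffs rapid_hser)
  then show ?thesis unfolding fourier_borel_def by (simp add: holomorphic_extension_eq)
qed

text \<open>
  The kernel expands in Hermite coefficients (\<open>\<sigma> = -1\<close>) as well as in powers (\<open>\<sigma> = 0\<close>). The first
  form meets the coefficients of the transform, the second the Taylor coefficients in the Fischer
  inner product.
\<close>

lemma fourier_borel_sums:
  "(\<lambda>k. \<Sum>\<beta>\<in>multi_indices k. hcoef \<sigma> u \<beta> *\<^sub>R mono_proj \<beta> z) sums fourier_borel z u"
proof -
  have "ceval k (monogenic_coeffs (hser 0 u)) z = (\<Sum>\<beta>\<in>multi_indices k. hcoef \<sigma> u \<beta> *\<^sub>R mono_proj \<beta> z)" for k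
    unfolding monogenic_coeffs_hser[of \<sigma> u, symmetric] ceval_monogenic_coeffs_eq_sum
    by (simp add: hser_def cl.scaleR_right cl_one_right)
  then show ?thesis
    using pseries_sums[OF rapid_monogenic_coeffs[OF rapid_hser], of 0 u z]
    by (simp add: fourier_borel_eq)
qed

section \<open>The Segal-Bargmann-Fock transform as an entire series\<close>

text \<open>
  The Taylor coefficients of the transform of \<open>f\<close>, where \<open>w(x) = exp(-|x|\<^sup>2/4) f(x)\<close>.
\<close>

definition sb_coeffs :: "('m::{finite,linorder} rspace \<Rightarrow> 'm clifford) \<Rightarrow> 'm coeffs" where
  "sb_coeffs w \<alpha> = gauss_const TYPE('m) *\<^sub>R (LINT x|lebesgue. hcoef (-1) x \<alpha> *\<^sub>R w x)"

lemma rapid_sb_coeffs: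
  fixes w :: "'m::{finite,linorder} rspace \<Rightarrow> 'm clifford"
  assumes w: "admissible_weight w"
  shows "rapid (sb_coeffs w)"
  unfolding rapid_def
proof (intro allI impI)
  fix r :: real assume r: "r \<ge> 0"
  define C where "C = gauss_const TYPE('m)"
  have C: "C \<ge> 0" by (simp add: C_def)
  show "summable (\<lambda>k. r ^ k * cnorm k (sb_coeffs w))"
  proof (rule bounded_imp_summable)
    fix n
    have ih: "integrable lebesgue (\<lambda>x. \<bar>hcoef (-1) x \<alpha>\<bar> * norm (w x))" for \<alpha>
      using integrable_norm[OF integrable_hcoef[OF w, of "-1" \<alpha>]] by simp
    have ihr: "integrable lebesgue (\<lambda>x. (\<bar>hcoef (-1) x \<alpha>\<bar> * r ^ k) * norm (w x))" for \<alpha> k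
      using integrable_mult_right[OF ih, of "r ^ k" \<alpha>] by (simp only: mult_ac)
    have "r ^ k * cnorm k (sb_coeffs w)
        \<le> C * (LINT x|lebesgue. (\<Sum>\<alpha>\<in>multi_indices k. \<bar>hcoef (-1) x \<alpha>\<bar> * r ^ k) * norm (w x))" for k
    proof -
      have "norm (sb_coeffs w \<alpha>) \<le> C * (LINT x|lebesgue. \<bar>hcoef (-1) x \<alpha>\<bar> * norm (w x))" for \<alpha>
        using integral_norm_bound[of lebesgue "\<lambda>x. hcoef (-1) x \<alpha> *\<^sub>R w x"] C
        by (simp add: sb_coeffs_def mult_left_mono flip: C_def)
      then have "r ^ k * cnorm k (sb_coeffs w)
          \<le> r ^ k * (\<Sum>\<alpha>\<in>multi_indices k. C * (LINT x|lebesgue. \<bar>hcoef (-1) x \<alpha>\<bar> * norm (w x)))"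
        unfolding cnorm_def using r by (intro mult_left_mono sum_mono) auto
      also have "\<dots> = C * (LINT x|lebesgue. r ^ k * (\<Sum>\<alpha>\<in>multi_indices k. \<bar>hcoef (-1) x \<alpha>\<bar> * norm (w x)))"
        using ih by (simp add: Bochner_Integration.integral_sum sum_distrib_left mult_ac)
      finally show ?thesis by (simp add: sum_distrib_left sum_distrib_right mult_ac)
    qed
    then have "(\<Sum>k\<le>n. r ^ k * cnorm k (sb_coeffs w))
        \<le> (\<Sum>k\<le>n. C * (LINT x|lebesgue. (\<Sum>\<alpha>\<in>multi_indices k. \<bar>hcoef (-1) x \<alpha>\<bar> * r ^ k) * norm (w x)))"
      by (rule sum_mono)
    also have "\<dots> = C * (LINT x|lebesgue. (\<Sum>k\<le>n. (\<Sum>\<alpha>\<in>multi_indices k. \<bar>hcoef (-1) x \<alpha>\<bar> * r ^ k) * norm (w x)))"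
    proof -
      have "integrable lebesgue (\<lambda>x. (\<Sum>\<alpha>\<in>multi_indices k. \<bar>hcoef (-1) x \<alpha>\<bar> * r ^ k) * norm (w x))" for k
        unfolding sum_distrib_right
        by (intro Bochner_Integration.integrable_sum ihr)
      then show ?thesis by (simp add: Bochner_Integration.integral_sum sum_distrib_left)
    qed
    also have "\<dots> \<le> C * (LINT x|lebesgue. majorant (-1) r x * norm (w x))"
    proof (intro mult_left_mono C integral_mono)
      show "integrable lebesgue (\<lambda>x. majorant (-1) r x * norm (w x))" by (rule integrable_majorant[OF w r])
      show "integrable lebesgue (\<lambda>x. \<Sum>k\<le>n. (\<Sum>\<alpha>\<in>multi_indices k. \<bar>hcoef (-1) x \<alpha>\<bar> * r ^ k) * norm (w x))"
        unfolding sum_distrib_right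
        by (intro Bochner_Integration.integrable_sum ihr)
      fix x
      show "(\<Sum>k\<le>n. (\<Sum>\<alpha>\<in>multi_indices k. \<bar>hcoef (-1) x \<alpha>\<bar> * r ^ k) * norm (w x)) \<le> majorant (-1) r x * norm (w x)"
        using mult_right_mono[OF sum_degrees_le_majorant[OF r, where N = "Suc n" and \<sigma> = "-1" and x = x], of "norm (w x)"]
        by (simp add: sum_distrib_right lessThan_Suc_atMost)
    qed
    finally show "(\<Sum>k\<le>n. r ^ k * cnorm k (sb_coeffs w)) \<le> C * (LINT x|lebesgue. majorant (-1) r x * norm (w x))" .
  qed (use r in simp)
qed

lemma segal_bargmann_kernel:
  "exp (- cdot z z / 2 + cdot (complexify x) z - cdot (complexify x) (complexify x) / 4) *s
     (exp (- (norm x)\<^sup>2 / 4) *\<^sub>R a)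
   = (exp (\<Sum>j\<in>UNIV. of_real (-1 / 2) * (z $ j)\<^sup>2 + of_real (x $ j) * z $ j) *s cl_one) \<odot> (exp (- (norm x)\<^sup>2 / 2) *\<^sub>R a)"
proof -
  have n: "cdot (complexify x) (complexify x) = of_real ((norm x)\<^sup>2)"
    by (simp add: cdot_def complexify_def power2_norm_eq_inner inner_vec_def)
  have s: "- cdot z z / 2 + cdot (complexify x) z = (\<Sum>j\<in>UNIV. of_real (-1 / 2) * (z $ j)\<^sup>2 + of_real (x $ j) * z $ j)"
    by (simp add: cdot_def complexify_def sum.distrib sum_subtractf power2_eq_square sum_divide_distrib sum_negf)
  have e: "exp (- complex_of_real ((norm x)\<^sup>2) / 4) = of_real (exp (- (norm x)\<^sup>2 / 4))"
    by (simp flip: exp_of_real)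
  have ee: "exp (- (norm x)\<^sup>2 / 2) = exp (- (norm x)\<^sup>2 / 4) * exp (- (norm x)\<^sup>2 / 4)"
    by (simp flip: exp_add)
  define T where "T = (\<Sum>j\<in>UNIV. of_real (-1 / 2) * (z $ j)\<^sup>2 + of_real (x $ j) * z $ j)"
  have "exp (- cdot z z / 2 + cdot (complexify x) z - cdot (complexify x) (complexify x) / 4)
      = exp (T + - complex_of_real ((norm x)\<^sup>2) / 4)"
    unfolding n T_def s[symmetric] by (simp add: algebra_simps)
  also have "\<dots> = exp T * of_real (exp (- (norm x)\<^sup>2 / 4))" unfolding exp_add e ..
  finally show ?thesis
    unfolding T_def[symmetric] ee
    by (simp add: cl_mult_smult_left cl_one_left vector_smult_assoc mult_ac flip: of_real_smult)
qed

lemma hermite_kernel_sums: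
  fixes x :: "'m::{finite,linorder} rspace" and z :: "'m cspace"
  shows "(\<lambda>k. \<Sum>\<beta>\<in>multi_indices k. hcoef (-1) x \<beta> *\<^sub>R (mon z \<beta> *s (cl_one :: 'm clifford))) sums
    (exp (\<Sum>j\<in>UNIV. of_real (-1 / 2) * (z $ j)\<^sup>2 + of_real (x $ j) * z $ j) *s cl_one)"
  using pseries_sums[OF rapid_hser, of "-1" x z]
  by (simp add: pseries_hser ceval_def hser_def sm.scaleR_right)

lemma norm_mon_one_le: "norm (mon z \<beta> *s cl_one) \<le> norm z ^ deg \<beta>"
  by (simp add: norm_smult_complex norm_mon_le)

lemma segal_bargmann_integrable:
  fixes f g :: "'m rspace \<Rightarrow> 'm::{finite,linorder} clifford"
  assumes f: "\<And>x. f x = exp (- (norm x)\<^sup>2 / 4) *\<^sub>R g x"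
    and w: "admissible_weight (\<lambda>x. exp (- (norm x)\<^sup>2 / 2) *\<^sub>R g x)"
  shows "integrable lebesgue (\<lambda>x. exp (- cdot z z / 2 + cdot (complexify x) z
     - cdot (complexify x) (complexify x) / 4) *s f x)"
  unfolding f segal_bargmann_kernel
  by (rule hcoef_integral_sums(1)[OF w norm_mon_one_le _ hermite_kernel_sums]) simp

lemma segal_bargmann_eq_pseries:
  fixes f g :: "'m rspace \<Rightarrow> 'm::{finite,linorder} clifford"
  assumes f: "\<And>x. f x = exp (- (norm x)\<^sup>2 / 4) *\<^sub>R g x"
    and w: "admissible_weight (\<lambda>x. exp (- (norm x)\<^sup>2 / 2) *\<^sub>R g x)" (is "admissible_weight ?w")
  shows "segal_bargmann f = pseries (sb_coeffs ?w)"
proof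
  fix z :: "'m cspace"
  let ?S = "\<lambda>x. exp (\<Sum>j\<in>UNIV. of_real (-1 / 2) * (z $ j)\<^sup>2 + of_real (x $ j) * z $ j) *s cl_one"
  have "(\<lambda>k. \<Sum>\<beta>\<in>multi_indices k. (mon z \<beta> *s cl_one) \<odot> (LINT x|lebesgue. hcoef (-1) x \<beta> *\<^sub>R ?w x))
      sums (LINT x|lebesgue. ?S x \<odot> ?w x)"
    by (rule hcoef_integral_sums(2)[OF w norm_mon_one_le _ hermite_kernel_sums]) simp
  then have "(\<lambda>k. gauss_const TYPE('m) *\<^sub>R (\<Sum>\<beta>\<in>multi_indices k. (mon z \<beta> *s cl_one) \<odot> (LINT x|lebesgue. hcoef (-1) x \<beta> *\<^sub>R ?w x)))
      sums (gauss_const TYPE('m) *\<^sub>R (LINT x|lebesgue. ?S x \<odot> ?w x))"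
    by (rule sums_scaleR_right)
  moreover have "gauss_const TYPE('m) *\<^sub>R (\<Sum>\<beta>\<in>multi_indices k. (mon z \<beta> *s cl_one) \<odot> (LINT x|lebesgue. hcoef (-1) x \<beta> *\<^sub>R ?w x))
      = ceval k (sb_coeffs ?w) z" for k
    unfolding ceval_def sb_coeffs_def scaleR_sum_right
    by (simp add: cl_mult_smult_left cl_one_left sm.scaleR_right)
  moreover have "gauss_const TYPE('m) *\<^sub>R (LINT x|lebesgue. ?S x \<odot> ?w x) = segal_bargmann f z"
    unfolding segal_bargmann_def f segal_bargmann_kernel ..
  ultimately have "(\<lambda>k. ceval k (sb_coeffs ?w) z) sums segal_bargmann f z" by simp
  then show "segal_bargmann f z = pseries (sb_coeffs ?w) z"
    using sums_unique2 pseries_sums[OF rapid_sb_coeffs[OF w]] by blast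
qed

text \<open>
  Both sides are \<open>\<Sum>\<^sub>\<beta> M(z\<^sup>\<beta>) c\<^sub>\<beta>\<close>, with \<open>c\<^sub>\<beta>\<close> the Taylor coefficients of the transform.
\<close>

lemma fourier_borel_integral:
  fixes w :: "'m::{finite,linorder} rspace \<Rightarrow> 'm clifford"
  assumes w: "admissible_weight w"
  shows "integrable lebesgue (\<lambda>x. fourier_borel z x \<odot> w x)"
    and "gauss_const TYPE('m) *\<^sub>R (LINT x|lebesgue. fourier_borel z x \<odot> w x)
      = pseries (monogenic_coeffs (sb_coeffs w)) z"
proof -
  have r: "norm z * proj_const TYPE('m) \<ge> 0" using proj_const_ge_1[where 'm = 'm] by simp
  note sums = hcoef_integral_sums[OF w norm_mono_proj_le r fourier_borel_sums]
  show "integrable lebesgue (\<lambda>x. fourier_borel z x \<odot> w x)" by (rule sums(1))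
  have "(\<lambda>k. gauss_const TYPE('m) *\<^sub>R (\<Sum>\<beta>\<in>multi_indices k. mono_proj \<beta> z \<odot> (LINT x|lebesgue. hcoef (-1) x \<beta> *\<^sub>R w x)))
      sums (gauss_const TYPE('m) *\<^sub>R (LINT x|lebesgue. fourier_borel z x \<odot> w x))"
    by (rule sums_scaleR_right[OF sums(2)])
  moreover have "gauss_const TYPE('m) *\<^sub>R (\<Sum>\<beta>\<in>multi_indices k. mono_proj \<beta> z \<odot> (LINT x|lebesgue. hcoef (-1) x \<beta> *\<^sub>R w x))
      = ceval k (monogenic_coeffs (sb_coeffs w)) z" for k
    unfolding ceval_monogenic_coeffs_eq_sum sb_coeffs_def scaleR_sum_right cl.scaleR_right ..
  ultimately have "(\<lambda>k. ceval k (monogenic_coeffs (sb_coeffs w)) z)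
      sums (gauss_const TYPE('m) *\<^sub>R (LINT x|lebesgue. fourier_borel z x \<odot> w x))" by simp
  then show "gauss_const TYPE('m) *\<^sub>R (LINT x|lebesgue. fourier_borel z x \<odot> w x)
      = pseries (monogenic_coeffs (sb_coeffs w)) z"
    using sums_unique2 pseries_sums[OF rapid_monogenic_coeffs[OF rapid_sb_coeffs[OF w]]] by blast
qed

section \<open>Integration by parts for compact support\<close>

lemma compact_support_integral:
  fixes F :: "'m::finite rspace \<Rightarrow> 'b::euclidean_space"
  assumes "continuous_on UNIV F" "\<And>x. x \<notin> cbox a b \<Longrightarrow> F x = 0"
  shows "integrable lborel F" "(LINT x|lborel. F x) = integral (cbox a b) F"
proof -
  have F: "(\<lambda>x. indicator (cbox a b) x *\<^sub>R F x) = F"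
    using assms(2) by (auto simp: fun_eq_iff indicator_def)
  have "integrable lborel (\<lambda>x. indicator (cbox a b) x *\<^sub>R F x)"
    by (rule borel_integrable_compact[OF compact_cbox continuous_on_subset[OF assms(1) subset_UNIV]])
  then show i: "integrable lborel F" using F by simp
  have "set_integrable lborel (cbox a b) F"
    using i F by (simp add: set_integrable_def)
  from set_borel_integral_eq_integral(2)[OF this]
  show "(LINT x|lborel. F x) = integral (cbox a b) F"
    using F by (simp add: set_lebesgue_integral_def)
qed

lemma has_vector_derivative_integral_compact_support:
  fixes u u' :: "real \<Rightarrow> 'm::finite rspace \<Rightarrow> 'b::euclidean_space"
  assumes d: "\<And>t x. t \<in> {p..q} \<Longrightarrow> ((\<lambda>t. u t x) has_vector_derivative u' t x) (at t within {p..q})"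
    and cu: "\<And>t. t \<in> {p..q} \<Longrightarrow> continuous_on UNIV (u t)"
    and cu': "continuous_on UNIV (\<lambda>(t, x). u' t x)"
    and s: "\<And>t x. t \<in> {p..q} \<Longrightarrow> x \<notin> cbox a b \<Longrightarrow> u t x = 0 \<and> u' t x = 0"
    and t: "t0 \<in> {p..q}"
  shows "((\<lambda>t. LINT x|lborel. u t x) has_vector_derivative (LINT x|lborel. u' t0 x)) (at t0 within {p..q})"
proof -
  have "((\<lambda>t. integral (cbox a b) (u t)) has_vector_derivative integral (cbox a b) (u' t0)) (at t0 within {p..q})"
  proof (rule leibniz_rule_vector_derivative[OF d _ _ t])
    show "u t integrable_on cbox a b" if "t \<in> {p..q}" for t
      by (rule integrable_continuous[OF continuous_on_subset[OF cu[OF that] subset_UNIV]])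
    show "continuous_on ({p..q} \<times> cbox a b) (\<lambda>(t, x). u' t x)"
      using cu' by (rule continuous_on_subset) auto
  qed auto
  moreover have "(LINT x|lborel. u t x) = integral (cbox a b) (u t)" if "t \<in> {p..q}" for t
    using cu[OF that] s[OF that] by (intro compact_support_integral) auto
  moreover have "(LINT x|lborel. u' t0 x) = integral (cbox a b) (u' t0)"
  proof (rule compact_support_integral(2))
    have "continuous_on UNIV (\<lambda>x. case (t0, x) of (t, x) \<Rightarrow> u' t x)"
      by (rule continuous_on_compose2[OF cu']) (auto intro!: continuous_intros)
    then show "continuous_on UNIV (u' t0)" by simp
  qed (use s[OF t] in auto)
  ultimately show ?thesis
    using t has_vector_derivative_transform[of t0 "{p..q}" "\<lambda>t. LINT x|lborel. u t x" "\<lambda>t. integral (cbox a b) (u t)"]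
    by simp
qed

lemma lborel_integral_translate:
  fixes F :: "'a::euclidean_space \<Rightarrow> 'b::{banach,second_countable_topology}"
  assumes "F \<in> borel_measurable borel"
  shows "(LINT x|lborel. F (c + x)) = (LINT x|lborel. F x)"
proof -
  have "(LINT x|lborel. F x) = (LINT x|distr lborel borel ((+) c). F x)"
    by (simp add: lborel_distr_plus)
  also have "\<dots> = (LINT x|lborel. F (c + x))"
    using assms by (subst integral_distr) auto
  finally show ?thesis by simp
qed

text \<open>
  By translation invariance the integral of \<open>F(x + te)\<close> does not depend on \<open>t\<close>; its derivative at
  \<open>t = 0\<close> is the integral of the directional derivative.
\<close>

lemma integral_derivative_compact_support:
  fixes F :: "'m::finite rspace \<Rightarrow> 'b::euclidean_space"
  assumes F: "\<And>x. (F has_derivative F' x) (at x)"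
    and c: "continuous_on UNIV (\<lambda>x. F' x e)"
    and s: "\<And>x. norm x > R \<Longrightarrow> F x = 0 \<and> F' x e = 0"
  shows "(LINT x|lborel. F' x e) = 0"
proof -
  obtain a where a: "cball 0 (R + norm e) \<subseteq> cbox (- a) (a :: 'm rspace)"
    using bounded_subset_cbox_symmetric[OF bounded_cball] by metis
  have cF: "continuous_on UNIV F"
    using F by (meson has_derivative_continuous continuous_at_imp_continuous_on)
  have "((\<lambda>t. LINT x|lborel. F (x + t *\<^sub>R e)) has_vector_derivative
      (LINT x|lborel. F' (x + 0 *\<^sub>R e) e)) (at 0 within {-1..1})"
  proof (rule has_vector_derivative_integral_compact_support[where a = "- a" and b = a])
    fix t :: real and x :: "'m rspace"
    have "((\<lambda>t. x + t *\<^sub>R e) has_derivative (\<lambda>h. h *\<^sub>R e)) (at t within {-1..1})"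
      by (auto intro!: derivative_eq_intros)
    from has_derivative_compose[OF this F]
    show "((\<lambda>t. F (x + t *\<^sub>R e)) has_vector_derivative F' (x + t *\<^sub>R e) e) (at t within {-1..1})"
      by (simp add: has_vector_derivative_def linear_cmul[OF has_derivative_linear[OF F]])
    show "continuous_on UNIV (\<lambda>x. F (x + t *\<^sub>R e))"
      by (rule continuous_on_compose2[OF cF]) (auto intro!: continuous_intros)
    assume t: "t \<in> {-1..1}" and x: "x \<notin> cbox (- a) a"
    have "norm x > R + norm e" using a x by (meson mem_cball_0 not_le subsetD)
    moreover have "norm (t *\<^sub>R e) \<le> norm e" using t by (auto intro!: mult_left_le_one_le simp: abs_le_iff)
    moreover have "norm x \<le> norm (x + t *\<^sub>R e) + norm (t *\<^sub>R e)"
      using norm_triangle_ineq4[of "x + t *\<^sub>R e" "t *\<^sub>R e"] by simp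
    ultimately have "norm (x + t *\<^sub>R e) > R" by linarith
    then show "F (x + t *\<^sub>R e) = 0 \<and> F' (x + t *\<^sub>R e) e = 0" by (rule s)
  next
    have "continuous_on UNIV (\<lambda>p :: real \<times> 'm rspace. F' (snd p + fst p *\<^sub>R e) e)"
      by (rule continuous_on_compose2[OF c]) (auto intro!: continuous_intros)
    then show "continuous_on UNIV (\<lambda>(t, x). F' (x + t *\<^sub>R e) e)" by (simp add: case_prod_unfold)
  qed auto
  moreover have "(LINT x|lborel. F (x + t *\<^sub>R e)) = (LINT x|lborel. F x)" for t
    using lborel_integral_translate[OF borel_measurable_continuous_onI[OF cF], of "t *\<^sub>R e"]
    by (simp add: add.commute)
  ultimately have "((\<lambda>t::real. LINT x|lborel. F x) has_vector_derivative
      (LINT x|lborel. F' (x + 0 *\<^sub>R e) e)) (at 0 within {-1..1})"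
    by (simp only:)
  moreover have "at 0 within {-1..1} = at (0::real)" by (rule at_within_Icc_at) simp_all
  ultimately have "((\<lambda>t::real. LINT x|lborel. F x) has_vector_derivative (LINT x|lborel. F' x e)) (at 0)"
    by (simp only: scaleR_zero_left add_0_right)
  from vector_derivative_unique_at[OF this has_vector_derivative_const] show ?thesis .
qed

section \<open>Radial bumps\<close>

text \<open>
  A radial weight supported in the ball of radius \<open>\<surd>c\<close>, of class \<open>C\<^sup>p\<^sup>-\<^sup>1\<close> for \<open>p \<ge> 1\<close>. For \<open>p \<ge> 2\<close>
  its gradient is a multiple of \<open>x\<close> times the weight of exponent \<open>p - 1\<close>, and for \<open>c = 2p\<close> the weights tend
  to a Gaussian as \<open>p\<close> grows.
\<close>

definition bump :: "real \<Rightarrow> nat \<Rightarrow> 'm::finite rspace \<Rightarrow> real" where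
  "bump c p x = (max 0 (1 - (x \<bullet> x) / c)) ^ p"

lemma DERIV_max_power: "((\<lambda>s::real. (max 0 s) ^ Suc (Suc q)) has_field_derivative
   real (Suc (Suc q)) * (max 0 s) ^ Suc q) (at s)"
proof (cases "s = 0")
  case True
  have "(\<lambda>h. ((max 0 (0 + h)) ^ Suc (Suc q) - (max 0 0) ^ Suc (Suc q)) / h) \<midarrow>0\<rightarrow> (0::real)"
  proof (rule Lim_null_comparison)
    show "\<forall>\<^sub>F h in at 0. norm (((max 0 (0 + h)) ^ Suc (Suc q) - (max 0 0) ^ Suc (Suc q)) / h) \<le> \<bar>h\<bar> ^ Suc q"
    proof (intro always_eventually allI)
      fix h :: real
      show "norm (((max 0 (0 + h)) ^ Suc (Suc q) - (max 0 0) ^ Suc (Suc q)) / h) \<le> \<bar>h\<bar> ^ Suc q"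
      proof (cases "h > 0")
        case False
        then have "((max 0 (0 + h)) ^ Suc (Suc q) - (max 0 0) ^ Suc (Suc q)) / h = 0" by (simp add: max_def)
        then show ?thesis by (simp only: norm_zero zero_le_power abs_ge_zero)
      qed simp
    qed
    have "((\<lambda>h::real. \<bar>h\<bar> ^ Suc q) \<longlongrightarrow> \<bar>0\<bar> ^ Suc q) (at 0)" by (intro tendsto_intros)
    then show "(\<lambda>h. \<bar>h\<bar> ^ Suc q) \<midarrow>0\<rightarrow> (0::real)" by simp
  qed
  then show ?thesis unfolding True by (simp add: DERIV_def)
next
  case False
  show ?thesis
  proof (cases "s > 0")
    case True
    have "((\<lambda>s::real. s ^ Suc (Suc q)) has_field_derivative real (Suc (Suc q)) * (max 0 s) ^ Suc q) (at s)"
      using True DERIV_pow[of "Suc (Suc q)" s UNIV] by (simp del: power_Suc of_nat_Suc)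
    then show ?thesis
      by (rule has_field_derivative_transform_within_open[where S = "{0<..}"]) (use True in auto)
  next
    case 2: False
    have "((\<lambda>s::real. 0) has_field_derivative real (Suc (Suc q)) * (max 0 s) ^ Suc q) (at s)"
      using 2 by (auto simp: max_def)
    then show ?thesis
      by (rule has_field_derivative_transform_within_open[where S = "{..<0}"]) (use 2 False in auto)
  qed
qed

lemma has_derivative_bump:
  "(bump c (Suc (Suc q)) has_derivative
     (\<lambda>h. - (2 * real (Suc (Suc q)) / c * bump c (Suc q) x * (x \<bullet> h)))) (at x)"
proof -
  have "((\<lambda>x. 1 - (x \<bullet> x) / c) has_derivative (\<lambda>h. - (2 * (x \<bullet> h) / c))) (at x)"
    unfolding divide_inverse by (auto intro!: derivative_eq_intros simp: inner_commute)
  from has_derivative_compose[OF this DERIV_max_power[THEN has_field_derivative_imp_has_derivative]]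
  show ?thesis unfolding bump_def[abs_def]
    by (rule has_derivative_eq_rhs) (simp add: fun_eq_iff mult_ac del: power_Suc of_nat_Suc)
qed

lemma continuous_on_bump [continuous_intros]:
  "continuous_on S f \<Longrightarrow> continuous_on S (\<lambda>x. bump c p (f x))"
  unfolding bump_def divide_inverse by (intro continuous_intros)

lemma bump_nonneg: "bump c p x \<ge> 0"
  by (simp add: bump_def)

lemma bump_eq_0: "c > 0 \<Longrightarrow> p > 0 \<Longrightarrow> norm x > sqrt c \<Longrightarrow> bump c p x = 0"
proof -
  assume "c > 0" "p > 0" "norm x > sqrt c"
  then have "c < (norm x)\<^sup>2" using real_sqrt_less_iff[of c "(norm x)\<^sup>2"] by simp
  then have "1 - (x \<bullet> x) / c < 0" using \<open>c > 0\<close> by (simp add: power2_norm_eq_inner)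
  then show ?thesis using \<open>p > 0\<close> by (simp add: bump_def)
qed

lemma integrable_bump_scaleR:
  fixes F :: "'m::finite rspace \<Rightarrow> 'b::euclidean_space"
  assumes "c > 0" "p > 0" "continuous_on UNIV F"
  shows "integrable lborel (\<lambda>x. bump c p x *\<^sub>R F x)"
proof -
  obtain a where a: "cball 0 (sqrt c) \<subseteq> cbox (- a) (a :: 'm rspace)"
    using bounded_subset_cbox_symmetric[OF bounded_cball] by metis
  show ?thesis
  proof (rule compact_support_integral(1)[where a = "- a" and b = a])
    show "continuous_on UNIV (\<lambda>x. bump c p x *\<^sub>R F x)"
      using assms(3) by (intro continuous_intros)
    fix x assume "x \<notin> cbox (- a) a"
    then have "norm x > sqrt c" using a by (meson mem_cball_0 not_le subsetD)
    then show "bump c p x *\<^sub>R F x = 0" using assms by (simp add: bump_eq_0)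
  qed
qed

section \<open>The mean value property\<close>

lemma continuously_differentiable_has_derivative:
  fixes g :: "'m::finite rspace \<Rightarrow> 'b::real_normed_vector"
  assumes "continuously_differentiable g"
  shows "(g has_derivative (\<lambda>h. \<Sum>j\<in>UNIV. h $ j *\<^sub>R partial_deriv j g x)) (at x)"
proof -
  obtain g' where g': "(g has_derivative g') (at x)"
    using assms by (auto simp: continuously_differentiable_def differentiable_def)
  have l: "linear g'" by (rule has_derivative_linear[OF g'])
  have "g' h = (\<Sum>j\<in>UNIV. h $ j *\<^sub>R partial_deriv j g x)" for h
  proof -
    have "g' h = g' (\<Sum>j\<in>UNIV. h $ j *\<^sub>R axis j 1)"
      using basis_expansion[of h] by (simp add: scalar_mult_eq_scaleR)
    then show ?thesis by (simp add: linear_sum[OF l] linear_cmul[OF l] partial_deriv_eq[OF g'])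
  qed
  then have "g' = (\<lambda>h. \<Sum>j\<in>UNIV. h $ j *\<^sub>R partial_deriv j g x)" by (rule ext)
  then show ?thesis using g' by simp
qed

lemma has_derivative_dilate:
  assumes "(g has_derivative g') (at (y + r *\<^sub>R x))"
  shows "((\<lambda>x. g (y + r *\<^sub>R x)) has_derivative (\<lambda>h. r *\<^sub>R g' h)) (at x)"
proof -
  have "((\<lambda>x. y + r *\<^sub>R x) has_derivative (\<lambda>h. r *\<^sub>R h)) (at x)"
    by (auto intro!: derivative_eq_intros)
  from has_derivative_compose[OF this assms] show ?thesis
    by (simp add: linear_cmul[OF has_derivative_linear[OF assms]])
qed

lemma axis_sum:
  fixes d :: "'m::finite \<Rightarrow> 'b::real_vector"
  shows "(\<Sum>i\<in>UNIV. axis j (1::real) $ i *\<^sub>R d i) = d j"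
proof -
  have "(\<Sum>i\<in>UNIV. axis j (1::real) $ i *\<^sub>R d i) = (\<Sum>i\<in>UNIV. if i = j then d j else 0)"
    by (intro sum.cong) (auto simp: axis_def)
  then show ?thesis by simp
qed

text \<open>
  The integral of \<open>\<phi>(x) g(y + rx)\<close> has derivative \<open>\<integral> \<phi>(x) x\<cdot>\<nabla>g(y + rx) dx\<close> in \<open>r\<close>. If this flux vanishes,
  the value at \<open>r = 1\<close> is the value at \<open>r = 0\<close>.
\<close>

lemma mean_value_bump:
  fixes g :: "'m::finite rspace \<Rightarrow> 'b::euclidean_space"
  assumes g: "continuously_differentiable g" and c: "c > 0" "p > 0"
    and flux: "\<And>r. 0 < r \<Longrightarrow> r \<le> 1 \<Longrightarrow>
      (LINT x|lborel. bump c p x *\<^sub>R (\<Sum>j\<in>UNIV. x $ j *\<^sub>R partial_deriv j g (y + r *\<^sub>R x))) = 0"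
  shows "(LINT x|lborel. bump c p x *\<^sub>R g (y + x)) = (LINT x|lborel. bump c p (x :: 'm rspace) *\<^sub>R g y)"
proof -
  define \<Psi> where "\<Psi> t = (LINT x|lborel. bump c p x *\<^sub>R g (y + t *\<^sub>R x))" for t
  define u' where "u' t x = bump c p x *\<^sub>R (\<Sum>j\<in>UNIV. x $ j *\<^sub>R partial_deriv j g (y + t *\<^sub>R x))" for t x
  have cg: "continuous_on UNIV g"
    using continuously_differentiable_has_derivative[OF g]
    by (meson has_derivative_continuous continuous_at_imp_continuous_on)
  have cd: "continuous_on UNIV (partial_deriv j g)" for j
    using g by (simp add: continuously_differentiable_def)
  obtain a where a: "cball 0 (sqrt c) \<subseteq> cbox (- a) (a :: 'm rspace)"
    using bounded_subset_cbox_symmetric[OF bounded_cball] by metis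
  have der: "(\<Psi> has_vector_derivative (LINT x|lborel. u' t x)) (at t within {0..1})" if "t \<in> {0..1}" for t
    unfolding \<Psi>_def
  proof (rule has_vector_derivative_integral_compact_support[where a = "- a" and b = a, OF _ _ _ _ that])
    fix t :: real and x :: "'m rspace"
    have "((\<lambda>t. y + t *\<^sub>R x) has_derivative (\<lambda>h. h *\<^sub>R x)) (at t within {0..1})"
      by (auto intro!: derivative_eq_intros)
    from has_derivative_compose[OF this continuously_differentiable_has_derivative[OF g]]
    have "((\<lambda>t. g (y + t *\<^sub>R x)) has_vector_derivative
       (\<Sum>j\<in>UNIV. x $ j *\<^sub>R partial_deriv j g (y + t *\<^sub>R x))) (at t within {0..1})"
      by (simp add: has_vector_derivative_def scaleR_sum_right)
    from bounded_linear.has_vector_derivative[OF bounded_linear_scaleR_right this]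
    show "((\<lambda>t. bump c p x *\<^sub>R g (y + t *\<^sub>R x)) has_vector_derivative u' t x) (at t within {0..1})"
      unfolding u'_def .
    have "continuous_on UNIV (\<lambda>x. g (y + t *\<^sub>R x))"
      by (rule continuous_on_compose2[OF cg]) (auto intro!: continuous_intros)
    then show "continuous_on UNIV (\<lambda>x. bump c p x *\<^sub>R g (y + t *\<^sub>R x))" by (intro continuous_intros)
    assume "x \<notin> cbox (- a) a"
    then have "norm x > sqrt c" using a by (meson mem_cball_0 not_le subsetD)
    then show "bump c p x *\<^sub>R g (y + t *\<^sub>R x) = 0 \<and> u' t x = 0"
      using c by (simp add: bump_eq_0 u'_def)
  next
    have "continuous_on UNIV (\<lambda>z :: real \<times> 'm rspace. partial_deriv j g (y + fst z *\<^sub>R snd z))" for j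
      by (rule continuous_on_compose2[OF cd]) (auto intro!: continuous_intros)
    then have "continuous_on UNIV (\<lambda>z. u' (fst z) (snd z))"
      unfolding u'_def by (intro continuous_intros)
    then show "continuous_on UNIV (\<lambda>(t, x). u' t x)" by (simp add: case_prod_unfold)
  qed
  \<comment> \<open>The flux is only known to vanish for \<open>r > 0\<close>; continuity covers the endpoint.\<close>
  have "\<Psi> 1 = \<Psi> 0"
  proof (rule has_derivative_zero_unique_strong_interval[where k = "{0}" and a = 0 and b = 1])
    show "continuous_on {0..1} \<Psi>"
      unfolding continuous_on_eq_continuous_within
      using has_vector_derivative_continuous[OF der] by blast
    fix t :: real assume t: "t \<in> {0..1} - {0}"
    then have "(LINT x|lborel. u' t x) = 0" unfolding u'_def by (intro flux) auto
    then show "(\<Psi> has_derivative (\<lambda>h. 0)) (at t within {0..1})"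
      using der[of t] t by (simp add: has_vector_derivative_def)
  qed auto
  then show ?thesis by (simp add: \<Psi>_def)
qed

text \<open>
  Since \<open>x \<phi>\<close> is a multiple of the gradient of a smoother bump \<open>\<Phi>\<close>, integration by parts turns the flux
  into the integral of \<open>\<Phi>\<close> against the Laplacian.
\<close>

lemma flux_harmonic:
  fixes g :: "'m::finite rspace \<Rightarrow> 'b::euclidean_space"
  assumes g: "harmonic g" and c: "c > 0"
  shows "(LINT x|lborel. bump c (Suc q) x *\<^sub>R (\<Sum>j\<in>UNIV. x $ j *\<^sub>R partial_deriv j g (y + r *\<^sub>R x))) = 0"
proof -
  define \<kappa> where "\<kappa> = 2 * real (Suc (Suc q)) / c"
  have \<kappa>: "\<kappa> > 0" using c by (simp add: \<kappa>_def)
  define A where "A j x = bump c (Suc q) x *\<^sub>R (x $ j *\<^sub>R partial_deriv j g (y + r *\<^sub>R x))" for j x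
  define B where "B j x = bump c (Suc (Suc q)) x *\<^sub>R partial_deriv j (partial_deriv j g) (y + r *\<^sub>R x)" for j x
  have cd: "continuously_differentiable (partial_deriv j g)" for j
    using g by (simp add: harmonic_def)
  have c1: "continuous_on UNIV (\<lambda>x. partial_deriv j g (y + r *\<^sub>R x))" for j
    by (rule continuous_on_compose2[of UNIV])
       (use g in \<open>auto simp: harmonic_def continuously_differentiable_def intro!: continuous_intros\<close>)
  have c2: "continuous_on UNIV (\<lambda>x. partial_deriv j (partial_deriv j g) (y + r *\<^sub>R x))" for j
    by (rule continuous_on_compose2[of UNIV])
       (use cd in \<open>auto simp: continuously_differentiable_def intro!: continuous_intros\<close>)
  have iA: "integrable lborel (A j)" for j
    unfolding A_def using c1 c by (intro integrable_bump_scaleR continuous_intros) auto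
  have iB: "integrable lborel (B j)" for j
    unfolding B_def using c2 c by (intro integrable_bump_scaleR) auto
  have AB: "r *\<^sub>R (LINT x|lborel. B j x) = \<kappa> *\<^sub>R (LINT x|lborel. A j x)" for j
  proof -
    define F' where "F' x h = bump c (Suc (Suc q)) x *\<^sub>R (r *\<^sub>R (\<Sum>i\<in>UNIV. h $ i *\<^sub>R partial_deriv i (partial_deriv j g) (y + r *\<^sub>R x)))
       + (- (\<kappa> * bump c (Suc q) x * (x \<bullet> h))) *\<^sub>R partial_deriv j g (y + r *\<^sub>R x)" for x h
    have e: "F' x (axis j 1) = r *\<^sub>R B j x - \<kappa> *\<^sub>R A j x" for x
      by (simp add: F'_def A_def B_def axis_sum inner_axis mult_ac)
    have "(LINT x|lborel. F' x (axis j 1)) = 0"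
    proof (rule integral_derivative_compact_support)
      show "((\<lambda>x. bump c (Suc (Suc q)) x *\<^sub>R partial_deriv j g (y + r *\<^sub>R x)) has_derivative F' x) (at x)" for x
        unfolding F'_def \<kappa>_def
        by (rule has_derivative_scaleR[OF has_derivative_bump
              has_derivative_dilate[OF continuously_differentiable_has_derivative[OF cd]]])
      show "continuous_on UNIV (\<lambda>x. F' x (axis j 1))"
        unfolding e A_def B_def using c1 c2 by (intro continuous_intros)
      show "bump c (Suc (Suc q)) x *\<^sub>R partial_deriv j g (y + r *\<^sub>R x) = 0 \<and> F' x (axis j 1) = 0" if "norm x > sqrt c" for x
        using that c by (simp add: F'_def bump_eq_0)
    qed
    then show ?thesis using iA[of j] iB[of j] unfolding e by simp
  qed
  have "\<kappa> *\<^sub>R (LINT x|lborel. (\<Sum>j\<in>UNIV. A j x)) = r *\<^sub>R (LINT x|lborel. (\<Sum>j\<in>UNIV. B j x))"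
    using iA iB by (simp add: Bochner_Integration.integral_sum scaleR_sum_right AB)
  also have "\<dots> = 0"
    using g by (simp add: B_def harmonic_def flip: scaleR_sum_right)
  finally have "(LINT x|lborel. (\<Sum>j\<in>UNIV. A j x)) = 0" using \<kappa> by simp
  then show ?thesis by (simp add: A_def scaleR_sum_right)
qed

text \<open>
  Only first derivatives are at hand. Integration by parts turns \<open>S j k = \<integral> \<phi> x\<^sub>j \<partial>\<^sub>k g\<close> into a multiple of
  \<open>\<integral> x\<^sub>j x\<^sub>k \<psi> g\<close> for \<open>j \<noteq> k\<close>, with a bump \<open>\<psi>\<close> of lower exponent, which is symmetric. The integral of \<open>\<phi> x (\<partial>g)\<close> is zero, and equals
  \<open>\<Sum>\<^sub>j\<^sub>k e\<^sub>j e\<^sub>k S j k\<close>; for symmetric \<open>S\<close> this sum reduces to minus the flux \<open>\<Sum>\<^sub>j S j j\<close>.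
\<close>

lemma flux_monogenic:
  fixes g :: "'m rspace \<Rightarrow> 'm::{finite,linorder} clifford"
  assumes g: "monogenic g" and c: "c > 0" and r: "r > 0"
  shows "(LINT x|lborel. bump c (Suc (Suc q)) x *\<^sub>R (\<Sum>j\<in>UNIV. x $ j *\<^sub>R partial_deriv j g (y + r *\<^sub>R x))) = 0"
proof -
  define \<kappa> where "\<kappa> = 2 * real (Suc (Suc q)) / c"
  define A where "A j k x = bump c (Suc (Suc q)) x *\<^sub>R (x $ j *\<^sub>R partial_deriv k g (y + r *\<^sub>R x))" for j k x
  define B where "B j k x = bump c (Suc q) x *\<^sub>R ((x $ j * x $ k) *\<^sub>R g (y + r *\<^sub>R x))" for j k x
  define S where "S j k = (LINT x|lborel. A j k x)" for j k
  have cd: "continuously_differentiable g" using g by (simp add: monogenic_def)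
  have c0: "continuous_on UNIV (\<lambda>x. g (y + r *\<^sub>R x))"
    using has_derivative_dilate[OF continuously_differentiable_has_derivative[OF cd]]
    by (meson has_derivative_continuous continuous_at_imp_continuous_on)
  have c1: "continuous_on UNIV (\<lambda>x. partial_deriv j g (y + r *\<^sub>R x))" for j
    by (rule continuous_on_compose2[of UNIV])
       (use cd in \<open>auto simp: continuously_differentiable_def intro!: continuous_intros\<close>)
  have iA: "integrable lborel (A j k)" for j k
    unfolding A_def using c1 c by (intro integrable_bump_scaleR continuous_intros) auto
  have iB: "integrable lborel (B j k)" for j k
    unfolding B_def using c0 c by (intro integrable_bump_scaleR continuous_intros) auto
  have AB: "r *\<^sub>R S j k = \<kappa> *\<^sub>R (LINT x|lborel. B j k x)" if jk: "j \<noteq> k" for j k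
  proof -
    define F' where "F' x h = (bump c (Suc (Suc q)) x * x $ j) *\<^sub>R (r *\<^sub>R (\<Sum>i\<in>UNIV. h $ i *\<^sub>R partial_deriv i g (y + r *\<^sub>R x)))
       + (bump c (Suc (Suc q)) x * h $ j + (- (\<kappa> * bump c (Suc q) x * (x \<bullet> h))) * x $ j) *\<^sub>R g (y + r *\<^sub>R x)" for x h
    have e: "F' x (axis k 1) = r *\<^sub>R A j k x - \<kappa> *\<^sub>R B j k x" for x
      using jk by (simp add: F'_def A_def B_def axis_sum inner_axis mult_ac) (simp add: axis_def)
    have "(LINT x|lborel. F' x (axis k 1)) = 0"
    proof (rule integral_derivative_compact_support)
      show "((\<lambda>x. (bump c (Suc (Suc q)) x * x $ j) *\<^sub>R g (y + r *\<^sub>R x)) has_derivative F' x) (at x)" for x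
        unfolding F'_def \<kappa>_def
        by (rule has_derivative_scaleR[OF has_derivative_mult[OF has_derivative_bump
              bounded_linear_imp_has_derivative[OF bounded_linear_vec_nth]]
              has_derivative_dilate[OF continuously_differentiable_has_derivative[OF cd]]])
      show "continuous_on UNIV (\<lambda>x. F' x (axis k 1))"
        unfolding e A_def B_def using c0 c1 by (intro continuous_intros)
      show "(bump c (Suc (Suc q)) x * x $ j) *\<^sub>R g (y + r *\<^sub>R x) = 0 \<and> F' x (axis k 1) = 0" if "norm x > sqrt c" for x
        using that c by (simp add: F'_def bump_eq_0)
    qed
    then show ?thesis using iA[of j k] iB[of j k] unfolding e S_def by simp
  qed
  \<comment> \<open>Here \<open>r \<noteq> 0\<close> is needed to cancel the chain rule factor.\<close>
  have sym: "S j k = S k j" for j k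
  proof (cases "j = k")
    case False
    have "B j k = B k j" by (simp add: B_def fun_eq_iff mult.commute)
    then have "r *\<^sub>R S j k = r *\<^sub>R S k j" using AB[of j k] AB[of k j] False by simp
    then show ?thesis using r by simp
  qed simp
  have "(\<Sum>j\<in>UNIV. \<Sum>k\<in>UNIV. cl_e j \<odot> (cl_e k \<odot> A j k x)) = 0" for x
  proof -
    have "(\<Sum>j\<in>UNIV. \<Sum>k\<in>UNIV. cl_e j \<odot> (cl_e k \<odot> A j k x))
        = (\<Sum>j\<in>UNIV. (bump c (Suc (Suc q)) x * x $ j) *\<^sub>R (cl_e j \<odot> dirac g (y + r *\<^sub>R x)))"
      by (simp add: A_def dirac_def cl.scaleR_right cl.sum_right scaleR_sum_right)
    then show ?thesis using g by (simp add: monogenic_def cl.zero_right)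
  qed
  then have "(LINT x|lborel. (\<Sum>j\<in>UNIV. \<Sum>k\<in>UNIV. cl_e j \<odot> (cl_e k \<odot> A j k x))) = 0" by simp
  moreover have "integrable lborel (\<lambda>x. cl_e j \<odot> (cl_e k \<odot> A j k x))" for j k
    by (intro integrable_bounded_linear[OF cl.bounded_linear_right] iA)
  ultimately have 0: "(\<Sum>j\<in>UNIV. \<Sum>k\<in>UNIV. cl_e j \<odot> (cl_e k \<odot> S j k)) = 0"
    by (simp add: Bochner_Integration.integral_sum S_def iA
        integral_bounded_linear[OF cl.bounded_linear_right]
        integrable_bounded_linear[OF cl.bounded_linear_right])
  have "(\<Sum>j\<in>UNIV. \<Sum>k\<in>UNIV. cl_e j \<odot> (cl_e k \<odot> S j k)) + (\<Sum>j\<in>UNIV. \<Sum>k\<in>UNIV. cl_e k \<odot> (cl_e j \<odot> S j k)) = 0"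
  proof -
    have "(\<Sum>j\<in>UNIV. \<Sum>k\<in>UNIV. cl_e k \<odot> (cl_e j \<odot> S j k)) = (\<Sum>k\<in>UNIV. \<Sum>j\<in>UNIV. cl_e k \<odot> (cl_e j \<odot> S k j))"
      by (subst sum.swap) (simp add: sym)
    then show ?thesis using 0 by simp
  qed
  then have "(\<Sum>j\<in>UNIV. \<Sum>k\<in>UNIV. if j = k then - (2 *\<^sub>R S j k) else 0) = 0"
    by (simp only: sum.distrib[symmetric] cl_e_anticommute_mult)
  then have "(\<Sum>j\<in>UNIV. S j j) = 0" by (simp add: sum_negf flip: scaleR_sum_right)
  then have "(LINT x|lborel. (\<Sum>j\<in>UNIV. A j j x)) = 0"
    using iA by (simp add: Bochner_Integration.integral_sum S_def)
  then show ?thesis by (simp add: A_def scaleR_sum_right)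
qed

text \<open>
  The bumps \<open>(1 - |x|\<^sup>2/(2n))\<^sub>+\<^sup>n\<close> tend to \<open>exp(-|x|\<^sup>2/2)\<close> and are dominated by it, because \<open>1 - s \<le> exp(-s)\<close>.
\<close>

lemma mean_value_gaussian:
  fixes g :: "'m::finite rspace \<Rightarrow> 'b::euclidean_space"
  assumes g: "continuous_on UNIV g"
    and int: "integrable lborel (\<lambda>x. exp (- (norm x)\<^sup>2 / 2) *\<^sub>R g (y + x))"
    and mv: "\<And>n. n \<ge> 2 \<Longrightarrow> (LINT x|lborel. bump (2 * real n) n x *\<^sub>R g (y + x)) = (LINT x|lborel. bump (2 * real n) n (x :: 'm rspace) *\<^sub>R g y)"
  shows "(LINT x|lborel. exp (- (norm x)\<^sup>2 / 2) *\<^sub>R g (y + x)) = ((2 * pi) powr (real CARD('m) / 2)) *\<^sub>R g y"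
proof -
  \<comment> \<open>The shift by 2 stays in the range where the mean value identity is available.\<close>
  define b :: "nat \<Rightarrow> 'm rspace \<Rightarrow> real" where "b n = bump (2 * real (n + 2)) (n + 2)" for n
  have lim: "(\<lambda>n. b n x) \<longlonglongrightarrow> exp (- (norm x)\<^sup>2 / 2)" for x
  proof -
    define s where "s = - (norm x)\<^sup>2 / 2"
    have "(\<lambda>n. (1 + s / real n) ^ n) \<longlonglongrightarrow> exp s" by (rule tendsto_exp_limit_sequentially)
    moreover have "\<forall>\<^sub>F n in sequentially. (1 + s / real n) ^ n = bump (2 * real n) n x"
    proof -
      obtain N where N: "real N \<ge> - s" "N > 0"
        using real_arch_simple[of "max 1 (- s)"] by (metis less_le_trans max.bounded_iff of_nat_0_less_iff zero_less_one)
      have "(1 + s / real n) ^ n = bump (2 * real n) n x" if "n \<ge> N" for n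
      proof -
        have "n > 0" "- s \<le> real n" using N that by linarith+
        then have "1 + s / real n \<ge> 0" by (simp add: field_simps)
        moreover have "1 - (x \<bullet> x) / (2 * real n) = 1 + s / real n"
          by (simp add: s_def power2_norm_eq_inner)
        ultimately show ?thesis by (simp only: bump_def max_absorb2)
      qed
      then show ?thesis by (auto simp: eventually_sequentially)
    qed
    ultimately have "(\<lambda>n. bump (2 * real n) n x) \<longlonglongrightarrow> exp s" by (rule Lim_transform_eventually)
    from LIMSEQ_ignore_initial_segment[OF this, of 2] show ?thesis by (simp add: b_def s_def)
  qed
  have le: "b n x \<le> exp (- (norm x)\<^sup>2 / 2)" for n x
  proof -
    define k where "k = n + 2"
    have k: "k > 0" by (simp add: k_def)
    have "max 0 (1 - (x \<bullet> x) / (2 * real k)) \<le> exp (- (x \<bullet> x) / (2 * real k))"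
      using exp_ge_add_one_self[of "- (x \<bullet> x) / (2 * real k)"] by simp
    then have "bump (2 * real k) k x \<le> exp (- (x \<bullet> x) / (2 * real k)) ^ k"
      unfolding bump_def by (intro power_mono) auto
    also have "\<dots> = exp (- (norm x)\<^sup>2 / 2)"
      unfolding exp_of_nat_mult[symmetric] using k by (simp add: power2_norm_eq_inner)
    finally show ?thesis by (simp add: b_def k_def)
  qed
  have conv: "(\<lambda>n. LINT x|lborel. b n x *\<^sub>R h x) \<longlonglongrightarrow> (LINT x|lborel. exp (- (norm x)\<^sup>2 / 2) *\<^sub>R h x)"
    if h: "continuous_on UNIV h" and i: "integrable lborel (\<lambda>x. exp (- (norm x)\<^sup>2 / 2) *\<^sub>R h x)"
    for h :: "'m rspace \<Rightarrow> 'b"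
  proof (rule integral_dominated_convergence)
    show "integrable lborel (\<lambda>x. norm (exp (- (norm x)\<^sup>2 / 2) *\<^sub>R h x))" by (rule integrable_norm[OF i])
    show "(\<lambda>x. exp (- (norm x)\<^sup>2 / 2) *\<^sub>R h x) \<in> borel_measurable lborel" by (rule borel_measurable_integrable[OF i])
    show "(\<lambda>x. b n x *\<^sub>R h x) \<in> borel_measurable lborel" for n
      unfolding b_def by (intro borel_measurable_integrable integrable_bump_scaleR h) auto
    show "AE x in lborel. (\<lambda>n. b n x *\<^sub>R h x) \<longlonglongrightarrow> exp (- (norm x)\<^sup>2 / 2) *\<^sub>R h x"
      by (intro AE_I2 tendsto_scaleR lim tendsto_const)
    show "AE x in lborel. norm (b n x *\<^sub>R h x) \<le> norm (exp (- (norm x)\<^sup>2 / 2) *\<^sub>R h x)" for n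
      using le[of n] by (intro AE_I2) (simp add: b_def bump_nonneg mult_right_mono)
  qed
  have "continuous_on UNIV (\<lambda>x. g (y + x))"
    by (rule continuous_on_compose2[OF g]) (auto intro!: continuous_intros)
  note lim_g = conv[OF this int]
  have "(LINT x|lborel. b n x *\<^sub>R g (y + x)) = (LINT x|lborel. b n x *\<^sub>R g y)" for n
    unfolding b_def by (rule mv) simp
  with lim_g have "(\<lambda>n. LINT x|lborel. b n x *\<^sub>R g y) \<longlonglongrightarrow> (LINT x|lborel. exp (- (norm x)\<^sup>2 / 2) *\<^sub>R g (y + x))"
    by (simp only:)
  moreover have "(\<lambda>n. LINT x|lborel. b n x *\<^sub>R g y) \<longlonglongrightarrow> (LINT x|lborel. exp (- (norm (x :: 'm rspace))\<^sup>2 / 2) *\<^sub>R g y)"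
    using gaussian_integral(1) by (intro conv continuous_on_const integrable_scaleR_left)
  ultimately have "(LINT x|lborel. exp (- (norm x)\<^sup>2 / 2) *\<^sub>R g (y + x)) = (LINT x|lborel. exp (- (norm (x :: 'm rspace))\<^sup>2 / 2) *\<^sub>R g y)"
    by (rule LIMSEQ_unique)
  also have "\<dots> = (LINT x|lborel. exp (- (norm (x :: 'm rspace))\<^sup>2 / 2)) *\<^sub>R g y"
    using gaussian_integral(1) by (intro integral_scaleR_left)
  finally show ?thesis by (simp only: gaussian_integral(2))
qed

section \<open>The transform reproduces harmonic and monogenic functions\<close>

lemma lborel_integrable_translate:
  fixes F :: "'a::euclidean_space \<Rightarrow> 'b::{banach,second_countable_topology}"
  assumes "integrable lborel F"
  shows "integrable lborel (\<lambda>x. F (c + x))"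
proof -
  have "integrable (distr lborel borel ((+) c)) F" using assms by (simp add: lborel_distr_plus)
  then show ?thesis using borel_measurable_integrable[OF assms] by (subst (asm) integrable_distr_eq) auto
qed

lemma segal_bargmann_real_kernel:
  fixes x y :: "'m::finite rspace" and a :: "complex ^ 'n::finite"
  shows "exp (- cdot (complexify y) (complexify y) / 2 + cdot (complexify x) (complexify y)
     - cdot (complexify x) (complexify x) / 4) *s (exp (- (norm x)\<^sup>2 / 4) *\<^sub>R a)
   = exp (- (norm (x - y))\<^sup>2 / 2) *\<^sub>R a"
proof -
  have c: "cdot (complexify x) (complexify y) = of_real (x \<bullet> y)" for x y :: "'m rspace"
    by (simp add: cdot_def complexify_def inner_vec_def)
  have "- cdot (complexify y) (complexify y) / 2 + cdot (complexify x) (complexify y)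
     - cdot (complexify x) (complexify x) / 4 = of_real (- (y \<bullet> y) / 2 + x \<bullet> y - (x \<bullet> x) / 4)"
    by (simp add: c)
  moreover have "exp (- (y \<bullet> y) / 2 + x \<bullet> y - (x \<bullet> x) / 4) * exp (- (norm x)\<^sup>2 / 4) = exp (- (norm (x - y))\<^sup>2 / 2)"
    by (simp add: power2_norm_eq_inner inner_diff inner_commute algebra_simps add_divide_distrib
        diff_divide_distrib flip: exp_add)
  ultimately show ?thesis by (simp only: exp_of_real of_real_smult scaleR_scaleR)
qed

text \<open>
  At a real point \<open>y\<close> the transform is the Gaussian mean of \<open>g\<close> around \<open>y\<close>. So the transform, which is
  entire, extends \<open>g\<close>; in particular \<open>g\<close> is real analytic.
\<close>

lemma segal_bargmann_reproduces:
  fixes f g :: "'m rspace \<Rightarrow> 'm::{finite,linorder} clifford"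
  assumes f: "\<And>x. f x = exp (- (norm x)\<^sup>2 / 4) *\<^sub>R g x"
    and w: "admissible_weight (\<lambda>x. exp (- (norm x)\<^sup>2 / 2) *\<^sub>R g x)"
    and g: "continuous_on UNIV g"
    and mv: "\<And>n y. n \<ge> 2 \<Longrightarrow> (LINT x|lborel. bump (2 * real n) n x *\<^sub>R g (y + x))
       = (LINT x|lborel. bump (2 * real n) n (x :: 'm rspace) *\<^sub>R g y)"
  shows "segal_bargmann f (complexify y) = g y"
proof -
  define F where "F x = exp (- (norm (x - y))\<^sup>2 / 2) *\<^sub>R g x" for x
  have kernel: "exp (- cdot (complexify y) (complexify y) / 2 + cdot (complexify x) (complexify y)
     - cdot (complexify x) (complexify x) / 4) *s f x = F x" for x
    unfolding f F_def by (rule segal_bargmann_real_kernel)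
  have bF: "F \<in> borel_measurable borel"
    unfolding F_def by (intro borel_measurable_continuous_onI continuous_intros g) auto
  then have mF: "F \<in> borel_measurable lborel" by simp
  have "integrable lebesgue F"
    using segal_bargmann_integrable[OF f w, of "complexify y"] unfolding kernel .
  then have iF: "integrable lborel F" using integrable_completion[OF mF] by simp
  have Fy: "F (y + x) = exp (- (norm x)\<^sup>2 / 2) *\<^sub>R g (y + x)" for x by (simp add: F_def)
  have "(LINT x|lebesgue. F x) = (LINT x|lborel. F (y + x))"
    by (simp add: integral_completion[OF mF] lborel_integral_translate[OF bF])
  also have "\<dots> = ((2 * pi) powr (real CARD('m) / 2)) *\<^sub>R g y"
    unfolding Fy
  proof (rule mean_value_gaussian[OF g _ mv])
    show "integrable lborel (\<lambda>x. exp (- (norm x)\<^sup>2 / 2) *\<^sub>R g (y + x))"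
      using lborel_integrable_translate[OF iF, of y] unfolding Fy .
  qed
  finally show ?thesis unfolding segal_bargmann_def kernel by simp
qed

lemma continuously_differentiable_imp_continuous:
  fixes g :: "'m::finite rspace \<Rightarrow> 'b::real_normed_vector"
  shows "continuously_differentiable g \<Longrightarrow> continuous_on UNIV g"
  using continuously_differentiable_has_derivative
  by (meson has_derivative_continuous continuous_at_imp_continuous_on)

lemma mean_value_harmonic:
  fixes g :: "'m::finite rspace \<Rightarrow> 'b::euclidean_space"
  assumes "harmonic g" "n \<ge> 2"
  shows "(LINT x|lborel. bump (2 * real n) n x *\<^sub>R g (y + x))
       = (LINT x|lborel. bump (2 * real n) n (x :: 'm rspace) *\<^sub>R g y)"
proof (rule mean_value_bump)
  show "continuously_differentiable g" using assms by (simp add: harmonic_def)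
  obtain q where n: "n = Suc q" using assms(2) by (cases n) auto
  show "(LINT x|lborel. bump (2 * real n) n x *\<^sub>R (\<Sum>j\<in>UNIV. x $ j *\<^sub>R partial_deriv j g (y + r *\<^sub>R x))) = 0" for r
    unfolding n by (rule flux_harmonic[OF assms(1)]) simp
qed (use assms in auto)

lemma mean_value_monogenic:
  fixes g :: "'m rspace \<Rightarrow> 'm::{finite,linorder} clifford"
  assumes "monogenic g" "n \<ge> 2"
  shows "(LINT x|lborel. bump (2 * real n) n x *\<^sub>R g (y + x))
       = (LINT x|lborel. bump (2 * real n) n (x :: 'm rspace) *\<^sub>R g y)"
proof (rule mean_value_bump)
  show "continuously_differentiable g" using assms by (simp add: monogenic_def)
  obtain q where n: "n = Suc (Suc q)" using assms(2) by (metis add_2_eq_Suc le_Suc_ex)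
  show "(LINT x|lborel. bump (2 * real n) n x *\<^sub>R (\<Sum>j\<in>UNIV. x $ j *\<^sub>R partial_deriv j g (y + r *\<^sub>R x))) = 0"
    if "r > 0" for r
    unfolding n by (rule flux_monogenic[OF assms(1) _ that]) simp
qed (use assms in auto)

section \<open>Iterated derivatives at the origin\<close>

lemma pdiff_pow:
  "(pdiff j ^^ n) c \<beta> = (fact (\<beta> j + n) / fact (\<beta> j)) *\<^sub>R c (\<beta>(j := \<beta> j + n))"
proof (induction n arbitrary: \<beta>)
  case (Suc n)
  have "(pdiff j ^^ Suc n) c \<beta> = real (Suc (\<beta> j)) *\<^sub>R (pdiff j ^^ n) c (inc j \<beta>)"
    by (simp add: pdiff_def)
  also have "\<dots> = (real (Suc (\<beta> j)) * (fact (Suc (\<beta> j) + n) / fact (Suc (\<beta> j)))) *\<^sub>R c ((inc j \<beta>)(j := Suc (\<beta> j) + n))"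
    unfolding Suc.IH inc_same scaleR_scaleR ..
  also have "real (Suc (\<beta> j)) * (fact (Suc (\<beta> j) + n) / fact (Suc (\<beta> j))) = fact (\<beta> j + Suc n) / fact (\<beta> j)"
    unfolding fact_Suc[of "\<beta> j"] by (simp del: fact_Suc of_nat_Suc)
  also have "(inc j \<beta>)(j := Suc (\<beta> j) + n) = \<beta>(j := \<beta> j + Suc n)"
    by (auto simp: inc_def)
  finally show ?case .
qed simp

lemma foldr_pdiff:
  assumes "distinct js" "\<And>j. j \<in> set js \<Longrightarrow> \<beta> j = 0"
  shows "foldr (\<lambda>j. pdiff j ^^ \<alpha> j) js c \<beta>
    = (\<Prod>j\<in>set js. fact (\<alpha> j)) *\<^sub>R c (\<lambda>i. if i \<in> set js then \<alpha> i else \<beta> i)"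
  using assms
proof (induction js arbitrary: \<beta>)
  case (Cons j js)
  have "foldr (\<lambda>j. pdiff j ^^ \<alpha> j) (j # js) c \<beta>
      = fact (\<alpha> j) *\<^sub>R foldr (\<lambda>j. pdiff j ^^ \<alpha> j) js c (\<beta>(j := \<alpha> j))"
    using Cons.prems by (simp add: pdiff_pow)
  also have "foldr (\<lambda>j. pdiff j ^^ \<alpha> j) js c (\<beta>(j := \<alpha> j))
      = (\<Prod>j\<in>set js. fact (\<alpha> j)) *\<^sub>R c (\<lambda>i. if i \<in> set js then \<alpha> i else (\<beta>(j := \<alpha> j)) i)"
    using Cons.prems by (intro Cons.IH) auto
  also have "(\<lambda>i. if i \<in> set js then \<alpha> i else (\<beta>(j := \<alpha> j)) i) = (\<lambda>i. if i \<in> set (j # js) then \<alpha> i else \<beta> i)"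
    by auto
  finally show ?case using Cons.prems(1) by simp
qed simp

lemma partial_deriv_multi_pseries_0:
  assumes "rapid c"
  shows "partial_deriv_multi \<alpha> (\<lambda>x. pseries c (complexify x)) 0 = (\<Prod>j\<in>UNIV. fact (\<alpha> j)) *\<^sub>R c \<alpha>"
proof -
  have pow: "rapid ((pdiff j ^^ n) c) \<and> (partial_deriv j ^^ n) (\<lambda>x. pseries c (complexify x))
      = (\<lambda>x. pseries ((pdiff j ^^ n) c) (complexify x))" if "rapid c" for j n and c :: "'a coeffs"
    using that by (induction n) (auto intro: rapid_pdiff simp: partial_deriv_pseries)
  have fold: "rapid (foldr (\<lambda>j. pdiff j ^^ \<alpha> j) js c) \<and>
      foldr (\<lambda>j. partial_deriv j ^^ \<alpha> j) js (\<lambda>x. pseries c (complexify x))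
      = (\<lambda>x. pseries (foldr (\<lambda>j. pdiff j ^^ \<alpha> j) js c) (complexify x))" for js
    by (induction js) (use assms pow in auto)
  let ?js = "sorted_list_of_set (UNIV :: 'a set)"
  have z: "complexify 0 = (0 :: 'a cspace)" by (simp add: complexify_def vec_eq_iff)
  have "partial_deriv_multi \<alpha> (\<lambda>x. pseries c (complexify x)) 0 = foldr (\<lambda>j. pdiff j ^^ \<alpha> j) ?js c (\<lambda>_. 0)"
    using fold[of ?js] by (simp add: partial_deriv_multi_def pseries_0 z)
  also have "\<dots> = (\<Prod>j\<in>UNIV. fact (\<alpha> j)) *\<^sub>R c \<alpha>"
    by (subst foldr_pdiff) auto
  finally show ?thesis .
qed

section \<open>The Fischer inner product with the kernel\<close>

lemma power_series_coeff_eq: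
  fixes R :: "'m rspace \<Rightarrow> 'm::{finite,linorder} clifford"
  assumes "is_power_series_coeff R r"
  shows "power_series_coeff R = r"
  unfolding power_series_coeff_def
proof (rule the_equality)
  show "is_power_series_coeff R r" by (rule assms)
  have sums: "\<forall>\<^sub>F x in nhds 0. (\<lambda>k. reval k s x) sums R x" if "is_power_series_coeff R s" for s
    using that unfolding is_power_series_coeff_def
  proof eventually_elim
    case (elim x)
    from has_sum_imp_sums_degree[OF this] show ?case by (simp add: reval_def mon_def)
  qed
  fix s assume "is_power_series_coeff R s"
  from expansion_coeff_unique[OF sums[OF this] sums[OF assms]] show "s = r" by blast
qed

lemma fourier_borel_has_sum:
  fixes z :: "'m::{finite,linorder} cspace"
  shows "((\<lambda>\<alpha>. hcoef 0 u \<alpha> *\<^sub>R mono_proj \<alpha> z) has_sum fourier_borel z u) UNIV"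
proof -
  define r where "r = norm z * proj_const TYPE('m)"
  have r: "r \<ge> 0" using proj_const_ge_1[where 'm = 'm] by (simp add: r_def)
  have "(\<lambda>\<alpha>. norm (hcoef 0 u \<alpha> *\<^sub>R mono_proj \<alpha> z)) summable_on UNIV"
  proof (rule summable_on_comparison_test)
    show "(\<lambda>\<alpha>. hcoef \<bar>0\<bar> (absv u) \<alpha> * r ^ deg \<alpha>) summable_on UNIV"
      using majorant_has_sum has_sum_imp_summable by blast
    show "norm (hcoef 0 u \<alpha> *\<^sub>R mono_proj \<alpha> z) \<le> hcoef \<bar>0\<bar> (absv u) \<alpha> * r ^ deg \<alpha>" for \<alpha>
      using abs_hcoef_le[of 0 u \<alpha>] norm_mono_proj_le[of \<alpha> z] by (simp add: r_def mult_mono)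
  qed simp
  from has_sum_infsum[OF abs_summable_summable[OF this]]
  have *: "((\<lambda>\<alpha>. hcoef 0 u \<alpha> *\<^sub>R mono_proj \<alpha> z) has_sum infsum (\<lambda>\<alpha>. hcoef 0 u \<alpha> *\<^sub>R mono_proj \<alpha> z) UNIV) UNIV" .
  from sums_unique2[OF has_sum_imp_sums_degree[OF this] fourier_borel_sums] * show ?thesis by simp
qed

lemma power_series_coeff_fourier_borel:
  "power_series_coeff (\<lambda>x. cl_hconj (fourier_borel z x))
    = (\<lambda>\<alpha>. cl_hconj ((1 / (\<Prod>j\<in>UNIV. fact (\<alpha> j))) *\<^sub>R mono_proj \<alpha> z))"
proof (rule power_series_coeff_eq)
  have "((\<lambda>\<alpha>. mon x \<alpha> *\<^sub>R cl_hconj ((1 / (\<Prod>j\<in>UNIV. fact (\<alpha> j))) *\<^sub>R mono_proj \<alpha> z))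
      has_sum cl_hconj (fourier_borel z x)) UNIV" for x
    using has_sum_bounded_linear[OF bounded_linear_cl_hconj fourier_borel_has_sum[of x z]]
    by (simp add: o_def hcoef_0_left linear_cmul[OF bounded_linear.linear[OF bounded_linear_cl_hconj]])
  then show "is_power_series_coeff (\<lambda>x. cl_hconj (fourier_borel z x))
      (\<lambda>\<alpha>. cl_hconj ((1 / (\<Prod>j\<in>UNIV. fact (\<alpha> j))) *\<^sub>R mono_proj \<alpha> z))"
    by (simp add: is_power_series_coeff_def mon_def)
qed

lemma rapid_abs_summable:
  fixes c :: "'m::{finite,linorder} coeffs"
  assumes "rapid c" "r \<ge> 0"
  shows "(\<lambda>\<alpha>. r ^ deg \<alpha> * norm (c \<alpha>)) summable_on UNIV"
proof (rule nonneg_bdd_above_summable_on)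
  have s: "summable (\<lambda>k. r ^ k * cnorm k c)" using assms by (simp add: rapid_def)
  show "bdd_above (sum (\<lambda>\<alpha>. r ^ deg \<alpha> * norm (c \<alpha>)) ` {F. F \<subseteq> UNIV \<and> finite F})"
  proof (intro bdd_aboveI2[where M = "\<Sum>k. r ^ k * cnorm k c"])
    fix F :: "('m \<Rightarrow> nat) set" assume "F \<in> {F. F \<subseteq> UNIV \<and> finite F}"
    then have fin: "finite F" by simp
    define N where "N = Max (insert 0 (deg ` F))"
    have N: "deg \<alpha> \<le> N" if "\<alpha> \<in> F" for \<alpha>
      unfolding N_def using fin that by (intro Max_ge) auto
    have "(\<Sum>\<alpha>\<in>F. r ^ deg \<alpha> * norm (c \<alpha>)) \<le> (\<Sum>\<alpha>\<in>(\<Union>k\<le>N. multi_indices k). r ^ deg \<alpha> * norm (c \<alpha>))"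
      using N assms(2) by (intro sum_mono2) (auto simp: multi_indices_iff)
    also have "\<dots> = (\<Sum>k\<le>N. \<Sum>\<alpha>\<in>multi_indices k. r ^ deg \<alpha> * norm (c \<alpha>))"
      by (rule sum.UNION_disjoint) (auto simp: multi_indices_iff)
    also have "\<dots> = (\<Sum>k\<le>N. r ^ k * cnorm k c)"
      by (simp add: cnorm_def sum_distrib_left multi_indices_iff)
    also have "\<dots> \<le> (\<Sum>k. r ^ k * cnorm k c)"
      using s assms(2) by (intro sum_le_suminf) auto
    finally show "(\<Sum>\<alpha>\<in>F. r ^ deg \<alpha> * norm (c \<alpha>)) \<le> (\<Sum>k. r ^ k * cnorm k c)" .
  qed
qed (use assms in simp)

text \<open>
  The factorials of the iterated derivatives cancel those of the kernel, and \<open>\<Sum>\<^sub>\<beta> M(z\<^sup>\<beta>) c\<^sub>\<beta>\<close> remains.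
\<close>

lemma fischer_inner_fourier_borel:
  fixes c :: "'m::{finite,linorder} coeffs"
  assumes c: "rapid c"
  shows "fischer_inner (\<lambda>x. cl_hconj (fourier_borel z x)) (\<lambda>x. pseries c (complexify x))
    = pseries (monogenic_coeffs c) z"
proof -
  define r where "r = norm z * proj_const TYPE('m)"
  have r: "r \<ge> 0" using proj_const_ge_1[where 'm = 'm] by (simp add: r_def)
  have term_eq: "cl_hconj (power_series_coeff (\<lambda>x. cl_hconj (fourier_borel z x)) \<alpha>)
      \<odot> partial_deriv_multi \<alpha> (\<lambda>x. pseries c (complexify x)) 0 = mono_proj \<alpha> z \<odot> c \<alpha>" for \<alpha>
    by (simp add: power_series_coeff_fourier_borel partial_deriv_multi_pseries_0[OF c]
        cl.scaleR_left cl.scaleR_right)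
  have "(\<lambda>\<alpha>. norm (mono_proj \<alpha> z \<odot> c \<alpha>)) summable_on UNIV"
  proof (rule summable_on_comparison_test)
    show "(\<lambda>\<alpha>. cl_const TYPE('m) * (r ^ deg \<alpha> * norm (c \<alpha>))) summable_on UNIV"
      by (intro summable_on_cmult_right rapid_abs_summable c r)
    fix \<alpha>
    have "norm (mono_proj \<alpha> z \<odot> c \<alpha>) \<le> cl_const TYPE('m) * norm (mono_proj \<alpha> z) * norm (c \<alpha>)"
      by (rule norm_cl_mult_le)
    also have "\<dots> \<le> cl_const TYPE('m) * r ^ deg \<alpha> * norm (c \<alpha>)"
      using norm_mono_proj_le[of \<alpha> z] cl_const_pos[where 'm = 'm]
      by (intro mult_right_mono mult_left_mono) (auto simp: r_def)
    finally show "norm (mono_proj \<alpha> z \<odot> c \<alpha>) \<le> cl_const TYPE('m) * (r ^ deg \<alpha> * norm (c \<alpha>))"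
      by (simp add: mult.assoc)
  qed simp
  from has_sum_imp_sums_degree[OF has_sum_infsum[OF abs_summable_summable[OF this]]]
  have "(\<lambda>k. ceval k (monogenic_coeffs c) z) sums (\<Sum>\<^sub>\<infinity>\<alpha>. mono_proj \<alpha> z \<odot> c \<alpha>)"
    by (simp add: ceval_monogenic_coeffs_eq_sum)
  from sums_unique2[OF this pseries_sums[OF rapid_monogenic_coeffs[OF c]]]
  show ?thesis by (simp add: fischer_inner_def term_eq)
qed

section \<open>Monogenic functions\<close>

lemma fdirac_restr: "fdirac (restr (Suc k) c) = restr k (fdirac c)"
  by (auto simp: fun_eq_iff fdirac_def restr_def cl.zero_right)

lemma monogenic_coeffs_eq_self:
  assumes "fdirac c = (\<lambda>_. 0)"
  shows "monogenic_coeffs c = c"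
proof
  fix \<alpha>
  have "fdirac (restr k c) = (\<lambda>_. 0)" for k
  proof (cases k)
    case 0
    then show ?thesis using hom_0_fdirac[OF hom_restr] by simp
  next
    case (Suc l)
    then show ?thesis by (simp add: fdirac_restr assms) (simp add: restr_def)
  qed
  then show "monogenic_coeffs c \<alpha> = c \<alpha>"
    by (simp add: monogenic_coeffs_def fischer_proj_eq_self) (simp add: restr_def)
qed

text \<open>
  The homogeneous components of a monogenic series are monogenic, as the Dirac operator respects
  the grading.
\<close>

lemma fdirac_eq_0_if_monogenic:
  assumes c: "rapid c" and g: "monogenic (\<lambda>x. pseries c (complexify x))"
  shows "fdirac c = (\<lambda>_. 0)"
proof
  fix \<alpha>
  have "(\<lambda>k. reval k (fdirac c) x) sums 0" for x
  proof -
    have "(\<lambda>k. ceval k (fdirac c) (complexify x)) sums (\<Sum>j\<in>UNIV. cl_e j \<odot> pseries (pdiff j c) (complexify x))"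
      unfolding ceval_fdirac
      by (intro sums_sum bounded_linear.sums[OF cl.bounded_linear_right] pseries_sums rapid_pdiff c)
    also have "(\<Sum>j\<in>UNIV. cl_e j \<odot> pseries (pdiff j c) (complexify x)) = dirac (\<lambda>x. pseries c (complexify x)) x"
      by (simp add: dirac_def partial_deriv_pseries[OF c])
    also have "\<dots> = 0" using g by (simp add: monogenic_def)
    finally show ?thesis by (simp add: ceval_complexify)
  qed
  then have "\<forall>\<^sub>F x in nhds 0. (\<lambda>k. reval k (fdirac c) x) sums 0" by simp
  from reval_sums_0_imp[OF this] have "reval k (fdirac c) x = 0" for k x .
  from reval_eq_0_imp[OF this refl] show "fdirac c \<alpha> = 0" .
qed

theorem proposition4p6:
  fixes f g :: "'m rspace \<Rightarrow> 'm::{finite,linorder} clifford"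
  assumes f_def: "\<And>x. f x = exp (- (norm x)\<^sup>2 / 4) *\<^sub>R g x"
    and f_L2: "square_integrable f"
  shows
    "(\<forall>z. integrable lebesgue (\<lambda>x. exp (- (norm x)\<^sup>2 / 2) *\<^sub>R (fourier_borel z x \<odot> g x)) \<and>
          cmonogenic_part (segal_bargmann f) z =
            (1 / (2 * pi) powr (real CARD('m) / 2)) *\<^sub>R
              (LINT x|lebesgue. exp (- (norm x)\<^sup>2 / 2) *\<^sub>R (fourier_borel z x \<odot> g x))) \<and>
     (harmonic g \<longrightarrow>
        (\<forall>z. (1 / (2 * pi) powr (real CARD('m) / 2)) *\<^sub>R
               (LINT x|lebesgue. exp (- (norm x)\<^sup>2 / 2) *\<^sub>R (fourier_borel z x \<odot> g x)) =
             fischer_inner (\<lambda>x. cl_hconj (fourier_borel z x)) g)) \<and>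
     (monogenic g \<longrightarrow>
        is_holomorphic_extension g (holomorphic_extension g) \<and>
        (\<forall>z. cmonogenic_part (segal_bargmann f) z = holomorphic_extension g z))"
proof -
  define w where "w x = exp (- (norm x)\<^sup>2 / 2) *\<^sub>R g x" for x
  have "exp (- (norm x)\<^sup>2 / 4) *\<^sub>R f x = w x" for x
    by (simp add: w_def f_def flip: exp_add)
  then have w: "admissible_weight w"
    using admissible_weight_gaussian[OF f_L2] by simp
  define c where "c = sb_coeffs w"
  have c: "rapid c" unfolding c_def by (rule rapid_sb_coeffs[OF w])
  have B: "segal_bargmann f = pseries c"
    using segal_bargmann_eq_pseries[OF f_def] w unfolding c_def w_def by blast
  have ew: "exp (- (norm x)\<^sup>2 / 2) *\<^sub>R (fourier_borel z x \<odot> g x) = fourier_borel z x \<odot> w x" for z x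
    by (simp add: w_def cl.scaleR_right)
  have M: "cmonogenic_part (segal_bargmann f) = pseries (monogenic_coeffs c)"
    unfolding B by (rule cmonogenic_part_pseries[OF c])
  have I: "integrable lebesgue (\<lambda>x. fourier_borel z x \<odot> w x)"
    "gauss_const TYPE('m) *\<^sub>R (LINT x|lebesgue. fourier_borel z x \<odot> w x) = pseries (monogenic_coeffs c) z" for z
    unfolding c_def by (rule fourier_borel_integral[OF w])+
  have rep: "g = (\<lambda>x. pseries c (complexify x))"
    if "continuous_on UNIV g" "\<And>n y. n \<ge> 2 \<Longrightarrow> (LINT x|lborel. bump (2 * real n) n x *\<^sub>R g (y + x))
       = (LINT x|lborel. bump (2 * real n) n (x :: 'm rspace) *\<^sub>R g y)"
    using segal_bargmann_reproduces[OF f_def w[unfolded w_def] that] by (simp add: B fun_eq_iff)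
  have H: "fischer_inner (\<lambda>x. cl_hconj (fourier_borel z x)) g = pseries (monogenic_coeffs c) z"
    if "harmonic g" for z
  proof -
    have "g = (\<lambda>x. pseries c (complexify x))"
      using that by (intro rep mean_value_harmonic continuously_differentiable_imp_continuous)
        (simp_all add: harmonic_def)
    then show ?thesis using fischer_inner_fourier_borel[OF c] by simp
  qed
  have G: "is_holomorphic_extension g (pseries c)" "monogenic_coeffs c = c" if g: "monogenic g"
  proof -
    have eq: "g = (\<lambda>x. pseries c (complexify x))"
      using g by (intro rep mean_value_monogenic continuously_differentiable_imp_continuous)
        (simp_all add: monogenic_def)
    show "is_holomorphic_extension g (pseries c)"
      using fun_cong[OF eq] by (simp add: is_holomorphic_extension_def entire_pseries[OF c])
    have "monogenic (\<lambda>x. pseries c (complexify x))" using g eq by (simp only:)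
    from monogenic_coeffs_eq_self[OF fdirac_eq_0_if_monogenic[OF c this]]
    show "monogenic_coeffs c = c" .
  qed
  show ?thesis
    unfolding ew using I H G M holomorphic_extension_eq[OF G(1)] by auto
qed

end
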